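(* Let $M$ be a bounded Fréchet manifold modelled on a Fréchet space $F$. If $T^2M$ (with projection $\pi^2|_{T^2M}:T^2M\to M$) admits a vector bundle structure over $M$ isomorphic to $TM\oplus TM$, then there exists a linear connection on $M$.
   Context: **Metrics and Lipschitz linear maps.** A Fréchet space $(F,d)$ is a Fréchet space whose topology is defined by a complete translation-invariant metric $d$ with absolutely convex balls (a *standard metric* ); all Fréchet spaces carry a fixed standard metric, and finite products carry the maximum metric. Put $\|f\|_d:=d(f,0)$. For Fréchet spaces $(E,g)$, $(F,d)$, let $\mathcal L_{g,d}(E,F)$ be the set of linear maps $L:E\to F$ with $\|L\|_{g,d}:=\sup_{x\in E\setminus\{0\}}\|L x\|_d/\|x\|_g<\infty$, with the translation-invariant metric $D_{g,d}(L,H)=\|L-H\|_{g,d}$, which makes it an abelian topological group. Write $\mathcal L_d(F)=\mathcal L_{d,d}(F,F)$. Let $\mathcal L_{g,d}(E,F)_0$ be the connected component of $0$; with this metric it is a Fréchet space. **$MC^k$-maps.** Let $U\subseteq E$ be open and $P:U\to F$ continuous. $P$ is differentiable at $p$ if there is a linear map $\mathrm dP(p):E\to F$ with $\mathrm dP(p)h=\lim_{t\to0}(P(p+th)-P(p))/t$ for all $h\in E$. $P$ is Keller-differentiable if it is differentiable at all $p\in U$, each $\mathrm dP(p)$ is continuous, $p\mapsto \mathrm dP(p)$ is continuous into the space $CL(E,F)$ of continuous linear maps with the compact-open topology, and $U\times E\to F$, $(u,h)\mapsto \mathrm dP(u)h$, is continuous. $P$ is b-differentiable if it is Keller-differentiable,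 $\mathrm dP(p)\in\mathcal L_{g,d}(E,F)$ for all $p\in U$, and $P':U\to\mathcal L_{g,d}(E,F)$, $p\mapsto \mathrm dP(p)$, is continuous. $P$ is $MC^0$ if continuous, and $MC^1$ if b-differentiable. For $k\ge2$, $P$ is $MC^k$ if it is $MC^1$ and each $x_0\in U$ has a connected open neighborhood $V\subseteq U$ such that $P'|_V-P'(x_0):V\to\mathcal L_{g,d}(E,F)_0$ is $MC^{k-1}$. $P$ is $MC^\infty$ if it is $MC^k$ for all $k$. **Manifolds.** A bounded Fréchet manifold modelled on $F$ is a Hausdorff second countable space with an atlas $\{(U_\alpha,\varphi_\alpha)\}$ of charts with values in $F$ whose transition functions are $MC^\infty$. **Tangent bundles.** For $p\in M$ let $\mathcal{MC}_p(M)$ be the set of all $MC^\infty$-mappings $f:\mathbb R\to M$ with $f(0)=p$. Two such $f,g$ have the same $r$-jet at $p$ if the derivatives at $0$ of $\varphi_\alpha\circ f$ and $\varphi_\alpha\circ g$ of orders $1,\dots,r$ agree for a chart $\varphi_\alpha$ at $p$; the $r$-jet is denoted $j^r_pf$. $TM$ is the set of all 1-jets, with projection $\pi_M(j^1_pf)=p$ and charts $T\varphi_\alpha:\pi_M^{-1}(U_\alpha)\to\varphi_\alpha(U_\alpha)\times F$, $j^1_pf\mapsto(\varphi_\alpha(p),(\varphi_\alpha\circ f)'(0))$. For a map $h:M\to N$, $Th(j^1_pf)=j^1_{h(p)}(h\circ f)$. Applying this to $TM$ gives $\pi_2:T(TM)\to TM$ and $T\pi_M:T(TM)\to TM$; in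 charts, with $T(TM)$ locally $\varphi_\alpha(U_\alpha)\times F\times F\times F$, one has $\pi_2(f,g,h,k)=(f,g)$ and $T\pi_M(f,g,h,k)=(f,h)$. Put $\pi^2=\pi_M\circ T\pi_M:T(TM)\to M$. $T^2M$, the set of all 2-jets $j^2_pf$, is identified with the submanifold $\{\Upsilon\in T(TM)\mid \pi_2(\Upsilon)=T\pi_M(\Upsilon)\}$ of $T(TM)$, and $\pi^2|_{T^2M}:T^2M\to M$ is a fiber bundle. $TM\oplus TM$ is the Whitney sum over $M$. **Vector bundles.** An $MC^r$-vector bundle of type $E$ ($E$ a Fréchet space) over $M$ consists of an $MC^r$-manifold $V$ and an $MC^r$-map $\Pi:V\to M$ such that every fiber $V_m=\Pi^{-1}(m)$ is a Fréchet space isomorphic to $E$, and each $m\in M$ has an open neighborhood $U$ with a diffeomorphism $\phi_U=(\Pi|_{\Pi^{-1}(U)},\psi_U):\Pi^{-1}(U)\to U\times E$, where $\psi_U$ is linear on each $V_m$, $m\in U$. Writing $\phi_U\circ\phi_V^{-1}(x,v)=(x,\psi_{UV}(x)v)$, the map $(x,v)\mapsto(\psi_{UV}(x)v,\psi_{UV}(x)^{-1}v)$ on $(U\cap V)\times E$ is of class $MC^r$. Here $r=\infty$. **Connections.** A connection on $M$ is a (strengthened) connection map for $TM$, i.e. a map $\mathcal K:T(TM)\to TM$ determined by its local forms: in the charts of $T(TM)$ and $TM$ induced by $\varphi_\alpha$, it is the map $\varphi_\alpha(U_\alpha)\times F\times F\times F\to\varphi_\alpha(U_\alpha)\times F$,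 $(f,g,h,k)\mapsto(f,k+\tau_\alpha(f,g)h)$, for a family of mappings $\tau_\alpha:\varphi_\alpha(U_\alpha)\times F\to\mathcal L_d(F)^\times$, where $\mathcal L_d(F)^\times$ is the subset of invertible mappings in $\mathcal L_d(F)$, such that $\tau_\alpha$ is $MC^\infty$ in the sense that the map $(\varphi_\alpha(U_\alpha)\times F)\times F\to F\times F$, $(x,y,h)\mapsto(\tau_\alpha(x,y)(h),\tau_\alpha(x,y)^{-1}(h))$, is $MC^\infty$. The connection $\mathcal K$ is linear if it is linear on the fibers of $T\pi_M$ (locally the spaces $\{f\}\times F\times\{h\}\times F$); equivalently, the mappings $\tau_\alpha$ are linear in the second variable.
   Formalization: Local forms τ_α of a connection take values in L_d(F), not only invertible maps (linearity forces τ_α(f,0)=0), and the condition on τ_α^{-1} is dropped; curves defining jets are smooth with F-valued derivatives of all orders instead of MC^∞ maps R→M, so that tangent charts are onto φ(U)×F. *)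

theory Defs
  imports "HOL-Analysis.Analysis" "HOL-Library.Function_Algebras"
begin

section \<open>Frechet spaces with a standard metric\<close>

instantiation "fun" :: (type, real_vector) real_vector
begin

definition scaleR_fun :: "real \<Rightarrow> ('a \<Rightarrow> 'b) \<Rightarrow> 'a \<Rightarrow> 'b" where
  "scaleR_fun a f = (\<lambda>x. a *\<^sub>R f x)"

instance
  by standard (auto simp: scaleR_fun_def fun_eq_iff algebra_simps)

end

text \<open>
  A Frechet space is a linear subspace of some real vector space together with its standard
  metric, packed as a value of the library type of metrics. The carrier is explicit because
  the spaces of Lipschitz linear maps below are proper subsets of their function types.
  Balls are taken around 0, which by translation invariance determines all balls. Local
  convexity and continuity of addition follow from the clauses listed.
\<close>

definition frechet_space :: "'a::real_vector metric \<Rightarrow> bool" where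
  "frechet_space F \<longleftrightarrow>
     subspace (mspace F) \<and>
     mcomplete_of F \<and>
     (\<forall>x\<in>mspace F. \<forall>y\<in>mspace F. \<forall>z\<in>mspace F. mdist F (x + z) (y + z) = mdist F x y) \<and>
     (\<forall>r. convex (mball_of F 0 r) \<and>
          (\<forall>x\<in>mball_of F 0 r. \<forall>a. \<bar>a\<bar> \<le> 1 \<longrightarrow> a *\<^sub>R x \<in> mball_of F 0 r)) \<and>
     continuous_map (prod_topology euclideanreal (mtopology_of F)) (mtopology_of F)
       (\<lambda>(a, x). a *\<^sub>R x)"

definition max_metric :: "'a metric \<Rightarrow> 'b metric \<Rightarrow> ('a \<times> 'b) metric" where
  "max_metric E F = metric (mspace E \<times> mspace F,
     \<lambda>(x, y) (x', y'). max (mdist E x x') (mdist F y y'))"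

section \<open>Lipschitz linear maps\<close>

text \<open>
  From here on, the domain \<open>E\<close> of a linear or differentiable map is always a Frechet space
  whose carrier is its whole type; the target may be any Frechet space.
\<close>

definition Lip_quotients ::
  "'e::real_vector metric \<Rightarrow> 'x::real_vector metric \<Rightarrow> ('e \<Rightarrow> 'x) \<Rightarrow> real set" where
  "Lip_quotients E X L = {mdist X (L x) 0 / mdist E x 0 | x. x \<noteq> 0}"

definition Lip_maps ::
  "'e::real_vector metric \<Rightarrow> 'x::real_vector metric \<Rightarrow> ('e \<Rightarrow> 'x) set" where
  "Lip_maps E X = {L. linear L \<and> range L \<subseteq> mspace X \<and> bdd_above (Lip_quotients E X L)}"

text \<open>The element 0 is inserted only to get norm 0 when \<open>E\<close> is the zero space.\<close>

definition Lip_norm ::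
  "'e::real_vector metric \<Rightarrow> 'x::real_vector metric \<Rightarrow> ('e \<Rightarrow> 'x) \<Rightarrow> real" where
  "Lip_norm E X L = Sup (insert 0 (Lip_quotients E X L))"

text \<open>
  The library requires a metric to be nonnegative and symmetric also outside of its carrier,
  hence the conditional.
\<close>

definition Lip_metric ::
  "'e::real_vector metric \<Rightarrow> 'x::real_vector metric \<Rightarrow> ('e \<Rightarrow> 'x) metric" where
  "Lip_metric E X = metric (Lip_maps E X,
     \<lambda>L H. if L \<in> Lip_maps E X \<and> H \<in> Lip_maps E X then Lip_norm E X (L - H) else 0)"

definition Lip_metric0 ::
  "'e::real_vector metric \<Rightarrow> 'x::real_vector metric \<Rightarrow> ('e \<Rightarrow> 'x) metric" where
  "Lip_metric0 E X = submetric (Lip_metric E X)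
     (connected_component_of_set (mtopology_of (Lip_metric E X)) 0)"

section \<open>Differentiability\<close>

definition cont_lin ::
  "'e::real_vector metric \<Rightarrow> 'x::real_vector metric \<Rightarrow> ('e \<Rightarrow> 'x) set" where
  "cont_lin E X = {L. linear L \<and> continuous_map (mtopology_of E) (mtopology_of X) L}"

definition compact_open ::
  "'e::real_vector metric \<Rightarrow> 'x::real_vector metric \<Rightarrow> ('e \<Rightarrow> 'x) topology" where
  "compact_open E X = topology_generated_by
     {{L \<in> cont_lin E X. L ` K \<subseteq> W} | K W.
        compactin (mtopology_of E) K \<and> openin (mtopology_of X) W}"

definition has_dir_deriv ::
  "'x::real_vector metric \<Rightarrow> ('e::real_vector \<Rightarrow> 'x) \<Rightarrow> 'e \<Rightarrow> 'e \<Rightarrow> 'x \<Rightarrow> bool" where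
  "has_dir_deriv X P p h v \<longleftrightarrow>
     limitin (mtopology_of X) (\<lambda>t::real. (P (p + t *\<^sub>R h) - P p) /\<^sub>R t) v (at 0)"

definition diff_at ::
  "'x::real_vector metric \<Rightarrow> ('e::real_vector \<Rightarrow> 'x) \<Rightarrow> 'e \<Rightarrow> bool" where
  "diff_at X P p \<longleftrightarrow> (\<exists>L. linear L \<and> (\<forall>h. has_dir_deriv X P p h (L h)))"

definition dd ::
  "'x::real_vector metric \<Rightarrow> ('e::real_vector \<Rightarrow> 'x) \<Rightarrow> 'e \<Rightarrow> 'e \<Rightarrow> 'x" where
  "dd X P p = (\<lambda>h. THE v. has_dir_deriv X P p h v)"

definition keller_diff ::
  "'e::real_vector metric \<Rightarrow> 'x::real_vector metric \<Rightarrow> 'e set \<Rightarrow> ('e \<Rightarrow> 'x) \<Rightarrow> bool" where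
  "keller_diff E X U P \<longleftrightarrow>
     openin (mtopology_of E) U \<and>
     continuous_map (subtopology (mtopology_of E) U) (mtopology_of X) P \<and>
     (\<forall>p\<in>U. diff_at X P p \<and> dd X P p \<in> cont_lin E X) \<and>
     continuous_map (subtopology (mtopology_of E) U) (compact_open E X) (dd X P) \<and>
     continuous_map (prod_topology (subtopology (mtopology_of E) U) (mtopology_of E))
       (mtopology_of X) (\<lambda>(u, h). dd X P u h)"

definition b_diff ::
  "'e::real_vector metric \<Rightarrow> 'x::real_vector metric \<Rightarrow> 'e set \<Rightarrow> ('e \<Rightarrow> 'x) \<Rightarrow> bool" where
  "b_diff E X U P \<longleftrightarrow>
     keller_diff E X U P \<and>
     (\<forall>p\<in>U. dd X P p \<in> Lip_maps E X) \<and>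
     continuous_map (subtopology (mtopology_of E) U) (mtopology_of (Lip_metric E X)) (dd X P)"

section \<open>Maps of class MC\<close>

text \<open>
  The recursion defining \<open>MC\<^sup>k\<close> replaces the target \<open>X\<close> by \<open>\<L>(E, X)\<^sub>0\<close>, whose type would be a
  new one at each step. All iterated targets over \<open>F\<close> are therefore realised inside the one type
  \<^typ>\<open>'e list \<Rightarrow> 'f\<close>: a vector \<open>v\<close> of \<open>F\<close> is the function with value \<open>v\<close> at the empty list and
  0 elsewhere, and a linear map \<open>L\<close> from \<open>E\<close> to such functions is the function sending
  \<open>x # xs\<close> to \<open>L x xs\<close> (and the empty list to 0). Both encodings are linear and injective,
  and the metrics are transported along them.
\<close>

definition base_code :: "'f::real_vector \<Rightarrow> 'e list \<Rightarrow> 'f" where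
  "base_code v = (\<lambda>xs. if xs = [] then v else 0)"

definition base_metric :: "'f::real_vector metric \<Rightarrow> ('e list \<Rightarrow> 'f) metric" where
  "base_metric F = metric (base_code ` mspace F, \<lambda>S T. mdist F (S []) (T []))"

definition map_code :: "('e \<Rightarrow> 'e list \<Rightarrow> 'f::real_vector) \<Rightarrow> 'e list \<Rightarrow> 'f" where
  "map_code L = (\<lambda>xs. case xs of [] \<Rightarrow> 0 | y # ys \<Rightarrow> L y ys)"

definition map_decode :: "('e list \<Rightarrow> 'f) \<Rightarrow> 'e \<Rightarrow> 'e list \<Rightarrow> 'f" where
  "map_decode T = (\<lambda>y ys. T (y # ys))"

definition map_code_metric ::
  "('e \<Rightarrow> 'e list \<Rightarrow> 'f::real_vector) metric \<Rightarrow> ('e list \<Rightarrow> 'f) metric" where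
  "map_code_metric m =
     metric (map_code ` mspace m, \<lambda>S T. mdist m (map_decode S) (map_decode T))"

fun MC_code :: "nat \<Rightarrow> 'e::real_vector metric \<Rightarrow> ('e list \<Rightarrow> 'f::real_vector) metric \<Rightarrow>
    'e set \<Rightarrow> ('e \<Rightarrow> 'e list \<Rightarrow> 'f) \<Rightarrow> bool" where
  "MC_code 0 E X U P \<longleftrightarrow> openin (mtopology_of E) U \<and>
     continuous_map (subtopology (mtopology_of E) U) (mtopology_of X) P"
| "MC_code (Suc 0) E X U P \<longleftrightarrow> b_diff E X U P"
| "MC_code (Suc (Suc k)) E X U P \<longleftrightarrow> b_diff E X U P \<and>
     (\<forall>x0\<in>U. \<exists>V. x0 \<in> V \<and> V \<subseteq> U \<and> openin (mtopology_of E) V \<and>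
        connectedin (mtopology_of E) V \<and>
        MC_code (Suc k) E (map_code_metric (Lip_metric0 E X)) V
          (\<lambda>x. map_code (dd X P x - dd X P x0)))"

definition MC :: "nat \<Rightarrow> 'e::real_vector metric \<Rightarrow> 'f::real_vector metric \<Rightarrow>
    'e set \<Rightarrow> ('e \<Rightarrow> 'f) \<Rightarrow> bool" where
  "MC k E F U P \<longleftrightarrow> MC_code k E (base_metric F) U (\<lambda>x. base_code (P x))"

definition MC_inf :: "'e::real_vector metric \<Rightarrow> 'f::real_vector metric \<Rightarrow>
    'e set \<Rightarrow> ('e \<Rightarrow> 'f) \<Rightarrow> bool" where
  "MC_inf E F U P \<longleftrightarrow> (\<forall>k. MC k E F U P)"

section \<open>Bounded Frechet manifolds\<close>

text \<open>
  A chart is a pair of its domain and a coordinate function, which is irrelevant outside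
  of the domain.
\<close>

record ('m, 'f) mfd =
  topo :: "'m topology"
  atlas :: "('m set \<times> ('m \<Rightarrow> 'f)) set"
  model :: "'f metric"

abbreviation pts :: "('m, 'f) mfd \<Rightarrow> 'm set" where
  "pts M \<equiv> topspace (topo M)"

definition bounded_frechet_manifold :: "'f::real_vector metric \<Rightarrow> ('m, 'f) mfd \<Rightarrow> bool" where
  "bounded_frechet_manifold F M \<longleftrightarrow>
     frechet_space F \<and> mspace F = UNIV \<and> model M = F \<and>
     Hausdorff_space (topo M) \<and> second_countable (topo M) \<and>
     (\<Union>(U, \<phi>)\<in>atlas M. U) = pts M \<and>
     (\<forall>(U, \<phi>)\<in>atlas M. openin (topo M) U \<and> openin (mtopology_of F) (\<phi> ` U) \<and>
        homeomorphic_map (subtopology (topo M) U) (subtopology (mtopology_of F) (\<phi> ` U)) \<phi>) \<and>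
     (\<forall>(U, \<phi>)\<in>atlas M. \<forall>(V, \<psi>)\<in>atlas M. MC_inf F F (\<phi> ` (U \<inter> V)) (\<psi> \<circ> inv_into U \<phi>))"

definition MC_map :: "('m, 'e::real_vector) mfd \<Rightarrow> ('n, 'f::real_vector) mfd \<Rightarrow>
    ('m \<Rightarrow> 'n) \<Rightarrow> bool" where
  "MC_map M N h \<longleftrightarrow>
     continuous_map (topo M) (topo N) h \<and>
     (\<forall>(U, \<phi>)\<in>atlas M. \<forall>(V, \<psi>)\<in>atlas N.
        MC_inf (model M) (model N) (\<phi> ` (U \<inter> h -` V)) (\<psi> \<circ> h \<circ> inv_into U \<phi>))"

definition MC_diffeo :: "('m, 'e::real_vector) mfd \<Rightarrow> ('n, 'f::real_vector) mfd \<Rightarrow>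
    ('m \<Rightarrow> 'n) \<Rightarrow> bool" where
  "MC_diffeo M N h \<longleftrightarrow>
     MC_map M N h \<and>
     (\<exists>g. MC_map N M g \<and> (\<forall>x\<in>pts M. g (h x) = x) \<and> (\<forall>y\<in>pts N. h (g y) = y))"

definition open_submfd :: "('m, 'f) mfd \<Rightarrow> 'm set \<Rightarrow> ('m, 'f) mfd" where
  "open_submfd M W = \<lparr>topo = subtopology (topo M) W,
     atlas = (\<lambda>(U, \<phi>). (U \<inter> W, \<phi>)) ` atlas M, model = model M\<rparr>"

definition space_mfd :: "'f metric \<Rightarrow> ('f, 'f) mfd" where
  "space_mfd E = \<lparr>topo = mtopology_of E, atlas = {(UNIV, id)}, model = E\<rparr>"

definition times_space :: "('m, 'f) mfd \<Rightarrow> 'e metric \<Rightarrow> ('m \<times> 'e, 'f \<times> 'e) mfd" where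
  "times_space M E = \<lparr>topo = prod_topology (topo M) (mtopology_of E),
     atlas = (\<lambda>(U, \<phi>). (U \<times> UNIV, \<lambda>(x, v). (\<phi> x, v))) ` atlas M,
     model = max_metric (model M) E\<rparr>"

section \<open>The tangent bundle\<close>

text \<open>
  Tangent vectors are 1-jets, i.e. equivalence classes of curves. Smoothness of a curve in a chart
  is meant in the usual sense for vector-valued functions of one real variable: the derivatives
  \<open>D 0, D 1, D 2, \<dots>\<close> of all orders exist as functions with values in the model space \<open>F\<close>. The
  Lipschitz condition of class MC is not imposed on the maps from the real line to \<open>F\<close> sending
  \<open>s\<close> to \<open>s\<close> times a derivative: a vector \<open>v\<close> for which \<open>d(s v, 0) / \<bar>s\<bar>\<close> is unbounded
  could then never be a velocity, and unless \<open>F\<close> is normable such \<open>v\<close> exist, so that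
  the tangent chart \<open>(\<phi>(p), (\<phi> \<circ> c)'(0))\<close> would not be onto \<open>\<phi>(U) \<times> F\<close>.
\<close>

definition smooth_curve :: "('m, 'f::real_vector) mfd \<Rightarrow> (real \<Rightarrow> 'm) \<Rightarrow> bool" where
  "smooth_curve M c \<longleftrightarrow>
     continuous_map euclideanreal (topo M) c \<and>
     (\<forall>(U, \<phi>)\<in>atlas M. \<exists>D :: nat \<Rightarrow> real \<Rightarrow> 'f.
        (\<forall>t\<in>c -` U. D 0 t = \<phi> (c t)) \<and>
        (\<forall>n. \<forall>t\<in>c -` U. has_dir_deriv (model M) (D n) t 1 (D (Suc n) t)))"

definition velocity :: "'f::real_vector metric \<Rightarrow> (real \<Rightarrow> 'f) \<Rightarrow> 'f" where
  "velocity F \<gamma> = (THE v. has_dir_deriv F \<gamma> 0 1 v)"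

definition same_1jet :: "('m, 'f::real_vector) mfd \<Rightarrow> (real \<Rightarrow> 'm) \<Rightarrow> (real \<Rightarrow> 'm) \<Rightarrow> bool" where
  "same_1jet M c c' \<longleftrightarrow> c 0 = c' 0 \<and>
     (\<exists>(U, \<phi>)\<in>atlas M. c 0 \<in> U \<and> velocity (model M) (\<phi> \<circ> c) = velocity (model M) (\<phi> \<circ> c'))"

definition jet1 :: "('m, 'f::real_vector) mfd \<Rightarrow> (real \<Rightarrow> 'm) \<Rightarrow> (real \<Rightarrow> 'm) set" where
  "jet1 M c = {c'. smooth_curve M c' \<and> same_1jet M c c'}"

definition tproj :: "(real \<Rightarrow> 'm) set \<Rightarrow> 'm" where
  "tproj \<xi> = (SOME c. c \<in> \<xi>) 0"

definition tchart :: "'f::real_vector metric \<Rightarrow> ('m \<Rightarrow> 'f) \<Rightarrow> (real \<Rightarrow> 'm) set \<Rightarrow> 'f \<times> 'f" where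
  "tchart F \<phi> \<xi> = (\<phi> (tproj \<xi>), velocity F (\<phi> \<circ> (SOME c. c \<in> \<xi>)))"

definition tangent_set :: "('m, 'f::real_vector) mfd \<Rightarrow> (real \<Rightarrow> 'm) set set" where
  "tangent_set M = jet1 M ` {c. smooth_curve M c}"

text \<open>The topology is the coarsest one for which the charts have open domains and are continuous.\<close>

definition tangent_bundle ::
  "('m, 'f::real_vector) mfd \<Rightarrow> ((real \<Rightarrow> 'm) set, 'f \<times> 'f) mfd" where
  "tangent_bundle M = \<lparr>
     topo = topology_generated_by
       {{\<xi>\<in>tangent_set M. tproj \<xi> \<in> U \<and> tchart (model M) \<phi> \<xi> \<in> W} | U \<phi> W.
          (U, \<phi>) \<in> atlas M \<and> openin (mtopology_of (max_metric (model M) (model M))) W},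
     atlas = (\<lambda>(U, \<phi>). ({\<xi>\<in>tangent_set M. tproj \<xi> \<in> U}, tchart (model M) \<phi>)) ` atlas M,
     model = max_metric (model M) (model M)\<rparr>"

definition tangent_map :: "('n, 'e::real_vector) mfd \<Rightarrow> ('m \<Rightarrow> 'n) \<Rightarrow>
    (real \<Rightarrow> 'm) set \<Rightarrow> (real \<Rightarrow> 'n) set" where
  "tangent_map N h \<xi> = jet1 N (h \<circ> (SOME c. c \<in> \<xi>))"

definition tvec :: "('m, 'f::real_vector) mfd \<Rightarrow> ('m \<Rightarrow> 'f) \<Rightarrow> (real \<Rightarrow> 'm) set \<Rightarrow> 'f" where
  "tvec M \<phi> \<xi> = snd (tchart (model M) \<phi> \<xi>)"

definition tangent_add :: "('m, 'f::real_vector) mfd \<Rightarrow>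
    (real \<Rightarrow> 'm) set \<Rightarrow> (real \<Rightarrow> 'm) set \<Rightarrow> (real \<Rightarrow> 'm) set" where
  "tangent_add M \<xi> \<eta> = (THE \<zeta>. \<zeta> \<in> tangent_set M \<and> tproj \<zeta> = tproj \<xi> \<and>
     (\<forall>(U, \<phi>)\<in>atlas M. tproj \<xi> \<in> U \<longrightarrow> tvec M \<phi> \<zeta> = tvec M \<phi> \<xi> + tvec M \<phi> \<eta>))"

definition tangent_scale :: "('m, 'f::real_vector) mfd \<Rightarrow>
    real \<Rightarrow> (real \<Rightarrow> 'm) set \<Rightarrow> (real \<Rightarrow> 'm) set" where
  "tangent_scale M a \<xi> = (THE \<zeta>. \<zeta> \<in> tangent_set M \<and> tproj \<zeta> = tproj \<xi> \<and>
     (\<forall>(U, \<phi>)\<in>atlas M. tproj \<xi> \<in> U \<longrightarrow> tvec M \<phi> \<zeta> = a *\<^sub>R tvec M \<phi> \<xi>))"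

section \<open>Second order tangent bundle and Whitney sum\<close>

type_synonym 'm tan = "(real \<Rightarrow> 'm) set"

definition ttchart :: "'f::real_vector metric \<Rightarrow> ('m \<Rightarrow> 'f) \<Rightarrow> 'm tan tan \<Rightarrow>
    ('f \<times> 'f) \<times> ('f \<times> 'f)" where
  "ttchart F \<phi> = tchart (max_metric F F) (tchart F \<phi>)"

definition pi2 :: "('m, 'f::real_vector) mfd \<Rightarrow> 'm tan tan \<Rightarrow> 'm" where
  "pi2 M \<Upsilon> = tproj (tangent_map M tproj \<Upsilon>)"

definition T2_set :: "('m, 'f::real_vector) mfd \<Rightarrow> 'm tan tan set" where
  "T2_set M =
     {\<Upsilon>\<in>pts (tangent_bundle (tangent_bundle M)). tproj \<Upsilon> = tangent_map M tproj \<Upsilon>}"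

text \<open>
  The equation \<open>\<pi>\<^sub>2 = T\<pi>\<^sub>M\<close> reads \<open>g = h\<close> in the chart \<open>(f, g, h, k)\<close> of the double tangent bundle;
  the submanifold charts are \<open>(f, g, k)\<close>.
\<close>

definition T2_bundle ::
  "('m, 'f::real_vector) mfd \<Rightarrow> ('m tan tan, 'f \<times> 'f \<times> 'f) mfd" where
  "T2_bundle M = \<lparr>
     topo = subtopology (topo (tangent_bundle (tangent_bundle M))) (T2_set M),
     atlas = (\<lambda>(U, \<phi>). ({\<Upsilon>\<in>T2_set M. pi2 M \<Upsilon> \<in> U},
        \<lambda>\<Upsilon>. case ttchart (model M) \<phi> \<Upsilon> of ((f, g), (h, k)) \<Rightarrow> (f, g, k))) ` atlas M,
     model = max_metric (model M) (max_metric (model M) (model M))\<rparr>"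

definition whitney_set :: "('m, 'f::real_vector) mfd \<Rightarrow> ('m tan \<times> 'm tan) set" where
  "whitney_set M = {(\<xi>, \<eta>). \<xi> \<in> tangent_set M \<and> \<eta> \<in> tangent_set M \<and> tproj \<xi> = tproj \<eta>}"

definition whitney_proj :: "'m tan \<times> 'm tan \<Rightarrow> 'm" where
  "whitney_proj = tproj \<circ> fst"

definition whitney_sum ::
  "('m, 'f::real_vector) mfd \<Rightarrow> ('m tan \<times> 'm tan, 'f \<times> 'f \<times> 'f) mfd" where
  "whitney_sum M = \<lparr>
     topo = subtopology (prod_topology (topo (tangent_bundle M)) (topo (tangent_bundle M)))
       (whitney_set M),
     atlas = (\<lambda>(U, \<phi>). ({\<omega>\<in>whitney_set M. whitney_proj \<omega> \<in> U},
        \<lambda>(\<xi>, \<eta>). (\<phi> (tproj \<xi>), tvec M \<phi> \<xi>, tvec M \<phi> \<eta>))) ` atlas M,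
     model = max_metric (model M) (max_metric (model M) (model M))\<rparr>"

definition whitney_add :: "('m, 'f::real_vector) mfd \<Rightarrow>
    'm tan \<times> 'm tan \<Rightarrow> 'm tan \<times> 'm tan \<Rightarrow> 'm tan \<times> 'm tan" where
  "whitney_add M = (\<lambda>(\<xi>, \<eta>) (\<xi>', \<eta>'). (tangent_add M \<xi> \<xi>', tangent_add M \<eta> \<eta>'))"

definition whitney_scale :: "('m, 'f::real_vector) mfd \<Rightarrow>
    real \<Rightarrow> 'm tan \<times> 'm tan \<Rightarrow> 'm tan \<times> 'm tan" where
  "whitney_scale M a = (\<lambda>(\<xi>, \<eta>). (tangent_scale M a \<xi>, tangent_scale M a \<eta>))"

section \<open>Vector bundles\<close>

text \<open>
  A vector bundle is given by the manifold \<open>V\<close>, the projection \<open>pr\<close>, and functions \<open>add\<close> and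
  \<open>scl\<close>, of which only the restrictions to the fibers matter.
\<close>

definition fiber :: "('v, 'g) mfd \<Rightarrow> ('v \<Rightarrow> 'm) \<Rightarrow> 'm \<Rightarrow> 'v set" where
  "fiber V pr m = {v\<in>pts V. pr v = m}"

definition linear_on_fiber :: "'v set \<Rightarrow> ('v \<Rightarrow> 'v \<Rightarrow> 'v) \<Rightarrow> (real \<Rightarrow> 'v \<Rightarrow> 'v) \<Rightarrow>
    ('w \<Rightarrow> 'w \<Rightarrow> 'w) \<Rightarrow> (real \<Rightarrow> 'w \<Rightarrow> 'w) \<Rightarrow> ('v \<Rightarrow> 'w) \<Rightarrow> bool" where
  "linear_on_fiber A add scl add' scl' \<theta> \<longleftrightarrow>
     (\<forall>v\<in>A. \<forall>w\<in>A. \<theta> (add v w) = add' (\<theta> v) (\<theta> w)) \<and>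
     (\<forall>a. \<forall>v\<in>A. \<theta> (scl a v) = scl' a (\<theta> v))"

text \<open>
  The closure conditions and the existence of a linear homeomorphism onto \<open>E\<close> say that the
  fiber, with its subspace topology, is a topological vector space isomorphic to \<open>E\<close>.
\<close>

definition frechet_fiber :: "'e::real_vector metric \<Rightarrow> ('v, 'g) mfd \<Rightarrow> ('v \<Rightarrow> 'm) \<Rightarrow>
    ('v \<Rightarrow> 'v \<Rightarrow> 'v) \<Rightarrow> (real \<Rightarrow> 'v \<Rightarrow> 'v) \<Rightarrow> 'm \<Rightarrow> bool" where
  "frechet_fiber E V pr add scl m \<longleftrightarrow>
     (\<forall>v\<in>fiber V pr m. \<forall>w\<in>fiber V pr m. add v w \<in> fiber V pr m) \<and>
     (\<forall>a. \<forall>v\<in>fiber V pr m. scl a v \<in> fiber V pr m) \<and>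
     (\<exists>\<theta>. linear_on_fiber (fiber V pr m) add scl (+) (*\<^sub>R) \<theta> \<and>
        homeomorphic_map (subtopology (topo V) (fiber V pr m)) (mtopology_of E) \<theta>)"

definition trivialization :: "'e::real_vector metric \<Rightarrow> ('m, 'f::real_vector) mfd \<Rightarrow>
    ('v, 'g::real_vector) mfd \<Rightarrow> ('v \<Rightarrow> 'm) \<Rightarrow> ('v \<Rightarrow> 'v \<Rightarrow> 'v) \<Rightarrow> (real \<Rightarrow> 'v \<Rightarrow> 'v) \<Rightarrow>
    'm set \<Rightarrow> ('v \<Rightarrow> 'e) \<Rightarrow> bool" where
  "trivialization E M V pr add scl U \<psi> \<longleftrightarrow>
     openin (topo M) U \<and>
     MC_diffeo (open_submfd V {v\<in>pts V. pr v \<in> U}) (times_space (open_submfd M U) E)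
       (\<lambda>v. (pr v, \<psi> v)) \<and>
     (\<forall>m\<in>U. linear_on_fiber (fiber V pr m) add scl (+) (*\<^sub>R) \<psi>)"

definition transition :: "('v, 'g) mfd \<Rightarrow> ('v \<Rightarrow> 'm) \<Rightarrow> ('v \<Rightarrow> 'e) \<Rightarrow> ('v \<Rightarrow> 'e) \<Rightarrow>
    'm \<Rightarrow> 'e \<Rightarrow> 'e" where
  "transition V pr \<psi> \<psi>' x v = \<psi> (inv_into (fiber V pr x) \<psi>' v)"

definition MC_vector_bundle :: "'e::real_vector metric \<Rightarrow> ('m, 'f::real_vector) mfd \<Rightarrow>
    ('v, 'g::real_vector) mfd \<Rightarrow> ('v \<Rightarrow> 'm) \<Rightarrow> ('v \<Rightarrow> 'v \<Rightarrow> 'v) \<Rightarrow> (real \<Rightarrow> 'v \<Rightarrow> 'v) \<Rightarrow>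
    bool" where
  "MC_vector_bundle E M V pr add scl \<longleftrightarrow>
     frechet_space E \<and> mspace E = UNIV \<and>
     bounded_frechet_manifold (model V) V \<and>
     MC_map V M pr \<and>
     (\<forall>m\<in>pts M. frechet_fiber E V pr add scl m) \<and>
     (\<exists>\<T>. (\<Union>(U, \<psi>)\<in>\<T>. U) = pts M \<and>
        (\<forall>(U, \<psi>)\<in>\<T>. trivialization E M V pr add scl U \<psi>) \<and>
        (\<forall>(U, \<psi>)\<in>\<T>. \<forall>(U', \<psi>')\<in>\<T>.
           MC_map (times_space (open_submfd M (U \<inter> U')) E) (space_mfd (max_metric E E))
             (\<lambda>(x, v). (transition V pr \<psi> \<psi>' x v, inv (transition V pr \<psi> \<psi>' x) v))))"

definition vector_bundle_iso :: "('m, 'f) mfd \<Rightarrow>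
    ('v, 'g::real_vector) mfd \<Rightarrow> ('v \<Rightarrow> 'm) \<Rightarrow> ('v \<Rightarrow> 'v \<Rightarrow> 'v) \<Rightarrow> (real \<Rightarrow> 'v \<Rightarrow> 'v) \<Rightarrow>
    ('w, 'h::real_vector) mfd \<Rightarrow> ('w \<Rightarrow> 'm) \<Rightarrow> ('w \<Rightarrow> 'w \<Rightarrow> 'w) \<Rightarrow> (real \<Rightarrow> 'w \<Rightarrow> 'w) \<Rightarrow>
    ('v \<Rightarrow> 'w) \<Rightarrow> bool" where
  "vector_bundle_iso M V pr add scl W pr' add' scl' \<Phi> \<longleftrightarrow>
     MC_diffeo V W \<Phi> \<and>
     (\<forall>v\<in>pts V. pr' (\<Phi> v) = pr v) \<and>
     (\<forall>m\<in>pts M. linear_on_fiber (fiber V pr m) add scl add' scl' \<Phi>)"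

section \<open>Linear connections\<close>

text \<open>
  \<open>\<tau>\<close> is the family of local forms, indexed by the charts. Its values are arbitrary elements of
  \<open>\<L>\<^sub>d(F)\<close>: requiring them to be invertible would exclude every linear connection on a nonempty
  manifold with \<open>F \<noteq> 0\<close>, because linearity forces \<open>\<tau> (U, \<phi>) x 0 = 0\<close>.
\<close>

definition connection_with :: "('m, 'f::real_vector) mfd \<Rightarrow>
    ('m set \<times> ('m \<Rightarrow> 'f) \<Rightarrow> 'f \<Rightarrow> 'f \<Rightarrow> 'f \<Rightarrow> 'f) \<Rightarrow> ('m tan tan \<Rightarrow> 'm tan) \<Rightarrow> bool" where
  "connection_with M \<tau> K \<longleftrightarrow>
     (\<forall>(U, \<phi>)\<in>atlas M.
        (\<forall>x\<in>\<phi> ` U. \<forall>y. \<tau> (U, \<phi>) x y \<in> Lip_maps (model M) (model M)) \<and>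
        MC_inf (max_metric (max_metric (model M) (model M)) (model M)) (model M)
          ((\<phi> ` U \<times> UNIV) \<times> UNIV) (\<lambda>((x, y), h). \<tau> (U, \<phi>) x y h) \<and>
        (\<forall>\<Upsilon>\<in>pts (tangent_bundle (tangent_bundle M)). pi2 M \<Upsilon> \<in> U \<longrightarrow>
           K \<Upsilon> \<in> tangent_set M \<and> tproj (K \<Upsilon>) \<in> U \<and>
           tchart (model M) \<phi> (K \<Upsilon>) =
             (case ttchart (model M) \<phi> \<Upsilon> of ((f, g), (h, k)) \<Rightarrow> (f, k + \<tau> (U, \<phi>) f g h))))"

text \<open>
  In the chart \<open>(f, g, h, k)\<close> the fibers of \<open>T\<pi>\<^sub>M\<close> are given by fixing \<open>f\<close> and \<open>h\<close>, with
  the vector space structure in \<open>(g, k)\<close>.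
\<close>

definition linear_connection :: "('m, 'f::real_vector) mfd \<Rightarrow> ('m tan tan \<Rightarrow> 'm tan) \<Rightarrow> bool" where
  "linear_connection M K \<longleftrightarrow>
     (\<exists>\<tau>. connection_with M \<tau> K \<and>
        (\<forall>(U, \<phi>)\<in>atlas M. \<forall>x\<in>\<phi> ` U. \<forall>h. linear (\<lambda>(g, k). k + \<tau> (U, \<phi>) x g h)))"

end

theory Submission
  imports Defs
begin

text \<open>
  In a chart the inverse of the given isomorphism and the isomorphism itself become mutually inverse
  maps \<open>\<Gamma>\<close> and \<open>\<Phi>\<close> of triples that preserve the first component. Coordinate changes act
  on \<open>T\<^sup>2M\<close> by \<open>(f, g, k) \<mapsto> (\<sigma> f, \<sigma>' g, \<sigma>' k + \<sigma>''(g, g))\<close> and on \<open>TM \<oplus> TM\<close> by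
  \<open>(f, a, b) \<mapsto> (\<sigma> f, \<sigma>' a, \<sigma>' b)\<close>, so the inhomogeneous quadratic term can be read off the second
  derivative of \<open>\<Phi>\<close> at the natural points \<open>(f, 0, 0)\<close>, once the first derivative there has been
  divided out: half the last component of \<open>d\<Gamma> (d\<^sup>2\<Phi> ((0, g, 0), (0, h, 0)))\<close> transforms like the
  local forms of a linear connection.

  That these local forms are again of class MC rests on describing such a map by its jet, the family of
  its iterated directional derivatives: these are multilinear, bounded by products of the values of
  the metric, and continuous in the corresponding operator metrics. For jets the chain rule is the
  formula of Faa di Bruno.
\<close>

section \<open>Translation-invariant metrics\<close>

text \<open>Why the points \<open>(f, 0, 0)\<close>: a coordinate change sends zero vectors to zero
  vectors and its quadratic term vanishes there, so these points correspond to each other in all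
  charts. Why one half: along a line the quadratic term grows like \<open>s^2 q\<close>, so its
  second derivative is \<open>2 q\<close>. The first derivative of \<open>\<Phi>\<close> at such a
  point need not be the identity on the fiber and acts on this term; the derivative of
  \<open>\<Gamma>\<close> strips it off again.

  Two obstacles shape the analysis. The metric is subadditive but not homogeneous, so a scalar
  factor cannot be divided out of a finished estimate: difference quotients have to be formed before
  anything is estimated. And the class MC is defined by a recursion through connected components of
  spaces of Lipschitz maps, so the way back from a jet to a map of class MC requires that
  derivatives lie in these components.\<close>

abbreviation nrm :: "'a::real_vector metric \<Rightarrow> 'a \<Rightarrow> real" where
  "nrm F x \<equiv> mdist F x 0"

text \<open>All estimates rest on these consequences of \<open>frechet_space\<close> for a full
  carrier. \<open>nrm\<close> is subadditive but not homogeneous; of homogeneity only monotonicity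
  under factors of modulus at most 1 survives.\<close>

definition standard_metric :: "'a::real_vector metric \<Rightarrow> bool" where
  "standard_metric F \<longleftrightarrow>
     mspace F = UNIV \<and>
     (\<forall>x y. mdist F x y = nrm F (x - y)) \<and>
     (\<forall>a x. \<bar>a\<bar> \<le> 1 \<longrightarrow> nrm F (a *\<^sub>R x) \<le> nrm F x) \<and>
     (\<forall>r x y u. 0 \<le> u \<longrightarrow> u \<le> 1 \<longrightarrow> nrm F x < r \<longrightarrow> nrm F y < r \<longrightarrow>
        nrm F (u *\<^sub>R x + (1 - u) *\<^sub>R y) < r) \<and>
     (\<forall>x. ((\<lambda>a. nrm F (a *\<^sub>R x)) \<longlongrightarrow> 0) (at 0))"

text \<open>Stated as a limit of real numbers along an arbitrary filter, so that sandwich arguments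
  apply directly.\<close>

definition tends :: "'a::real_vector metric \<Rightarrow> ('b \<Rightarrow> 'a) \<Rightarrow> 'a \<Rightarrow> 'b filter \<Rightarrow> bool" where
  "tends F f l G \<longleftrightarrow> ((\<lambda>t. nrm F (f t - l)) \<longlongrightarrow> 0) G"

lemma limitin_mtopology_of:
  "limitin (mtopology_of X) f l G \<longleftrightarrow>
     l \<in> mspace X \<and> (\<forall>\<epsilon>>0. \<forall>\<^sub>F t in G. f t \<in> mspace X \<and> mdist X (f t) l < \<epsilon>)"
  unfolding mtopology_of_def
  using Metric_space.limitin_metric[OF Metric_space_mspace_mdist[of X], of f l G] by auto

lemma openin_mtopology_of:
  "openin (mtopology_of X) U \<longleftrightarrow>
     U \<subseteq> mspace X \<and> (\<forall>x\<in>U. \<exists>r>0. \<forall>y\<in>mspace X. mdist X x y < r \<longrightarrow> y \<in> U)"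
proof -
  interpret Metric_space "mspace X" "mdist X" by simp
  show ?thesis
    unfolding mtopology_of_def openin_mtopology by (simp add: subset_eq Ball_def) (meson subsetD)
qed

lemma continuous_map_subtopology_mtopology_of:
  assumes "U \<subseteq> mspace E"
  shows "continuous_map (subtopology (mtopology_of E) U) (mtopology_of X) f \<longleftrightarrow>
    f ` U \<subseteq> mspace X \<and>
    (\<forall>x\<in>U. \<forall>\<epsilon>>0. \<exists>\<delta>>0. \<forall>y\<in>U. mdist E x y < \<delta> \<longrightarrow> mdist X (f x) (f y) < \<epsilon>)"
proof -
  have *: "subtopology (mtopology_of E) U = mtopology_of (submetric E U)"
    by (simp add: mtopology_of_submetric)
  interpret A: Metric_space "mspace (submetric E U)" "mdist (submetric E U)"
    by (rule Metric_space_mspace_mdist)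
  show ?thesis
    unfolding *
    using A.metric_continuous_map[OF Metric_space_mspace_mdist[of X], of f]
    unfolding mtopology_of_def mspace_submetric mdist_submetric Int_absorb2[OF assms]
    by (simp only: Ball_def imp_conjL)
qed

lemma atin_euclidean: "atin euclidean a = at a"
  by (rule filter_eq_iff[THEN iffD2])
     (auto simp: eventually_atin eventually_at_topological)

lemma frechet_space_imp_standard_metric:
  assumes "frechet_space F" "mspace F = UNIV"
  shows "standard_metric F"
proof -
  have inv: "mdist F (x + z) (y + z) = mdist F x y" for x y z
    using assms by (auto simp: frechet_space_def)
  have d: "mdist F x y = nrm F (x - y)" for x y
    using inv[of "x - y" y 0] by simp
  have n: "nrm F (-x) = nrm F x" for x
    using d[of 0 x] mdist_commute[of F 0 x] by simp
  have cv: "convex (mball_of F 0 r)"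
    and bal: "\<And>x a. x \<in> mball_of F 0 r \<Longrightarrow> \<bar>a\<bar> \<le> 1 \<Longrightarrow> a *\<^sub>R x \<in> mball_of F 0 r" for r
    using assms(1) unfolding frechet_space_def by blast+
  have b: "y \<in> mball_of F 0 r \<longleftrightarrow> nrm F y < r" for y r
    using assms(2) by (simp add: mdist_commute)
  \<comment> \<open>Balanced balls are given as open balls: a radius r with
    \<open>nrm F x < r < nrm F (a *\<^sub>R x)\<close> would put x inside the ball and its multiple
    outside.\<close>
  have le: "nrm F (a *\<^sub>R x) \<le> nrm F x" if "\<bar>a\<bar> \<le> 1" for a x
  proof (rule dense_le)
    fix r show "r \<le> nrm F x" if "r < nrm F (a *\<^sub>R x)" for r
      using bal[of x r a] b \<open>\<bar>a\<bar> \<le> 1\<close> that by (meson less_asym not_less)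
  qed
  have c: "nrm F (u *\<^sub>R x + (1 - u) *\<^sub>R y) < r"
    if "0 \<le> u" "u \<le> 1" "nrm F x < r" "nrm F y < r" for r x y u
    using cv[of r] that unfolding b[symmetric] convex_def by simp
  have "((\<lambda>a. nrm F (a *\<^sub>R x)) \<longlongrightarrow> 0) (at 0)" for x
  proof -
    have "continuous_map (prod_topology euclideanreal (mtopology_of F)) (mtopology_of F) (\<lambda>(a, x). a *\<^sub>R x)"
      using assms by (auto simp: frechet_space_def)
    moreover have "continuous_map euclideanreal (prod_topology euclideanreal (mtopology_of F)) (\<lambda>a. (a, x))"
      by (auto simp: continuous_map_pairwise o_def assms)
    ultimately have "continuous_map euclideanreal (mtopology_of F) (\<lambda>a. a *\<^sub>R x)"
      using continuous_map_compose[of euclideanreal _ "\<lambda>a. (a, x)" _ "\<lambda>(a, x). a *\<^sub>R x"] by (simp add: o_def)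
    then have "limitin (mtopology_of F) (\<lambda>a. a *\<^sub>R x) (0 *\<^sub>R x) (atin euclideanreal 0)"
      unfolding continuous_map_atin by (metis UNIV_I topspace_euclidean)
    then show ?thesis
      by (simp add: limitin_mtopology_of tendsto_iff assms atin_euclidean)
  qed
  then show ?thesis
    unfolding standard_metric_def using assms d le c by blast
qed

context
  fixes F :: "'a::real_vector metric"
  assumes F: "standard_metric F"
begin

lemma std_mspace [simp]: "mspace F = UNIV"
  using F by (simp add: standard_metric_def)

lemma mdist_eq_nrm: "mdist F x y = nrm F (x - y)"
  using F by (simp add: standard_metric_def)

lemma nrm_zero [simp]: "nrm F 0 = 0"
  by (simp add: F std_mspace)

lemma nrm_eq_0 [simp]: "nrm F x = 0 \<longleftrightarrow> x = 0"
  by (simp add: F std_mspace)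

lemma nrm_minus: "nrm F (- x) = nrm F x"
  using mdist_eq_nrm[of 0 x] by (simp add: mdist_commute)

lemma nrm_minus_commute: "nrm F (x - y) = nrm F (y - x)"
  using nrm_minus[of "x - y"] by simp

lemma nrm_add: "nrm F (x + y) \<le> nrm F x + nrm F y"
proof -
  have "mdist F (x + y) 0 \<le> mdist F (x + y) y + mdist F y 0"
    by (rule mdist_triangle) (auto simp: std_mspace)
  then show ?thesis using mdist_eq_nrm[of "x + y" y] by simp
qed

lemma nrm_diff: "nrm F (x - y) \<le> nrm F x + nrm F y"
  using nrm_add[of x "- y"] by (simp add: nrm_minus)

lemma nrm_diff_le: "nrm F x \<le> nrm F (x - y) + nrm F y"
  using nrm_add[of "x - y" y] by simp

lemma nrm_scaleR_le: "\<bar>a\<bar> \<le> 1 \<Longrightarrow> nrm F (a *\<^sub>R x) \<le> nrm F x"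
  using F by (auto simp: standard_metric_def)

lemma nrm_convex:
  "0 \<le> u \<Longrightarrow> u \<le> 1 \<Longrightarrow> nrm F x < r \<Longrightarrow> nrm F y < r \<Longrightarrow> nrm F (u *\<^sub>R x + (1 - u) *\<^sub>R y) < r"
  using F by (auto simp: standard_metric_def)

lemma nrm_scaleR_tendsto: "((\<lambda>a. nrm F (a *\<^sub>R x)) \<longlongrightarrow> 0) (at 0)"
  using F by (auto simp: standard_metric_def)

lemma nrm_of_nat: "nrm F (of_nat n *\<^sub>R x) \<le> of_nat n * nrm F x"
proof (induction n)
  case (Suc n)
  then show ?case using nrm_add[of x "of_nat n *\<^sub>R x"] by (simp add: algebra_simps)
qed simp

text \<open>Substitute for homogeneity: with n the least integer above |a|, the factor a / n has
  modulus at most 1, and subadditivity costs the factor n, which is at most |a| + 1.\<close>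

lemma nrm_scaleR_bound: "nrm F (a *\<^sub>R x) \<le> (\<bar>a\<bar> + 1) * nrm F x"
proof -
  define n where "n = nat \<lceil>\<bar>a\<bar>\<rceil>"
  have n: "\<bar>a\<bar> \<le> of_nat n" "of_nat n \<le> \<bar>a\<bar> + 1" unfolding n_def by linarith+
  show ?thesis
  proof (cases "n = 0")
    case True
    with n have "a = 0" by simp
    then show ?thesis by simp
  next
    case False
    have "nrm F (a *\<^sub>R x) = nrm F ((a / of_nat n) *\<^sub>R (of_nat n *\<^sub>R x))" using False by simp
    also have "\<dots> \<le> nrm F (of_nat n *\<^sub>R x)" using n False by (intro nrm_scaleR_le) (simp add: field_simps)
    also have "\<dots> \<le> of_nat n * nrm F x" by (rule nrm_of_nat)
    also have "\<dots> \<le> (\<bar>a\<bar> + 1) * nrm F x" using n by (intro mult_right_mono) auto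
    finally show ?thesis .
  qed
qed

lemma nrm_sum_list: "nrm F (sum_list xs) \<le> sum_list (map (nrm F) xs)"
  by (induction xs) (auto intro: order_trans[OF nrm_add] add_left_mono)

section \<open>Limits and directional derivatives in a translation-invariant metric\<close>

lemma tends_const: "tends F (\<lambda>t. c) c G"
  by (simp add: tends_def)

lemma tends_add:
  assumes "tends F f l G" "tends F g m G"
  shows "tends F (\<lambda>t. f t + g t) (l + m) G"
  unfolding tends_def
proof (rule tendsto_sandwich[OF _ _ tendsto_const])
  show "((\<lambda>t. nrm F (f t - l) + nrm F (g t - m)) \<longlongrightarrow> 0) G"
    using tendsto_add[OF assms[unfolded tends_def]] by simp
  have "nrm F (f t + g t - (l + m)) \<le> nrm F (f t - l) + nrm F (g t - m)" for t
    using nrm_add[of "f t - l" "g t - m"] by (simp add: algebra_simps)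
  then show "\<forall>\<^sub>F t in G. nrm F (f t + g t - (l + m)) \<le> nrm F (f t - l) + nrm F (g t - m)" by simp
qed simp

lemma tends_scaleR:
  assumes "tends F f l G"
  shows "tends F (\<lambda>t. a *\<^sub>R f t) (a *\<^sub>R l) G"
  unfolding tends_def
proof (rule tendsto_sandwich[OF _ _ tendsto_const])
  show "((\<lambda>t. (\<bar>a\<bar> + 1) * nrm F (f t - l)) \<longlongrightarrow> 0) G"
    using tendsto_mult_right_zero[OF assms[unfolded tends_def]] by simp
  have "nrm F (a *\<^sub>R f t - a *\<^sub>R l) \<le> (\<bar>a\<bar> + 1) * nrm F (f t - l)" for t
    using nrm_scaleR_bound[of a "f t - l"] by (simp add: algebra_simps)
  then show "\<forall>\<^sub>F t in G. nrm F (a *\<^sub>R f t - a *\<^sub>R l) \<le> (\<bar>a\<bar> + 1) * nrm F (f t - l)" by simp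
qed simp

lemma tends_diff:
  assumes "tends F f l G" "tends F g m G"
  shows "tends F (\<lambda>t. f t - g t) (l - m) G"
  using tends_add[OF assms(1) tends_scaleR[OF assms(2), of "-1"]] by simp

lemma tends_sum_list:
  assumes "\<And>x. x \<in> set xs \<Longrightarrow> tends F (f x) (l x) G"
  shows "tends F (\<lambda>t. \<Sum>x\<leftarrow>xs. f x t) (\<Sum>x\<leftarrow>xs. l x) G"
  using assms by (induction xs) (auto intro: tends_add tends_const)

lemma tends_unique:
  assumes "tends F f l G" "tends F f m G" "G \<noteq> bot"
  shows "l = m"
proof -
  have "tends F (\<lambda>t. f t - f t) (l - m) G" by (rule tends_diff[OF assms(1,2)])
  then have "((\<lambda>t. nrm F (m - l)) \<longlongrightarrow> 0) G" by (simp add: tends_def)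
  then have "nrm F (m - l) = 0" using assms(3) tendsto_unique tendsto_const by blast
  then show ?thesis by simp
qed

lemma tends_cong:
  assumes "tends F f l G" "\<forall>\<^sub>F t in G. f t = g t"
  shows "tends F g l G"
  using assms(1) unfolding tends_def
  by (rule Lim_transform_eventually) (use assms(2) in \<open>auto elim: eventually_mono\<close>)

lemma tends_nrm_bounded:
  assumes "tends F f l G"
  shows "\<forall>\<^sub>F t in G. nrm F (f t) \<le> nrm F l + 1"
proof -
  have "\<forall>\<^sub>F t in G. nrm F (f t - l) < 1"
    using order_tendstoD(2)[OF assms[unfolded tends_def], of 1] by simp
  then show ?thesis
  proof (rule eventually_mono)
    show "nrm F (f t) \<le> nrm F l + 1" if "nrm F (f t - l) < 1" for t
      using nrm_diff_le[of "f t" l] that by linarith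
  qed
qed

lemma tends_le:
  assumes "(g \<longlongrightarrow> 0) G" "\<forall>\<^sub>F t in G. nrm F (f t - l) \<le> g t"
  shows "tends F f l G"
  unfolding tends_def by (rule tendsto_sandwich[OF _ assms(2) tendsto_const assms(1)]) simp

lemma has_dir_deriv_iff_tends:
  "has_dir_deriv F P p h v \<longleftrightarrow> tends F (\<lambda>t. (P (p + t *\<^sub>R h) - P p) /\<^sub>R t) v (at 0)"
  unfolding has_dir_deriv_def limitin_mtopology_of tends_def tendsto_iff
  by (simp add: std_mspace mdist_eq_nrm[of _ v])

lemma has_dir_deriv_unique:
  "has_dir_deriv F P p h v \<Longrightarrow> has_dir_deriv F P p h w \<Longrightarrow> v = w"
  unfolding has_dir_deriv_iff_tends by (erule tends_unique) auto

lemma has_dir_deriv_the: "has_dir_deriv F P p h v \<Longrightarrow> (THE v. has_dir_deriv F P p h v) = v"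
  using has_dir_deriv_unique by blast

lemma has_dir_deriv_cong_ev:
  assumes "has_dir_deriv F P p h v" "\<forall>\<^sub>F t in at 0. P (p + t *\<^sub>R h) = Q (p + t *\<^sub>R h)" "P p = Q p"
  shows "has_dir_deriv F Q p h v"
  using assms(1) unfolding has_dir_deriv_iff_tends
  by (rule tends_cong) (use assms(2,3) in \<open>auto elim: eventually_mono\<close>)

text \<open>For a metric with convex balls, the difference quotients over adjacent intervals
  combine convexly, so a bound on the derivative passes to all of \<open>[0, 1]\<close> by bisection.\<close>

lemma mean_value:
  assumes "\<And>t. 0 \<le> t \<Longrightarrow> t \<le> 1 \<Longrightarrow> has_dir_deriv F \<gamma> t 1 (\<gamma>' t) \<and> nrm F (\<gamma>' t) < r"
  shows "nrm F (\<gamma> 1 - \<gamma> (0::real)) < r"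
proof -
  \<comment> \<open>A bound on the slope over [a, b], vacuous for a degenerate interval.
    \<open>Bolzano\<close> wants it to pass to unions of adjacent intervals and to hold on all short
    intervals around each point.\<close>
  define P where "P a b \<longleftrightarrow> (a < b \<longrightarrow> nrm F ((\<gamma> b - \<gamma> a) /\<^sub>R (b - a)) < r)" for a b
  have "P 0 (1::real)"
  proof (rule Bolzano)
    fix a b c :: real
    assume *: "P a b" "P b c" "a \<le> b" "b \<le> c"
    show "P a c"
    proof (cases "a = b \<or> b = c")
      case False
      with * have lt: "a < b" "b < c" by auto
      define u where "u = (b - a) / (c - a)"
      have u: "0 \<le> u" "u \<le> 1" using lt by (auto simp: u_def field_simps)
      have u1: "1 - u = (c - b) / (c - a)" using lt by (simp add: u_def field_simps)
      have "u *\<^sub>R ((\<gamma> b - \<gamma> a) /\<^sub>R (b - a)) + (1 - u) *\<^sub>R ((\<gamma> c - \<gamma> b) /\<^sub>R (c - b))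
          = (1 / (c - a)) *\<^sub>R (\<gamma> b - \<gamma> a) + (1 / (c - a)) *\<^sub>R (\<gamma> c - \<gamma> b)"
        unfolding u1 using lt by (simp add: u_def)
      also have "\<dots> = (\<gamma> c - \<gamma> a) /\<^sub>R (c - a)"
        by (simp add: divide_inverse algebra_simps)
      finally show ?thesis
        using nrm_convex[OF u, of "(\<gamma> b - \<gamma> a) /\<^sub>R (b - a)" r "(\<gamma> c - \<gamma> b) /\<^sub>R (c - b)"] * lt
        by (simp add: P_def)
    qed (use * in auto)
  next
    fix x :: real
    assume x: "0 \<le> x" "x \<le> 1"
    have r: "nrm F (\<gamma>' x) < r" and
      D: "((\<lambda>t. nrm F ((\<gamma> (x + t) - \<gamma> x) /\<^sub>R t - \<gamma>' x)) \<longlongrightarrow> 0) (at 0)"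
      using assms[OF x] by (auto simp: has_dir_deriv_iff_tends tends_def)
    then obtain d where d: "d > 0" "\<And>t. t \<noteq> 0 \<Longrightarrow> \<bar>t\<bar> < d \<Longrightarrow>
        nrm F ((\<gamma> (x + t) - \<gamma> x) /\<^sub>R t - \<gamma>' x) < r - nrm F (\<gamma>' x)"
      using tendstoD[OF D, of "r - nrm F (\<gamma>' x)"]
      unfolding eventually_at by (auto simp: dist_real_def)
    have d': "nrm F ((\<gamma> (x + t) - \<gamma> x) /\<^sub>R t) < r" if "t \<noteq> 0" "\<bar>t\<bar> < d" for t
      using d(2)[OF that] nrm_diff_le[of "(\<gamma> (x + t) - \<gamma> x) /\<^sub>R t" "\<gamma>' x"] by linarith
    have "P a b" if ab: "a \<le> x" "x \<le> b" "b - a < d" for a b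
      unfolding P_def
    proof
      assume "a < b"
      define u where "u = (b - x) / (b - a)"
      have u: "0 \<le> u" "u \<le> 1" using ab \<open>a < b\<close> by (auto simp: u_def field_simps)
      have u1: "1 - u = (x - a) / (b - a)" using \<open>a < b\<close> by (simp add: u_def field_simps)
      \<comment> \<open>If x is an endpoint, one of the two slopes from x is degenerate. Its weight
        in the convex combination is then 0, and the other slope stands in for it so that the strict
        bound still holds.\<close>
      define y where "y = (if b = x then (\<gamma> a - \<gamma> x) /\<^sub>R (a - x) else (\<gamma> b - \<gamma> x) /\<^sub>R (b - x))"
      define z where "z = (if a = x then (\<gamma> b - \<gamma> x) /\<^sub>R (b - x) else (\<gamma> a - \<gamma> x) /\<^sub>R (a - x))"
      have yz: "nrm F y < r" "nrm F z < r"
        using d'[of "a - x"] d'[of "b - x"] ab \<open>a < b\<close> by (auto simp: y_def z_def)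
      have 1: "u *\<^sub>R y = (1 / (b - a)) *\<^sub>R (\<gamma> b - \<gamma> x)"
        using ab \<open>a < b\<close> by (simp add: y_def u_def divide_inverse)
      have "(x - a) *\<^sub>R z = \<gamma> x - \<gamma> a"
      proof (cases "a = x")
        case False
        have "(x - a) *\<^sub>R ((\<gamma> a - \<gamma> x) /\<^sub>R (a - x)) = ((x - a) / (a - x)) *\<^sub>R (\<gamma> a - \<gamma> x)"
          by (simp add: divide_inverse)
        also have "(x - a) / (a - x) = -1" using False by (simp add: field_simps)
        finally show ?thesis using False by (simp add: z_def)
      qed simp
      then have 2: "(1 - u) *\<^sub>R z = (1 / (b - a)) *\<^sub>R (\<gamma> x - \<gamma> a)"
        unfolding u1 by (metis divide_inverse_commute divide_inverse mult_1 scaleR_scaleR)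
      have "u *\<^sub>R y + (1 - u) *\<^sub>R z = (\<gamma> b - \<gamma> a) /\<^sub>R (b - a)"
        unfolding 1 2 by (simp add: divide_inverse algebra_simps)
      with nrm_convex[OF u yz] show "nrm F ((\<gamma> b - \<gamma> a) /\<^sub>R (b - a)) < r" by simp
    qed
    with d(1) show "\<exists>d>0. \<forall>a b. a \<le> x \<and> x \<le> b \<and> b - a < d \<longrightarrow> P a b" by blast
  qed simp
  then show ?thesis by (simp add: P_def)
qed

end

section \<open>Jets\<close>

abbreviation prod_nrm :: "'e::real_vector metric \<Rightarrow> 'e list \<Rightarrow> real" where
  "prod_nrm E hs \<equiv> prod_list (map (nrm E) hs)"

text \<open>\<open>D (h\<^sub>n # \<dots> # h\<^sub>1) x\<close> plays the role of the iterated directional derivative at \<open>x\<close>, the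
  last direction being \<open>h\<^sub>n\<close>.\<close>

definition jet :: "'e::real_vector metric \<Rightarrow> 'f::real_vector metric \<Rightarrow> 'e set \<Rightarrow>
    ('e list \<Rightarrow> 'e \<Rightarrow> 'f) \<Rightarrow> bool" where
  "jet E F U D \<longleftrightarrow> openin (mtopology_of E) U \<and>
     (\<forall>x\<in>U. \<forall>hs. linear (\<lambda>h. D (h # hs) x)) \<and>
     (\<forall>x\<in>U. \<forall>hs h. has_dir_deriv F (D hs) x h (D (h # hs) x)) \<and>
     (\<forall>x\<in>U. \<forall>n. \<exists>C\<ge>0. \<forall>hs. length hs = n \<longrightarrow> nrm F (D hs x) \<le> C * prod_nrm E hs) \<and>
     (\<forall>x\<in>U. \<forall>n. \<forall>\<epsilon>>0. \<exists>\<delta>>0. \<forall>y\<in>U. nrm E (y - x) < \<delta> \<longrightarrow>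
        (\<forall>hs. length hs = n \<longrightarrow> nrm F (D hs y - D hs x) \<le> \<epsilon> * prod_nrm E hs))"

lemma prod_nrm_nonneg [simp]: "0 \<le> prod_nrm E hs"
  by (induction hs) auto

lemma prod_list_nrm_nonneg [simp]: "0 \<le> prod_list (map (nrm E \<circ> f) is)"
  by (induction "is") auto

text \<open>The terms of the product rule for a multilinear map: each list differs from
  \<open>map f is\<close> in exactly one slot, which carries its value under g.\<close>

fun repl :: "('i \<Rightarrow> 'a) \<Rightarrow> ('i \<Rightarrow> 'a) \<Rightarrow> 'i list \<Rightarrow> 'a list list" where
  "repl f g [] = []"
| "repl f g (i # is) = (g i # map f is) # map ((#) (f i)) (repl f g is)"

lemma map_repl: "map (map k) (repl f g is) = repl (k \<circ> f) (k \<circ> g) is"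
proof (induction "is")
  case (Cons i "is")
  have "map (map k) (map ((#) (f i)) (repl f g is)) = map ((#) (k (f i))) (map (map k) (repl f g is))"
    by simp
  then show ?case using Cons by simp
qed simp

lemma tends_epsI:
  assumes "standard_metric F" "K \<ge> 0" "\<And>\<epsilon>. \<epsilon> > 0 \<Longrightarrow> \<forall>\<^sub>F t in G. nrm F (f t - l) \<le> \<epsilon> * K"
  shows "tends F f l G"
  unfolding tends_def
proof (rule tendstoI)
  fix e :: real assume "e > 0"
  \<comment> \<open>K may be 0, hence the denominator K + 1.\<close>
  then have "e / (K + 1) > 0" using assms(2) by simp
  from assms(3)[OF this] show "\<forall>\<^sub>F x in G. dist (nrm F (f x - l)) 0 < e"
  proof (rule eventually_mono)
    fix t assume "nrm F (f t - l) \<le> e / (K + 1) * K"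
    also have "\<dots> < e" using assms(2) \<open>e > 0\<close> by (simp add: field_simps)
    finally show "dist (nrm F (f t - l)) 0 < e" by simp
  qed
qed

lemma open_nrm:
  assumes "standard_metric E"
  shows "openin (mtopology_of E) U \<longleftrightarrow> (\<forall>x\<in>U. \<exists>r>0. \<forall>y. nrm E (y - x) < r \<longrightarrow> y \<in> U)"
  unfolding openin_mtopology_of
  using assms mdist_eq_nrm[OF assms] mdist_commute[of E] by (simp add: std_mspace)

lemma tends_quotient_imp_tends:
  assumes E: "standard_metric E" and q: "tends E (\<lambda>t. (y t - x) /\<^sub>R t) v (at (0::real))"
  shows "tends E y x (at 0)"
proof (rule tends_le[OF E])
  show "((\<lambda>t. nrm E ((y t - x) /\<^sub>R t - v) + nrm E (t *\<^sub>R v)) \<longlongrightarrow> 0) (at 0)"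
    using tendsto_add[OF q[unfolded tends_def] nrm_scaleR_tendsto[OF E]] by simp
  have "nrm E (y t - x) \<le> nrm E ((y t - x) /\<^sub>R t - v) + nrm E (t *\<^sub>R v)" if "t \<noteq> 0" "\<bar>t\<bar> \<le> 1" for t
  proof -
    have "y t - x = t *\<^sub>R ((y t - x) /\<^sub>R t - v) + t *\<^sub>R v" using that by (simp add: algebra_simps)
    then show ?thesis
      using nrm_add[OF E, of "t *\<^sub>R ((y t - x) /\<^sub>R t - v)" "t *\<^sub>R v"]
        nrm_scaleR_le[OF E that(2), of "(y t - x) /\<^sub>R t - v"] by simp
  qed
  then show "\<forall>\<^sub>F t in at 0. nrm E (y t - x) \<le> nrm E ((y t - x) /\<^sub>R t - v) + nrm E (t *\<^sub>R v)"
    unfolding eventually_at by (intro exI[of _ 1]) (auto simp: dist_real_def)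
qed

section \<open>Multilinearity, chain rule and product rule for jets\<close>

context
  fixes E :: "'e::real_vector metric" and F :: "'f::real_vector metric" and U D
  assumes E: "standard_metric E" and F: "standard_metric F" and J: "jet E F U D"
begin

lemma jet_open: "openin (mtopology_of E) U"
  using J by (simp add: jet_def)

lemma jet_linear_hd: "x \<in> U \<Longrightarrow> linear (\<lambda>h. D (h # hs) x)"
  using J by (simp add: jet_def)

lemma jet_deriv: "x \<in> U \<Longrightarrow> has_dir_deriv F (D hs) x h (D (h # hs) x)"
  using J by (simp add: jet_def)

lemma jet_bound:
  assumes "x \<in> U"
  obtains C where "C \<ge> 0" "\<And>hs. length hs = n \<Longrightarrow> nrm F (D hs x) \<le> C * prod_nrm E hs"
proof -
  have "\<exists>C\<ge>0. \<forall>hs. length hs = n \<longrightarrow> nrm F (D hs x) \<le> C * prod_nrm E hs"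
    using J assms by (simp add: jet_def)
  then show thesis using that by auto
qed

lemma jet_nbhd:
  assumes "x \<in> U"
  obtains r where "r > 0" "\<And>y. nrm E (y - x) < r \<Longrightarrow> y \<in> U"
  using jet_open assms by (auto simp: open_nrm[OF E])

lemma jet_cont:
  assumes "x \<in> U" "\<epsilon> > 0"
  obtains \<delta> where "\<delta> > 0" "\<And>y. nrm E (y - x) < \<delta> \<Longrightarrow> y \<in> U"
    "\<And>y hs. nrm E (y - x) < \<delta> \<Longrightarrow> length hs = n \<Longrightarrow> nrm F (D hs y - D hs x) \<le> \<epsilon> * prod_nrm E hs"
proof -
  obtain r where r: "r > 0" "\<And>y. nrm E (y - x) < r \<Longrightarrow> y \<in> U" using jet_nbhd[OF assms(1)] by blast
  have "\<exists>\<delta>>0. \<forall>y\<in>U. nrm E (y - x) < \<delta> \<longrightarrow>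
        (\<forall>hs. length hs = n \<longrightarrow> nrm F (D hs y - D hs x) \<le> \<epsilon> * prod_nrm E hs)"
    using J assms by (simp add: jet_def)
  then obtain \<delta> where "\<delta> > 0" "\<forall>y\<in>U. nrm E (y - x) < \<delta> \<longrightarrow>
        (\<forall>hs. length hs = n \<longrightarrow> nrm F (D hs y - D hs x) \<le> \<epsilon> * prod_nrm E hs)"
    by blast
  with r show thesis by (intro that[of "min r \<delta>"]) auto
qed

text \<open>A jet is linear in its newest direction by definition. Older slots inherit this: the
  difference quotients in a newer direction a are linear in h, and limits are unique.\<close>

lemma jet_linear:
  assumes "x \<in> U"
  shows "linear (\<lambda>h. D (as @ h # bs) x)"
proof (cases as)
  case Nil
  then show ?thesis using jet_linear_hd[OF assms] by simp
next
  have *: "\<forall>x\<in>U. linear (\<lambda>h. D (as @ h # bs) x)" for as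
  proof (induction as)
    case Nil
    show ?case using jet_linear_hd by simp
  next
    case (Cons a as)
    show ?case
    proof
      fix x assume x: "x \<in> U"
      obtain r where r: "r > 0" "\<And>y. nrm E (y - x) < r \<Longrightarrow> y \<in> U" using jet_nbhd[OF x] by blast
      have ev: "\<forall>\<^sub>F t in at 0. x + t *\<^sub>R a \<in> U"
        using order_tendstoD(2)[OF nrm_scaleR_tendsto[OF E, of a] r(1)]
        by (rule eventually_mono) (use r(2) in auto)
      have d: "has_dir_deriv F (\<lambda>y. D (as @ h # bs) y) x a (D (a # as @ h # bs) x)" for h
        using jet_deriv[OF x] by simp
      have lin: "linear (\<lambda>h. D (as @ h # bs) y)" if "y \<in> U" for y using Cons that by blast
      show "linear (\<lambda>h. D ((a # as) @ h # bs) x)"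
      proof (rule linearI)
        fix u v :: 'e
        have "has_dir_deriv F (\<lambda>y. D (as @ (u + v) # bs) y) x a (D (a # as @ u # bs) x + D (a # as @ v # bs) x)"
          unfolding has_dir_deriv_iff_tends[OF F]
          by (rule tends_cong[OF F tends_add[OF F d[of u, unfolded has_dir_deriv_iff_tends[OF F]]
             d[of v, unfolded has_dir_deriv_iff_tends[OF F]]]])
            (use ev in eventually_elim, simp add: lin[THEN linear_add] x algebra_simps)
        then show "D ((a # as) @ (u + v) # bs) x = D ((a # as) @ u # bs) x + D ((a # as) @ v # bs) x"
          using d[of "u + v"] has_dir_deriv_unique[OF F] by (metis append_Cons)
      next
        fix c :: real and u :: 'e
        have "has_dir_deriv F (\<lambda>y. D (as @ (c *\<^sub>R u) # bs) y) x a (c *\<^sub>R D (a # as @ u # bs) x)"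
          unfolding has_dir_deriv_iff_tends[OF F]
          by (rule tends_cong[OF F tends_scaleR[OF F d[of u, unfolded has_dir_deriv_iff_tends[OF F]]]])
            (use ev in eventually_elim, simp add: lin[THEN linear_cmul] x algebra_simps)
        then show "D ((a # as) @ (c *\<^sub>R u) # bs) x = c *\<^sub>R D ((a # as) @ u # bs) x"
          using d[of "c *\<^sub>R u"] has_dir_deriv_unique[OF F] by (metis append_Cons)
      qed
    qed
  qed
  show ?thesis using * assms by blast
qed

lemma jet_tends_U:
  assumes "x \<in> U" "tends E y x G"
  shows "\<forall>\<^sub>F t in G. y t \<in> U"
proof -
  obtain r where r: "r > 0" "\<And>y. nrm E (y - x) < r \<Longrightarrow> y \<in> U" using jet_nbhd[OF assms(1)] by blast
  show ?thesis
    using order_tendstoD(2)[OF assms(2)[unfolded tends_def] r(1)]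
    by (rule eventually_mono) (use r(2) in auto)
qed

text \<open>The difference quotient minus the derivative is the increment of a curve on [0, 1] whose
  velocity is a difference of values of the next derivative. Its continuity in the operator metric
  makes the bound uniform in the direction q and in the slots.\<close>

lemma jet_uniform_deriv:
  assumes x: "x \<in> U" and "\<epsilon> > 0"
  obtains \<delta> where "\<delta> > 0"
    "\<And>t q hs. t \<noteq> 0 \<Longrightarrow> nrm E (t *\<^sub>R q) < \<delta> \<Longrightarrow> length hs = n \<Longrightarrow>
       nrm F ((D hs (x + t *\<^sub>R q) - D hs x) /\<^sub>R t - D (q # hs) x) \<le> \<epsilon> * (nrm E q * prod_nrm E hs)"
proof -
  obtain \<delta> where \<delta>: "\<delta> > 0" "\<And>y. nrm E (y - x) < \<delta> \<Longrightarrow> y \<in> U"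
    "\<And>y hs. nrm E (y - x) < \<delta> \<Longrightarrow> length hs = Suc n \<Longrightarrow> nrm F (D hs y - D hs x) \<le> \<epsilon> * prod_nrm E hs"
    using jet_cont[OF assms, of "Suc n"] by blast
  show thesis
  proof (rule that[OF \<delta>(1)])
    fix t :: real and q :: 'e and hs :: "'e list"
    assume t: "t \<noteq> 0" and q: "nrm E (t *\<^sub>R q) < \<delta>" and hs: "length hs = n"
    define B where "B = \<epsilon> * (nrm E q * prod_nrm E hs)"
    \<comment> \<open>The factor 1 / t and the subtraction of the linear term are built into the
      curve, because without homogeneity a bound on the increment could not be divided by t
      afterwards.\<close>
    define \<gamma> where "\<gamma> s = (1 / t) *\<^sub>R D hs (x + (s * t) *\<^sub>R q) - s *\<^sub>R D (q # hs) x" for s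
    define \<gamma>' where "\<gamma>' s = D (q # hs) (x + (s * t) *\<^sub>R q) - D (q # hs) x" for s
    have s: "x + (s * t) *\<^sub>R q \<in> U" "nrm F (\<gamma>' s) \<le> B" if "0 \<le> s" "s \<le> 1" for s
    proof -
      have "nrm E (s *\<^sub>R (t *\<^sub>R q)) < \<delta>" using nrm_scaleR_le[OF E, of s "t *\<^sub>R q"] q that by simp
      then show "x + (s * t) *\<^sub>R q \<in> U" "nrm F (\<gamma>' s) \<le> B"
        using \<delta>(2)[of "x + (s * t) *\<^sub>R q"] \<delta>(3)[of "x + (s * t) *\<^sub>R q" "q # hs"] hs
        by (auto simp: \<gamma>'_def B_def)
    qed
    have d: "has_dir_deriv F \<gamma> s 1 (\<gamma>' s)" if "0 \<le> s" "s \<le> 1" for s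
    proof -
      let ?z = "x + (s * t) *\<^sub>R q"
      have z: "?z \<in> U" using s that by blast
      have "tends F (\<lambda>r. (1 / t) *\<^sub>R ((D hs (?z + r *\<^sub>R (t *\<^sub>R q)) - D hs ?z) /\<^sub>R r) - D (q # hs) x)
         ((1 / t) *\<^sub>R D ((t *\<^sub>R q) # hs) ?z - D (q # hs) x) (at 0)"
        by (intro tends_diff[OF F] tends_scaleR[OF F] tends_const[OF F]
           jet_deriv[OF z, unfolded has_dir_deriv_iff_tends[OF F]])
      also have "(1 / t) *\<^sub>R D ((t *\<^sub>R q) # hs) ?z - D (q # hs) x = \<gamma>' s"
        using linear_cmul[OF jet_linear_hd[OF z], of t q] t by (simp add: \<gamma>'_def)
      finally show ?thesis
        unfolding has_dir_deriv_iff_tends[OF F]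
        by (rule tends_cong[OF F])
          (auto simp: \<gamma>_def eventually_at algebra_simps intro!: exI[of _ 1])
    qed
    \<comment> \<open>The mean value inequality wants a strict bound, so it is used for every number
      above B.\<close>
    have "nrm F (\<gamma> 1 - \<gamma> 0) < B'" if "B' > B" for B'
      by (rule mean_value[OF F]) (use d s(2) that in force)
    then have "nrm F (\<gamma> 1 - \<gamma> 0) \<le> B" by (meson dense_ge less_imp_le)
    then show "nrm F ((D hs (x + t *\<^sub>R q) - D hs x) /\<^sub>R t - D (q # hs) x) \<le> \<epsilon> * (nrm E q * prod_nrm E hs)"
      by (simp add: \<gamma>_def B_def algebra_simps divide_inverse)
  qed
qed

text \<open>A moving direction is harmless because the remainder in \<open>jet_uniform_deriv\<close>
  is uniform in q: it is applied with q the quotient of y, whose values stay bounded near the limit.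
  Linearity and boundedness of the derivative then replace this q by v.\<close>

lemma jet_chain_rule:
  assumes x: "x \<in> U" and y: "tends E (\<lambda>t. (y t - x) /\<^sub>R t) v (at 0)"
  shows "tends F (\<lambda>t. (D hs (y t) - D hs x) /\<^sub>R t) (D (v # hs) x) (at 0)"
proof -
  let ?q = "\<lambda>t. (y t - x) /\<^sub>R t"
  obtain C where C: "C \<ge> 0" "\<And>ks. length ks = Suc (length hs) \<Longrightarrow> nrm F (D ks x) \<le> C * prod_nrm E ks"
    using jet_bound[OF x] by blast
  have 1: "tends F (\<lambda>t. (D hs (y t) - D hs x) /\<^sub>R t - D (?q t # hs) x) 0 (at 0)"
  proof (rule tends_epsI[OF F])
    show "0 \<le> (nrm E v + 1) * prod_nrm E hs" by simp
    fix \<epsilon> :: real assume "\<epsilon> > 0"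
    then obtain \<delta> where \<delta>: "\<delta> > 0" "\<And>t q. t \<noteq> 0 \<Longrightarrow> nrm E (t *\<^sub>R q) < \<delta> \<Longrightarrow>
       nrm F ((D hs (x + t *\<^sub>R q) - D hs x) /\<^sub>R t - D (q # hs) x) \<le> \<epsilon> * (nrm E q * prod_nrm E hs)"
      using jet_uniform_deriv[OF x, of \<epsilon> "length hs"] by metis
    have "\<forall>\<^sub>F t in at 0. nrm E (y t - x) < \<delta>"
      using order_tendstoD(2)[OF tends_quotient_imp_tends[OF E y, unfolded tends_def] \<delta>(1)] .
    moreover have "\<forall>\<^sub>F t in at 0. nrm E (?q t) \<le> nrm E v + 1" by (rule tends_nrm_bounded[OF E y])
    moreover have "\<forall>\<^sub>F t in at (0::real). t \<noteq> 0" by (simp add: eventually_at_filter)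
    ultimately show "\<forall>\<^sub>F t in at 0. nrm F ((D hs (y t) - D hs x) /\<^sub>R t - D (?q t # hs) x - 0)
         \<le> \<epsilon> * ((nrm E v + 1) * prod_nrm E hs)"
    proof eventually_elim
      case (elim t)
      have "nrm F ((D hs (y t) - D hs x) /\<^sub>R t - D (?q t # hs) x) \<le> \<epsilon> * (nrm E (?q t) * prod_nrm E hs)"
        using \<delta>(2)[of t "?q t"] elim by simp
      also have "\<dots> \<le> \<epsilon> * ((nrm E v + 1) * prod_nrm E hs)"
        using elim \<open>\<epsilon> > 0\<close> by (intro mult_left_mono mult_right_mono) auto
      finally show ?case by simp
    qed
  qed
  have 2: "tends F (\<lambda>t. D (?q t # hs) x) (D (v # hs) x) (at 0)"
  proof (rule tends_le[OF F])
    show "((\<lambda>t. C * prod_nrm E hs * nrm E (?q t - v)) \<longlongrightarrow> 0) (at 0)"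
      by (rule tendsto_mult_right_zero) (use y in \<open>simp add: tends_def\<close>)
    have "nrm F (D (?q t # hs) x - D (v # hs) x) \<le> C * prod_nrm E hs * nrm E (?q t - v)" for t
    proof -
      have "D (?q t # hs) x - D (v # hs) x = D ((?q t - v) # hs) x"
        by (rule linear_diff[OF jet_linear_hd[OF x, of hs], symmetric])
      then show ?thesis using C(2)[of "(?q t - v) # hs"] by (simp add: mult_ac)
    qed
    then show "\<forall>\<^sub>F t in at 0. nrm F (D (?q t # hs) x - D (v # hs) x) \<le> C * prod_nrm E hs * nrm E (?q t - v)"
      by simp
  qed
  show ?thesis using tends_add[OF F 1 2] by simp
qed

text \<open>The base point moves first, uniformly over bounded slots. Then the slots move to their
  limits one at a time; those already done are kept in the prefix \<open>as\<close>.\<close>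

lemma jet_tends:
  assumes x: "x \<in> U" and y: "tends E y x G" and f: "\<And>i. i \<in> set is \<Longrightarrow> tends E (f i) (l i) G"
  shows "tends F (\<lambda>t. D (as @ map (\<lambda>i. f i t) is) (y t)) (D (as @ map l is) x) G"
proof -
  obtain C where C: "C \<ge> 0" "\<And>ks. length ks = length as + length is \<Longrightarrow> nrm F (D ks x) \<le> C * prod_nrm E ks"
    using jet_bound[OF x] by blast
  have bd: "\<exists>K\<ge>0. \<forall>\<^sub>F t in G. prod_nrm E (map (\<lambda>i. f i t) js) \<le> K" if "set js \<subseteq> set is" for js
    using that
  proof (induction js)
    case (Cons j js)
    then obtain K where K: "K \<ge> 0" "\<forall>\<^sub>F t in G. prod_nrm E (map (\<lambda>i. f i t) js) \<le> K" by auto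
    have "\<forall>\<^sub>F t in G. nrm E (f j t) \<le> nrm E (l j) + 1" using Cons by (intro tends_nrm_bounded[OF E] f) auto
    with K(2) have "\<forall>\<^sub>F t in G. prod_nrm E (map (\<lambda>i. f i t) (j # js)) \<le> (nrm E (l j) + 1) * K"
    proof eventually_elim
      case (elim t)
      then show ?case by (auto intro!: mult_mono)
    qed
    then show ?case using K(1) by (intro exI[of _ "(nrm E (l j) + 1) * K"]) auto
  qed (auto intro: exI[of _ 1])
  have 1: "tends F (\<lambda>t. D (as @ map (\<lambda>i. f i t) is) (y t) - D (as @ map (\<lambda>i. f i t) is) x) 0 G"
  proof -
    obtain K where K: "K \<ge> 0" "\<forall>\<^sub>F t in G. prod_nrm E (map (\<lambda>i. f i t) is) \<le> K" using bd[of "is"] by auto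
    show ?thesis
    proof (rule tends_epsI[OF F])
      show "0 \<le> prod_nrm E as * K" using K by simp
      fix \<epsilon> :: real assume \<epsilon>: "\<epsilon> > 0"
      then obtain \<delta> where \<delta>: "\<delta> > 0" "\<And>y hs. nrm E (y - x) < \<delta> \<Longrightarrow> length hs = length as + length is \<Longrightarrow>
          nrm F (D hs y - D hs x) \<le> \<epsilon> * prod_nrm E hs"
        using jet_cont[OF x] by metis
      have "\<forall>\<^sub>F t in G. nrm E (y t - x) < \<delta>"
        using order_tendstoD(2)[OF y[unfolded tends_def] \<delta>(1)] .
      with K(2) show "\<forall>\<^sub>F t in G. nrm F (D (as @ map (\<lambda>i. f i t) is) (y t) - D (as @ map (\<lambda>i. f i t) is) x - 0)
          \<le> \<epsilon> * (prod_nrm E as * K)"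
      proof eventually_elim
        case (elim t)
        have "nrm F (D (as @ map (\<lambda>i. f i t) is) (y t) - D (as @ map (\<lambda>i. f i t) is) x)
            \<le> \<epsilon> * prod_nrm E (as @ map (\<lambda>i. f i t) is)"
          using \<delta>(2)[of "y t" "as @ map (\<lambda>i. f i t) is"] elim by simp
        also have "\<dots> \<le> \<epsilon> * (prod_nrm E as * K)"
          using elim \<epsilon> by (simp add: mult_left_mono)
        finally show ?case by simp
      qed
    qed
  qed
  have 2: "tends F (\<lambda>t. D (as @ map (\<lambda>i. f i t) js) x) (D (as @ map l js) x) G" if "set js \<subseteq> set is" for as js
    using that
    proof (induction js arbitrary: as)
      case Nil
      then show ?case by (simp add: tends_const[OF F])
    next
      case (Cons j js)
      obtain K where K: "K \<ge> 0" "\<forall>\<^sub>F t in G. prod_nrm E (map (\<lambda>i. f i t) js) \<le> K"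
        using bd[of js] Cons.prems by auto
      obtain C where C: "C \<ge> 0" "\<And>ks. length ks = length as + length (j # js) \<Longrightarrow> nrm F (D ks x) \<le> C * prod_nrm E ks"
        using jet_bound[OF x] by blast
      have a: "tends F (\<lambda>t. D (as @ (f j t - l j) # map (\<lambda>i. f i t) js) x) 0 G"
      proof (rule tends_le[OF F])
        have "tends E (f j) (l j) G" using f Cons.prems by auto
        then show "((\<lambda>t. C * prod_nrm E as * K * nrm E (f j t - l j)) \<longlongrightarrow> 0) G"
          by (intro tendsto_mult_right_zero) (simp add: tends_def)
        show "\<forall>\<^sub>F t in G. nrm F (D (as @ (f j t - l j) # map (\<lambda>i. f i t) js) x - 0)
            \<le> C * prod_nrm E as * K * nrm E (f j t - l j)"
          using K(2)
        proof eventually_elim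
          case (elim t)
          have "nrm F (D (as @ (f j t - l j) # map (\<lambda>i. f i t) js) x) \<le>
              C * (prod_nrm E as * (nrm E (f j t - l j) * prod_nrm E (map (\<lambda>i. f i t) js)))"
            using C(2)[of "as @ (f j t - l j) # map (\<lambda>i. f i t) js"] by simp
          also have "\<dots> \<le> C * (prod_nrm E as * (nrm E (f j t - l j) * K))"
            using elim C(1) by (intro mult_left_mono) auto
          finally show ?case by (simp add: mult_ac)
        qed
      qed
      have b: "tends F (\<lambda>t. D (as @ l j # map (\<lambda>i. f i t) js) x) (D (as @ l j # map l js) x) G"
        using Cons.IH[of "as @ [l j]"] Cons.prems by simp
      show ?case
        using tends_add[OF F a b] linear_diff[OF jet_linear[OF x]] by simp
    qed
  show ?thesis using tends_add[OF F 1 2[of "is" as]] by simp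
qed

text \<open>Product rule by telescoping. Linearity turns the increment of the first slot into a term
  containing its difference quotient, with base point and later slots still moving, and
  \<open>jet_tends\<close> gives its limit. What remains has \<open>l i\<close> fixed in that slot,
  so it is the induction hypothesis with a longer prefix \<open>as\<close>.\<close>

lemma jet_curve_deriv:
  assumes x: "x \<in> U" and y: "tends E (\<lambda>t. (y t - x) /\<^sub>R t) v (at 0)"
    and f: "\<And>i. i \<in> set is \<Longrightarrow> tends E (\<lambda>t. (f i t - l i) /\<^sub>R t) (f' i) (at 0)"
  shows "tends F (\<lambda>t. (D (as @ map (\<lambda>i. f i t) is) (y t) - D (as @ map l is) x) /\<^sub>R t)
    (D (v # as @ map l is) x + (\<Sum>L\<leftarrow>repl l f' is. D (as @ L) x)) (at 0)"
  using f
proof (induction "is" arbitrary: as)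
  case Nil
  then show ?case using jet_chain_rule[OF x y, of as] by simp
next
  case (Cons i "is")
  have yx: "tends E y x (at 0)" by (rule tends_quotient_imp_tends[OF E y])
  \<comment> \<open>The option type adjoins one slot to the moving ones: \<open>None\<close> carries
    the difference quotient, \<open>Some k\<close> the slot k.\<close>
  have a: "tends F (\<lambda>t. D (as @ map (\<lambda>j. (case j of None \<Rightarrow> \<lambda>t. (f i t - l i) /\<^sub>R t | Some k \<Rightarrow> f k) t) (None # map Some is)) (y t))
     (D (as @ map (\<lambda>j. case j of None \<Rightarrow> f' i | Some k \<Rightarrow> l k) (None # map Some is)) x) (at 0)"
  proof (rule jet_tends[OF x yx])
    fix j assume "j \<in> set (None # map Some is)"
    then show "tends E (case j of None \<Rightarrow> \<lambda>t. (f i t - l i) /\<^sub>R t | Some k \<Rightarrow> f k) (case j of None \<Rightarrow> f' i | Some k \<Rightarrow> l k) (at 0)"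
      using Cons.prems tends_quotient_imp_tends[OF E] by (auto split: option.split)
  qed
  have b: "tends F (\<lambda>t. (D ((as @ [l i]) @ map (\<lambda>i. f i t) is) (y t) - D ((as @ [l i]) @ map l is) x) /\<^sub>R t)
    (D (v # (as @ [l i]) @ map l is) x + (\<Sum>L\<leftarrow>repl l f' is. D ((as @ [l i]) @ L) x)) (at 0)"
    by (rule Cons.IH) (use Cons.prems in auto)
  have "tends F (\<lambda>t. (D (as @ map (\<lambda>i. f i t) (i # is)) (y t) - D (as @ map l (i # is)) x) /\<^sub>R t)
     (D (as @ f' i # map l is) x + (D (v # (as @ [l i]) @ map l is) x + (\<Sum>L\<leftarrow>repl l f' is. D ((as @ [l i]) @ L) x))) (at 0)"
  proof (rule tends_cong[OF F tends_add[OF F a[unfolded list.map map_map o_def option.case] b]])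
    have "\<forall>\<^sub>F t in at 0. y t \<in> U" by (rule jet_tends_U[OF x yx])
    then show "\<forall>\<^sub>F t in at 0. D (as @ (f i t - l i) /\<^sub>R t # map (\<lambda>k. f k t) is) (y t) +
         (D ((as @ [l i]) @ map (\<lambda>i. f i t) is) (y t) - D ((as @ [l i]) @ map l is) x) /\<^sub>R t =
         (D (as @ map (\<lambda>i. f i t) (i # is)) (y t) - D (as @ map l (i # is)) x) /\<^sub>R t"
    proof eventually_elim
      case (elim t)
      note L = jet_linear[OF elim, of as "map (\<lambda>k. f k t) is"]
      have "D (as @ (f i t - l i) /\<^sub>R t # map (\<lambda>k. f k t) is) (y t)
          = (D (as @ f i t # map (\<lambda>k. f k t) is) (y t) - D (as @ l i # map (\<lambda>k. f k t) is) (y t)) /\<^sub>R t"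
        using linear_cmul[OF L] linear_diff[OF L] by simp
      then show ?case by (simp add: algebra_simps)
    qed
  qed
  then show ?case by (simp add: o_def algebra_simps)
qed

end

lemma jetI:
  assumes "openin (mtopology_of E) U"
    and "\<And>x hs. x \<in> U \<Longrightarrow> linear (\<lambda>h. D (h # hs) x)"
    and "\<And>x hs h. x \<in> U \<Longrightarrow> has_dir_deriv F (D hs) x h (D (h # hs) x)"
    and "\<And>x n. x \<in> U \<Longrightarrow> \<exists>C\<ge>0. \<forall>hs. length hs = n \<longrightarrow> nrm F (D hs x) \<le> C * prod_nrm E hs"
    and "\<And>x n \<epsilon>. x \<in> U \<Longrightarrow> \<epsilon> > 0 \<Longrightarrow> \<exists>\<delta>>0. \<forall>y\<in>U. nrm E (y - x) < \<delta> \<longrightarrow>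
        (\<forall>hs. length hs = n \<longrightarrow> nrm F (D hs y - D hs x) \<le> \<epsilon> * prod_nrm E hs)"
  shows "jet E F U D"
  using assms by (simp add: jet_def)

lemma eventually_line_in_open:
  assumes E: "standard_metric E" and "openin (mtopology_of E) U" "x \<in> U"
  shows "\<forall>\<^sub>F t in at 0. x + t *\<^sub>R h \<in> U"
proof -
  obtain r where r: "r > 0" "\<And>y. nrm E (y - x) < r \<Longrightarrow> y \<in> U"
    using assms unfolding open_nrm[OF E] by auto
  show ?thesis
    using order_tendstoD(2)[OF nrm_scaleR_tendsto[OF E, of h] r(1)]
    by (rule eventually_mono) (use r(2) in auto)
qed

lemma jet_subset:
  assumes "jet E F U D" "V \<subseteq> U" "openin (mtopology_of E) V"
  shows "jet E F V D"
proof (rule jetI)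
  fix x n and \<epsilon> :: real assume "x \<in> V" "\<epsilon> > 0"
  then have "\<exists>\<delta>>0. \<forall>y\<in>U. nrm E (y - x) < \<delta> \<longrightarrow>
        (\<forall>hs. length hs = n \<longrightarrow> nrm F (D hs y - D hs x) \<le> \<epsilon> * prod_nrm E hs)"
    using assms(1,2) by (simp add: jet_def subset_iff)
  then show "\<exists>\<delta>>0. \<forall>y\<in>V. nrm E (y - x) < \<delta> \<longrightarrow>
        (\<forall>hs. length hs = n \<longrightarrow> nrm F (D hs y - D hs x) \<le> \<epsilon> * prod_nrm E hs)"
    using assms(2) by (metis subsetD)
qed (use assms in \<open>simp_all add: jet_def subset_iff\<close>)

subsection \<open>Linear maps and products\<close>

lemma jet_linear_map:
  assumes E: "standard_metric E" and F: "standard_metric F"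
    and l: "linear l" and b: "\<And>h. nrm F (l h) \<le> C * nrm E h" and C: "C \<ge> 0"
  shows "jet E F UNIV (\<lambda>hs x. case hs of [] \<Rightarrow> l x | h # ks \<Rightarrow> if ks = [] then l h else 0)"
    (is "jet E F UNIV ?D")
proof (rule jetI)
  show "openin (mtopology_of E) UNIV"
    using openin_topspace[of "mtopology_of E"] by (simp add: std_mspace[OF E])
  fix x
  show "linear (\<lambda>h. ?D (h # hs) x)" for hs
    using l by (cases hs) (auto simp: module_hom_zero)
  show "has_dir_deriv F (?D hs) x h (?D (h # hs) x)" for hs h
    unfolding has_dir_deriv_iff_tends[OF F]
  proof (rule tends_cong[OF F tends_const[OF F]])
    have "t \<noteq> 0 \<Longrightarrow> ?D (h # hs) x = (?D hs (x + t *\<^sub>R h) - ?D hs x) /\<^sub>R t" for t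
      using linear_add[OF l] linear_cmul[OF l] by (auto split: list.split)
    then show "\<forall>\<^sub>F t in at 0. ?D (h # hs) x = (?D hs (x + t *\<^sub>R h) - ?D hs x) /\<^sub>R t"
      by (simp add: eventually_at_filter)
  qed
  show "\<exists>K\<ge>0. \<forall>hs. length hs = n \<longrightarrow> nrm F (?D hs x) \<le> K * prod_nrm E hs" for n
    using b C nrm_zero[OF F]
    by (intro exI[of _ "max C (nrm F (l x))"])
      (auto split: list.splits intro!: order_trans[OF b] mult_right_mono)
  fix n and \<epsilon> :: real assume "\<epsilon> > 0"
  show "\<exists>\<delta>>0. \<forall>y\<in>UNIV. nrm E (y - x) < \<delta> \<longrightarrow>
        (\<forall>hs. length hs = n \<longrightarrow> nrm F (?D hs y - ?D hs x) \<le> \<epsilon> * prod_nrm E hs)"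
  proof (intro exI[of _ "\<epsilon> / (C + 1)"] conjI ballI impI allI)
    show "0 < \<epsilon> / (C + 1)" using \<open>\<epsilon> > 0\<close> C by simp
    fix y hs assume y: "nrm E (y - x) < \<epsilon> / (C + 1)"
    have "C * nrm E (y - x) \<le> \<epsilon>"
    proof -
      have "C * nrm E (y - x) \<le> (C + 1) * nrm E (y - x)" by (intro mult_right_mono) auto
      also have "\<dots> \<le> \<epsilon>" using y C by (simp add: field_simps)
      finally show ?thesis .
    qed
    then show "nrm F (?D hs y - ?D hs x) \<le> \<epsilon> * prod_nrm E hs"
      using b[of "y - x"] linear_diff[OF l, of y x] \<open>\<epsilon> > 0\<close> nrm_zero[OF F]
      by (cases hs) (auto intro: order_trans mult_nonneg_nonneg)
  qed
qed

lemma Metric_space_max_metric: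
  "Metric_space (mspace E \<times> mspace F) (\<lambda>(x, y) (x', y'). max (mdist E x x') (mdist F y y'))"
proof
  fix u v w :: "'a \<times> 'b"
  show "0 \<le> (case u of (x, y) \<Rightarrow> \<lambda>(x', y'). max (mdist E x x') (mdist F y y')) v"
    by (auto split: prod.split simp: le_max_iff_disj)
  show "(case u of (x, y) \<Rightarrow> \<lambda>(x', y'). max (mdist E x x') (mdist F y y')) v =
      (case v of (x, y) \<Rightarrow> \<lambda>(x', y'). max (mdist E x x') (mdist F y y')) u"
    by (auto split: prod.split simp: mdist_commute)
  assume u: "u \<in> mspace E \<times> mspace F" and v: "v \<in> mspace E \<times> mspace F"
  have nonneg: "max a b = 0 \<longleftrightarrow> a = 0 \<and> b = 0" if "a \<ge> 0" "b \<ge> 0" for a b :: real using that by auto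
  show "((case u of (x, y) \<Rightarrow> \<lambda>(x', y'). max (mdist E x x') (mdist F y y')) v = 0) = (u = v)"
    using u v by (auto split: prod.split simp: nonneg)
  assume w: "w \<in> mspace E \<times> mspace F"
  show "(case u of (x, y) \<Rightarrow> \<lambda>(x', y'). max (mdist E x x') (mdist F y y')) w
      \<le> (case u of (x, y) \<Rightarrow> \<lambda>(x', y'). max (mdist E x x') (mdist F y y')) v +
         (case v of (x, y) \<Rightarrow> \<lambda>(x', y'). max (mdist E x x') (mdist F y y')) w"
    using u v w mdist_triangle[of "fst u" E "fst v" "fst w"] mdist_triangle[of "snd u" F "snd v" "snd w"]
    by (auto split: prod.split)
qed

lemma mspace_max_metric [simp]: "mspace (max_metric E F) = mspace E \<times> mspace F"
  unfolding max_metric_def by (rule Metric_space.mspace_metric[OF Metric_space_max_metric])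

lemma mdist_max_metric: "mdist (max_metric E F) (x, y) (x', y') = max (mdist E x x') (mdist F y y')"
  unfolding max_metric_def by (subst Metric_space.mdist_metric[OF Metric_space_max_metric]) simp

lemma nrm_max_metric: "nrm (max_metric E F) z = max (nrm E (fst z)) (nrm F (snd z))"
  using mdist_max_metric[of E F "fst z" "snd z" 0 0] by (simp add: zero_prod_def)

lemma nrm_max_metric_Pair [simp]: "nrm (max_metric E F) (x, y) = max (nrm E x) (nrm F y)"
  by (simp add: nrm_max_metric)

lemma standard_metric_max_metric:
  assumes E: "standard_metric E" and F: "standard_metric F"
  shows "standard_metric (max_metric E F)"
  unfolding standard_metric_def
proof (intro conjI allI impI)
  show "mspace (max_metric E F) = UNIV" using E F by (simp add: std_mspace)
  show "mdist (max_metric E F) x y = nrm (max_metric E F) (x - y)" for x y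
    using mdist_max_metric[of E F "fst x" "snd x" "fst y" "snd y"]
    by (simp add: nrm_max_metric mdist_eq_nrm[OF E, of "fst x"] mdist_eq_nrm[OF F, of "snd x"])
  show "nrm (max_metric E F) (a *\<^sub>R x) \<le> nrm (max_metric E F) x" if "\<bar>a\<bar> \<le> 1" for a x
    using nrm_scaleR_le[OF E that, of "fst x"] nrm_scaleR_le[OF F that, of "snd x"]
    by (auto simp: nrm_max_metric)
  show "nrm (max_metric E F) (u *\<^sub>R x + (1 - u) *\<^sub>R y) < r"
    if "0 \<le> u" "u \<le> 1" "nrm (max_metric E F) x < r" "nrm (max_metric E F) y < r" for r x y u
    using that nrm_convex[OF E that(1,2), of "fst x" r "fst y"] nrm_convex[OF F that(1,2), of "snd x" r "snd y"]
    by (simp add: nrm_max_metric)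
  show "((\<lambda>a. nrm (max_metric E F) (a *\<^sub>R x)) \<longlongrightarrow> 0) (at 0)" for x
    using tendsto_max[OF nrm_scaleR_tendsto[OF E, of "fst x"] nrm_scaleR_tendsto[OF F, of "snd x"]]
    by (simp add: nrm_max_metric)
qed

lemma tends_max_metric:
  assumes E: "standard_metric E" and F: "standard_metric F"
  shows "tends (max_metric E F) f l G \<longleftrightarrow> tends E (\<lambda>t. fst (f t)) (fst l) G \<and> tends F (\<lambda>t. snd (f t)) (snd l) G"
proof
  assume *: "tends (max_metric E F) f l G"
  have "tends E (\<lambda>t. fst (f t)) (fst l) G"
    by (rule tends_le[OF E *[unfolded tends_def]]) (simp add: nrm_max_metric)
  moreover have "tends F (\<lambda>t. snd (f t)) (snd l) G"
    by (rule tends_le[OF F *[unfolded tends_def]]) (simp add: nrm_max_metric)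
  ultimately show "tends E (\<lambda>t. fst (f t)) (fst l) G \<and> tends F (\<lambda>t. snd (f t)) (snd l) G" ..
next
  assume "tends E (\<lambda>t. fst (f t)) (fst l) G \<and> tends F (\<lambda>t. snd (f t)) (snd l) G"
  then show "tends (max_metric E F) f l G"
    unfolding tends_def nrm_max_metric
    using tendsto_max[of "\<lambda>t. nrm E (fst (f t) - fst l)" 0 G "\<lambda>t. nrm F (snd (f t) - snd l)" 0] by simp
qed

lemma has_dir_deriv_max_metric:
  assumes E: "standard_metric E" and F: "standard_metric F"
  shows "has_dir_deriv (max_metric E F) f p h l \<longleftrightarrow>
    has_dir_deriv E (\<lambda>t. fst (f t)) p h (fst l) \<and> has_dir_deriv F (\<lambda>t. snd (f t)) p h (snd l)"
  unfolding has_dir_deriv_iff_tends[OF E] has_dir_deriv_iff_tends[OF F]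
    has_dir_deriv_iff_tends[OF standard_metric_max_metric[OF E F]]
  by (subst tends_max_metric[OF E F]) simp

lemma jet_Pair:
  assumes E: "standard_metric E" and F: "standard_metric F" and G: "standard_metric G"
    and J: "jet E F U D" "jet E G U D'"
  shows "jet E (max_metric F G) U (\<lambda>hs x. (D hs x, D' hs x))"
proof (rule jetI)
  show U: "openin (mtopology_of E) U" using J by (simp add: jet_def)
  fix x assume x: "x \<in> U"
  show "linear (\<lambda>h. (D (h # hs) x, D' (h # hs) x))" for hs
    using jet_linear_hd[OF E F J(1) x] jet_linear_hd[OF E G J(2) x]
    by (intro linearI) (auto dest: linear_add linear_cmul)
  show "has_dir_deriv (max_metric F G) (\<lambda>x. (D hs x, D' hs x)) x h (D (h # hs) x, D' (h # hs) x)" for hs h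
    using jet_deriv[OF E F J(1) x] jet_deriv[OF E G J(2) x]
    by (simp add: has_dir_deriv_max_metric[OF F G])
  fix n
  obtain C where C: "C \<ge> 0" "\<And>hs. length hs = n \<Longrightarrow> nrm F (D hs x) \<le> C * prod_nrm E hs"
    using jet_bound[OF E F J(1) x] by blast
  obtain C' where C': "C' \<ge> 0" "\<And>hs. length hs = n \<Longrightarrow> nrm G (D' hs x) \<le> C' * prod_nrm E hs"
    using jet_bound[OF E G J(2) x] by blast
  show "\<exists>K\<ge>0. \<forall>hs. length hs = n \<longrightarrow> nrm (max_metric F G) (D hs x, D' hs x) \<le> K * prod_nrm E hs"
    using C(1)
    by (intro exI[of _ "max C C'"])
      (auto intro!: order_trans[OF C(2)] order_trans[OF C'(2)] mult_right_mono)
  fix \<epsilon> :: real assume \<epsilon>: "\<epsilon> > 0"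
  obtain \<delta> where \<delta>: "\<delta> > 0" "\<And>y hs. nrm E (y - x) < \<delta> \<Longrightarrow> length hs = n \<Longrightarrow> nrm F (D hs y - D hs x) \<le> \<epsilon> * prod_nrm E hs"
    using jet_cont[OF E F J(1) x \<epsilon>] by metis
  obtain \<delta>' where \<delta>': "\<delta>' > 0" "\<And>y hs. nrm E (y - x) < \<delta>' \<Longrightarrow> length hs = n \<Longrightarrow> nrm G (D' hs y - D' hs x) \<le> \<epsilon> * prod_nrm E hs"
    using jet_cont[OF E G J(2) x \<epsilon>] by metis
  show "\<exists>\<delta>>0. \<forall>y\<in>U. nrm E (y - x) < \<delta> \<longrightarrow>
    (\<forall>hs. length hs = n \<longrightarrow> nrm (max_metric F G) ((D hs y, D' hs y) - (D hs x, D' hs x)) \<le> \<epsilon> * prod_nrm E hs)"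
    using \<delta> \<delta>' by (intro exI[of _ "min \<delta> \<delta>'"]) auto
qed

subsection \<open>Composition\<close>

text \<open>The formula of Faa di Bruno: \<open>fdb hs\<close> lists the partitions of the directions \<open>hs\<close>
  into blocks.\<close>

fun fdb :: "'e list \<Rightarrow> 'e list list list" where
  "fdb [] = [[]]"
| "fdb (h # hs) = concat (map (\<lambda>bs. ([h] # bs) # repl (\<lambda>b. b) ((#) h) bs) (fdb hs))"

lemma sum_list_map_concat: "(\<Sum>x\<leftarrow>concat xss. f x) = (\<Sum>xs\<leftarrow>xss. \<Sum>x\<leftarrow>xs. f x)"
  by (induction xss) auto

lemma set_repl:
  assumes "L \<in> set (repl (\<lambda>b. b) g is)"
  shows "length L = length is" "x \<in> set L \<Longrightarrow> x \<in> set is \<or> x \<in> g ` set is"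
  using assms by (induction "is" arbitrary: L) fastforce+

lemma length_repl [simp]: "length (repl f g is) = length is"
  by (induction "is") auto

lemma prod_list_repl:
  fixes p :: "'i list \<Rightarrow> real"
  assumes "L \<in> set (repl (\<lambda>b. b) ((#) h) bs)" "\<And>b. p (h # b) = c * p b"
  shows "prod_list (map p L) = c * prod_list (map p bs)"
  using assms(1) by (induction bs arbitrary: L) (auto simp: assms(2))

text \<open>Each direction lies in exactly one block, so estimates for the single blocks multiply to
  an estimate by all directions.\<close>

lemma fdb_props:
  assumes "bs \<in> set (fdb hs)"
  shows "length bs \<le> length hs" "b \<in> set bs \<Longrightarrow> length b \<le> length hs"
    "prod_list (map (prod_nrm E) bs) = prod_nrm E hs"
  using assms
proof (induction hs arbitrary: bs b)
  case (Cons h hs)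
  {
    case 1
    then show ?case using Cons.IH(1) by (auto dest!: set_repl(1) intro: le_SucI)
  next
    case 2
    then obtain cs where cs: "cs \<in> set (fdb hs)" "bs = [h] # cs \<or> bs \<in> set (repl (\<lambda>b. b) ((#) h) cs)" by auto
    show ?case using cs(2)
    proof
      assume "bs = [h] # cs"
      then show ?thesis using 2(1) Cons.IH(2)[OF _ cs(1)] by (auto intro: le_SucI)
    next
      assume "bs \<in> set (repl (\<lambda>b. b) ((#) h) cs)"
      then have "b \<in> set cs \<or> b \<in> (#) h ` set cs" using set_repl(2) 2 by metis
      then show ?thesis using Cons.IH(2)[OF _ cs(1)] by (auto intro: le_SucI)
    qed
  next
    case 3
    then obtain cs where cs: "cs \<in> set (fdb hs)" "bs = [h] # cs \<or> bs \<in> set (repl (\<lambda>b. b) ((#) h) cs)" by auto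
    then show ?case using Cons.IH(3)[OF cs(1)] prod_list_repl[of bs h cs "prod_nrm E" "nrm E h"] by auto
  }
qed auto

text \<open>A further direction extends a partition with m blocks in m + 1 ways, and m is at most
  the number of directions. The count is a Bell number; the factorial is a crude bound for
  it.\<close>

lemma length_fdb:
  fixes hs :: "'e::real_vector list"
  shows "length (fdb hs) \<le> fact (length hs)"
proof (induction hs)
  case (Cons h hs)
  have "length (fdb (h # hs)) = (\<Sum>bs\<leftarrow>fdb hs. Suc (length bs))"
    by (simp add: length_concat o_def)
  also have "\<dots> \<le> (\<Sum>bs\<leftarrow>fdb hs. Suc (length hs))"
    by (intro sum_list_mono) (auto dest: fdb_props(1))
  also have "\<dots> = length (fdb hs) * Suc (length hs)" by (simp add: sum_list_triv)
  also have "\<dots> \<le> fact (length hs) * Suc (length hs)" using Cons by (intro mult_right_mono) auto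
  finally show ?case by (simp add: algebra_simps)
qed simp

lemma sum_list_le_length:
  fixes f :: "'a \<Rightarrow> real" and c :: real
  assumes "\<And>x. x \<in> set xs \<Longrightarrow> f x \<le> c"
  shows "(\<Sum>x\<leftarrow>xs. f x) \<le> length xs * c"
  using assms
proof (induction xs)
  case (Cons x xs)
  then have "f x \<le> c" "(\<Sum>x\<leftarrow>xs. f x) \<le> length xs * c" by auto
  then show ?case by (simp add: algebra_simps)
qed simp

lemma linear_sum_list:
  assumes "\<And>x. x \<in> set xs \<Longrightarrow> linear (f x)"
  shows "linear (\<lambda>h. \<Sum>x\<leftarrow>xs. f x h)"
  using assms by (induction xs) (auto simp: module_hom_zero intro!: linear_compose_add)

text \<open>The blocks of a partition have different lengths, so composition needs one constant for
  all orders up to n.\<close>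

lemma jet_bound_le:
  assumes "standard_metric E" "standard_metric F" "jet E F U D" "x \<in> U"
  obtains C where "C \<ge> 1" "\<And>hs. length hs \<le> n \<Longrightarrow> nrm F (D hs x) \<le> C * prod_nrm E hs"
proof -
  have "\<exists>C\<ge>1. \<forall>hs. length hs \<le> n \<longrightarrow> nrm F (D hs x) \<le> C * prod_nrm E hs"
  proof (induction n)
    case 0
    show ?case by (intro exI[of _ "max 1 (nrm F (D [] x))"]) auto
  next
    case (Suc n)
    then obtain C where C: "C \<ge> 1" "\<And>hs. length hs \<le> n \<Longrightarrow> nrm F (D hs x) \<le> C * prod_nrm E hs" by auto
    obtain C' where C': "C' \<ge> 0" "\<And>hs. length hs = Suc n \<Longrightarrow> nrm F (D hs x) \<le> C' * prod_nrm E hs"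
      using jet_bound[OF assms] by blast
    have "nrm F (D hs x) \<le> max C C' * prod_nrm E hs" if "length hs \<le> Suc n" for hs
    proof (cases "length hs = Suc n")
      case True
      show ?thesis by (rule order_trans[OF C'(2)[OF True]]) (intro mult_right_mono, auto)
    next
      case False
      with that have "length hs \<le> n" by simp
      then show ?thesis by (rule order_trans[OF C(2)]) (intro mult_right_mono, auto)
    qed
    then show ?case using C(1) by (intro exI[of _ "max C C'"]) auto
  qed
  then show thesis using that by auto
qed

lemma jet_cont_le:
  assumes "standard_metric E" "standard_metric F" "jet E F U D" "x \<in> U" "\<epsilon> > 0"
  obtains \<delta> where "\<delta> > 0" "\<And>y hs. nrm E (y - x) < \<delta> \<Longrightarrow> length hs \<le> n \<Longrightarrow> nrm F (D hs y - D hs x) \<le> \<epsilon> * prod_nrm E hs"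
proof -
  have "\<exists>\<delta>>0. \<forall>y hs. nrm E (y - x) < \<delta> \<longrightarrow> length hs \<le> n \<longrightarrow> nrm F (D hs y - D hs x) \<le> \<epsilon> * prod_nrm E hs"
  proof (induction n)
    case 0
    obtain \<delta> where "\<delta> > 0" "\<And>y hs. nrm E (y - x) < \<delta> \<Longrightarrow> length hs = 0 \<Longrightarrow> nrm F (D hs y - D hs x) \<le> \<epsilon> * prod_nrm E hs"
      using jet_cont[OF assms] by metis
    then show ?case by auto
  next
    case (Suc n)
    then obtain \<delta> where \<delta>: "\<delta> > 0" "\<And>y hs. nrm E (y - x) < \<delta> \<Longrightarrow> length hs \<le> n \<Longrightarrow> nrm F (D hs y - D hs x) \<le> \<epsilon> * prod_nrm E hs"
      by auto
    obtain \<delta>' where \<delta>': "\<delta>' > 0" "\<And>y hs. nrm E (y - x) < \<delta>' \<Longrightarrow> length hs = Suc n \<Longrightarrow> nrm F (D hs y - D hs x) \<le> \<epsilon> * prod_nrm E hs"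
      using jet_cont[OF assms] by metis
    show ?case
      by (intro exI[of _ "min \<delta> \<delta>'"]) (use \<delta> \<delta>' in \<open>auto simp: le_Suc_eq\<close>)
  qed
  then show thesis using that by auto
qed

text \<open>Exchanging one slot at a time: each exchange costs \<open>\<eta> * p i\<close> in its
  own slot and at most \<open>K * p j\<close> in each other slot. The number of exchanges gives the
  factor \<open>length is\<close>; the prefix \<open>as\<close> holds slots already
  exchanged.\<close>

lemma jet_slots_lipschitz:
  fixes K \<eta> :: real
  assumes E: "standard_metric E" and F: "standard_metric F" and J: "jet E F U D" and x: "x \<in> U"
    and C: "\<And>ks. length ks = N \<Longrightarrow> nrm F (D ks x) \<le> C * prod_nrm E ks" "C \<ge> 0"
    and \<beta>: "\<And>i. i \<in> set is \<Longrightarrow> nrm E (\<beta>' i) \<le> K * p i" "\<And>i. i \<in> set is \<Longrightarrow> nrm E (\<beta> i) \<le> K * p i"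
      "\<And>i. i \<in> set is \<Longrightarrow> nrm E (\<beta>' i - \<beta> i) \<le> \<eta> * p i"
    and p: "\<And>i. p i \<ge> 0" and K: "K \<ge> 1" and \<eta>: "\<eta> \<ge> 0" and N: "length as + length is = N"
  shows "nrm F (D (as @ map \<beta>' is) x - D (as @ map \<beta> is) x)
    \<le> C * prod_nrm E as * prod_list (map p is) * (length is * \<eta> * K ^ length is)"
  using \<beta> N
proof (induction "is" arbitrary: as)
  case Nil
  then show ?case by (simp add: nrm_zero[OF F])
next
  case (Cons i "is")
  let ?P = "prod_list (map p is)" and ?A = "prod_nrm E as" and ?m = "length is"
  have P: "?P \<ge> 0" by (induction "is") (auto simp: p)
  have pl: "prod_nrm E (map \<beta>' is) \<le> K ^ ?m * ?P"
    using Cons.prems(1)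
  proof (induction "is")
    case (Cons j js)
    have "nrm E (\<beta>' j) * prod_nrm E (map \<beta>' js) \<le> (K * p j) * (K ^ length js * prod_list (map p js))"
      using Cons K p by (intro mult_mono) auto
    then show ?case by (simp add: mult_ac)
  qed simp
  have 1: "nrm F (D (as @ (\<beta>' i - \<beta> i) # map \<beta>' is) x) \<le> C * ?A * (p i * ?P) * (\<eta> * K ^ Suc ?m)"
  proof -
    have "nrm F (D (as @ (\<beta>' i - \<beta> i) # map \<beta>' is) x) \<le> C * (?A * (nrm E (\<beta>' i - \<beta> i) * prod_nrm E (map \<beta>' is)))"
      using C(1)[of "as @ (\<beta>' i - \<beta> i) # map \<beta>' is"] Cons.prems by simp
    also have "\<dots> \<le> C * (?A * ((\<eta> * p i) * (K ^ ?m * ?P)))"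
      using Cons.prems(3)[of i] pl C(2) \<eta> p P by (intro mult_left_mono mult_mono) auto
    also have "\<dots> \<le> C * (?A * ((\<eta> * p i) * (K ^ Suc ?m * ?P)))"
      using K C(2) \<eta> p P by (intro mult_left_mono mult_right_mono) auto
    finally show ?thesis by (simp add: mult_ac)
  qed
  have 2: "nrm F (D ((as @ [\<beta> i]) @ map \<beta>' is) x - D ((as @ [\<beta> i]) @ map \<beta> is) x)
    \<le> C * prod_nrm E (as @ [\<beta> i]) * ?P * (?m * \<eta> * K ^ ?m)"
    by (rule Cons.IH) (use Cons.prems in auto)
  also have "\<dots> \<le> C * (?A * (K * p i)) * ?P * (?m * \<eta> * K ^ ?m)"
    using Cons.prems(2)[of i] C(2) P \<eta> K by (auto intro!: mult_left_mono mult_right_mono)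
  finally have 3: "nrm F (D ((as @ [\<beta> i]) @ map \<beta>' is) x - D ((as @ [\<beta> i]) @ map \<beta> is) x)
    \<le> C * ?A * (p i * ?P) * (?m * \<eta> * K ^ Suc ?m)" by (simp add: mult_ac)
  have "D (as @ map \<beta>' (i # is)) x - D (as @ map \<beta> (i # is)) x = D (as @ (\<beta>' i - \<beta> i) # map \<beta>' is) x
     + (D ((as @ [\<beta> i]) @ map \<beta>' is) x - D ((as @ [\<beta> i]) @ map \<beta> is) x)"
    using linear_diff[OF jet_linear[OF E F J x, of as "map \<beta>' is"], of "\<beta>' i" "\<beta> i"] by simp
  then have "nrm F (D (as @ map \<beta>' (i # is)) x - D (as @ map \<beta> (i # is)) x)
    \<le> C * ?A * (p i * ?P) * (\<eta> * K ^ Suc ?m) + C * ?A * (p i * ?P) * (?m * \<eta> * K ^ Suc ?m)"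
    using nrm_add[OF F] 1 3 by (smt (verit))
  then show ?case by (simp add: algebra_simps)
qed

text \<open>For the linearity of the formula of Faa di Bruno in its newest direction, which enters
  each term of the product rule through exactly one slot.\<close>

lemma linear_slots:
  assumes D: "\<And>as bs. linear (\<lambda>h. D (as @ h # bs))" and g: "\<And>i. i \<in> set is \<Longrightarrow> linear (g i)"
  shows "linear (\<lambda>h. \<Sum>L\<leftarrow>repl l (\<lambda>i. g i h) is. D (as @ L))"
  using g
proof (induction "is" arbitrary: as)
  case (Cons i "is")
  have "linear (\<lambda>h. D (as @ g i h # map l is))"
    using linear_compose[OF Cons.prems[of i] D[of as "map l is"]] by (simp add: o_def)
  moreover have "linear (\<lambda>h. \<Sum>L\<leftarrow>repl l (\<lambda>i. g i h) is. D ((as @ [l i]) @ L))"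
    by (rule Cons.IH) (use Cons.prems in auto)
  ultimately show ?case using linear_compose_add by (fastforce simp: o_def)
qed (simp add: module_hom_zero)

lemma scaleR_sum_list:
  fixes f :: "'a \<Rightarrow> 'b::real_vector"
  shows "r *\<^sub>R (\<Sum>x\<leftarrow>xs. f x) = (\<Sum>x\<leftarrow>xs. r *\<^sub>R f x)"
  by (induction xs) (auto simp: algebra_simps)

text \<open>Differentiating one summand by \<open>jet_curve_deriv\<close>, the moving base point
  contributes the new block \<open>[h]\<close>, and the moving slot of a block b contributes the
  block \<open>h # b\<close>. This is the recursion of \<open>fdb\<close>, so the derivative of the
  sum is again such a sum.\<close>

lemma jet_compose:
  assumes E: "standard_metric E" and F: "standard_metric F" and G: "standard_metric G"
    and Q: "jet E F U DQ" and P: "jet F G V DP" and UV: "\<And>x. x \<in> U \<Longrightarrow> DQ [] x \<in> V"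
  shows "jet E G U (\<lambda>hs x. \<Sum>bs\<leftarrow>fdb hs. DP (map (\<lambda>b. DQ b x) bs) (DQ [] x))"
    (is "jet E G U ?D")
proof (rule jetI)
  show U: "openin (mtopology_of E) U" using Q by (simp add: jet_def)
  fix x assume x: "x \<in> U"
  let ?y = "DQ [] x" and ?l = "\<lambda>b. DQ b x"
  have y: "?y \<in> V" by (rule UV[OF x])
  have step: "?D (h # hs) x = (\<Sum>bs\<leftarrow>fdb hs. DP (DQ [h] x # map ?l bs) ?y +
      (\<Sum>L\<leftarrow>repl ?l (\<lambda>b. DQ (h # b) x) bs. DP L ?y))" for h hs
  proof -
    have "(\<Sum>bs'\<leftarrow>repl (\<lambda>b. b) ((#) h) bs. DP (map ?l bs') ?y) = (\<Sum>L\<leftarrow>repl ?l (\<lambda>b. DQ (h # b) x) bs. DP L ?y)" for bs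
    proof -
      have "repl ?l (\<lambda>b. DQ (h # b) x) bs = map (map ?l) (repl (\<lambda>b. b) ((#) h) bs)"
        unfolding map_repl by (simp add: o_def)
      then show ?thesis by (simp add: o_def)
    qed
    then show ?thesis by (simp add: sum_list_map_concat o_def)
  qed
  show "linear (\<lambda>h. ?D (h # hs) x)" for hs
    unfolding step
  proof (intro linear_sum_list linear_compose_add)
    fix bs assume "bs \<in> set (fdb hs)"
    show "linear (\<lambda>h. DP (DQ [h] x # map ?l bs) ?y)"
      using linear_compose[OF jet_linear_hd[OF E F Q x, of "[]"] jet_linear_hd[OF F G P y, of "map ?l bs"]]
      by (simp add: o_def)
    show "linear (\<lambda>h. \<Sum>L\<leftarrow>repl ?l (\<lambda>b. DQ (h # b) x) bs. DP L ?y)"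
      using linear_slots[where as="[]" and D="\<lambda>L. DP L ?y" and g="\<lambda>b h. DQ (h # b) x"]
        jet_linear[OF F G P y] jet_linear_hd[OF E F Q x] by simp
  qed
  show "has_dir_deriv G (?D hs) x h (?D (h # hs) x)" for hs h
    unfolding has_dir_deriv_iff_tends[OF G] step
  proof (rule tends_cong[OF G])
    have q: "tends F (\<lambda>t. (DQ b (x + t *\<^sub>R h) - DQ b x) /\<^sub>R t) (DQ (h # b) x) (at 0)" for b
      using jet_deriv[OF E F Q x] by (simp add: has_dir_deriv_iff_tends[OF F])
    show "tends G (\<lambda>t. \<Sum>bs\<leftarrow>fdb hs. (DP (map (\<lambda>b. DQ b (x + t *\<^sub>R h)) bs) (DQ [] (x + t *\<^sub>R h)) - DP (map ?l bs) ?y) /\<^sub>R t)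
      (\<Sum>bs\<leftarrow>fdb hs. DP (DQ [h] x # map ?l bs) ?y + (\<Sum>L\<leftarrow>repl ?l (\<lambda>b. DQ (h # b) x) bs. DP L ?y)) (at 0)"
      using jet_curve_deriv[OF F G P y q[of "[]"], where as="[]" and f="\<lambda>b t. DQ b (x + t *\<^sub>R h)" and l="?l" and f'="\<lambda>b. DQ (h # b) x"] q
      by (intro tends_sum_list[OF G]) simp
    show "\<forall>\<^sub>F t in at 0. (\<Sum>bs\<leftarrow>fdb hs. (DP (map (\<lambda>b. DQ b (x + t *\<^sub>R h)) bs) (DQ [] (x + t *\<^sub>R h)) - DP (map ?l bs) ?y) /\<^sub>R t)
      = (?D hs (x + t *\<^sub>R h) - ?D hs x) /\<^sub>R t"
      by (simp add: scaleR_sum_list[symmetric] sum_list_subtractf)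
  qed
  fix n
  obtain CP where CP: "CP \<ge> 1" "\<And>ks. length ks \<le> n \<Longrightarrow> nrm G (DP ks ?y) \<le> CP * prod_nrm F ks"
    using jet_bound_le[OF F G P y] by blast
  obtain CQ where CQ: "CQ \<ge> 1" "\<And>ks. length ks \<le> n \<Longrightarrow> nrm F (DQ ks x) \<le> CQ * prod_nrm E ks"
    using jet_bound_le[OF E F Q x] by blast
  \<comment> \<open>One more than the bound at x, so that K also bounds the inner derivatives at
    nearby points, where they differ by a factor \<eta> of at most 1.\<close>
  define K where "K = CQ + 1"
  have K: "K \<ge> 1" using CQ by (simp add: K_def)
  have prod_bound: "prod_nrm F (map l bs) \<le> K ^ n * prod_nrm E hs"
    if hs: "length hs = n" "bs \<in> set (fdb hs)" and l: "\<And>b. length b \<le> n \<Longrightarrow> nrm F (l b) \<le> K * prod_nrm E b" for hs bs l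
  proof -
    have "\<forall>b\<in>set bs. length b \<le> n" using fdb_props(2)[OF that(2)] hs by auto
    then have "prod_nrm F (map l bs) \<le> K ^ length bs * prod_list (map (prod_nrm E) bs)"
    proof (induction bs)
      case (Cons b bs)
      have "nrm F (l b) * prod_nrm F (map l bs) \<le> (K * prod_nrm E b) * (K ^ length bs * prod_list (map (prod_nrm E) bs))"
        using Cons l[of b] K by (intro mult_mono) auto
      then show ?case by (simp add: mult_ac)
    qed simp
    also have "\<dots> \<le> K ^ n * prod_nrm E hs"
      using fdb_props(1,3)[OF that(2)] hs K by (auto intro!: mult_right_mono power_increasing)
    finally show ?thesis .
  qed
  show "\<exists>C\<ge>0. \<forall>hs. length hs = n \<longrightarrow> nrm G (?D hs x) \<le> C * prod_nrm E hs"
  proof (intro exI conjI allI impI)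
    show "0 \<le> fact n * (CP * K ^ n)" using CP K by simp
    fix hs :: "'a list" assume hs: "length hs = n"
    have "nrm G (?D hs x) \<le> (\<Sum>bs\<leftarrow>fdb hs. nrm G (DP (map ?l bs) ?y))"
      using nrm_sum_list[OF G, of "map (\<lambda>bs. DP (map ?l bs) ?y) (fdb hs)"] by (simp add: o_def)
    also have "\<dots> \<le> length (fdb hs) * (CP * (K ^ n * prod_nrm E hs))"
    proof (rule sum_list_le_length)
      fix bs assume bs: "bs \<in> set (fdb hs)"
      have "nrm G (DP (map ?l bs) ?y) \<le> CP * prod_nrm F (map ?l bs)"
        using fdb_props(1)[OF bs] hs by (intro CP(2)) simp
      also have "\<dots> \<le> CP * (K ^ n * prod_nrm E hs)"
      proof (intro mult_left_mono prod_bound[OF hs bs])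
        show "nrm F (DQ b x) \<le> K * prod_nrm E b" if "length b \<le> n" for b
          by (rule order_trans[OF CQ(2)[OF that]]) (auto simp: K_def intro!: mult_right_mono)
      qed (use CP in auto)
      finally show "nrm G (DP (map ?l bs) ?y) \<le> CP * (K ^ n * prod_nrm E hs)" .
    qed
    also have "\<dots> \<le> fact n * (CP * (K ^ n * prod_nrm E hs))"
    proof (rule mult_right_mono)
      show "real (length (fdb hs)) \<le> fact n"
        using length_fdb[of hs] hs by (metis of_nat_fact of_nat_le_iff)
    qed (use CP K in simp)
    finally show "nrm G (?D hs x) \<le> fact n * (CP * K ^ n) * prod_nrm E hs" by (simp add: mult_ac)
  qed
  fix \<epsilon> :: real assume \<epsilon>: "\<epsilon> > 0"
  \<comment> \<open>There are at most n! summands. In each, moving the base point of the outer jet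
    costs \<open>K ^ n\<close>, and exchanging at most n slots costs
    \<open>CP * (n * K ^ n)\<close>, both times \<eta>1.\<close>
  define A where "A = fact n * (K ^ n + CP * (n * K ^ n))"
  have A: "A > 0" unfolding A_def using K CP by (intro mult_pos_pos add_pos_nonneg) auto
  define \<eta>1 where "\<eta>1 = \<epsilon> / A"
  have \<eta>1: "\<eta>1 > 0" using A \<epsilon> by (simp add: \<eta>1_def)
  obtain \<delta>P where \<delta>P: "\<delta>P > 0" "\<And>z ks. nrm F (z - ?y) < \<delta>P \<Longrightarrow> length ks \<le> n \<Longrightarrow> nrm G (DP ks z - DP ks ?y) \<le> \<eta>1 * prod_nrm F ks"
    using jet_cont_le[OF F G P y \<eta>1] by metis
  \<comment> \<open>Three demands on the inner jet: accuracy \<eta>1 for the exchange of slots, 1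
    for the bound K, and below \<delta>P to keep the inner value in the range where the outer jet is
    controlled (the case of no directions).\<close>
  define \<eta> where "\<eta> = min \<eta>1 (min 1 (\<delta>P / 2))"
  have \<eta>: "\<eta> > 0" "\<eta> \<le> 1" "\<eta> \<le> \<eta>1" "\<eta> < \<delta>P" using \<eta>1 \<delta>P by (auto simp: \<eta>_def)
  obtain \<delta> where \<delta>: "\<delta> > 0" "\<And>z ks. nrm E (z - x) < \<delta> \<Longrightarrow> length ks \<le> n \<Longrightarrow> nrm F (DQ ks z - DQ ks x) \<le> \<eta> * prod_nrm E ks"
    using jet_cont_le[OF E F Q x \<eta>(1)] by metis
  show "\<exists>\<delta>>0. \<forall>y\<in>U. nrm E (y - x) < \<delta> \<longrightarrow>
      (\<forall>hs. length hs = n \<longrightarrow> nrm G (?D hs y - ?D hs x) \<le> \<epsilon> * prod_nrm E hs)"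
  proof (intro exI[of _ \<delta>] conjI ballI impI allI \<delta>(1))
    fix z and hs :: "'a list" assume z: "z \<in> U" "nrm E (z - x) < \<delta>" and hs: "length hs = n"
    let ?l' = "\<lambda>b. DQ b z" and ?y' = "DQ [] z"
    have y': "nrm F (?y' - ?y) < \<delta>P" using \<delta>(2)[OF z(2), of "[]"] \<eta> by simp
    have l: "nrm F (DQ b x) \<le> K * prod_nrm E b" if "length b \<le> n" for b
      by (rule order_trans[OF CQ(2)[OF that]]) (auto simp: K_def intro!: mult_right_mono)
    have l': "nrm F (DQ b z) \<le> K * prod_nrm E b" if "length b \<le> n" for b
    proof -
      have "nrm F (DQ b z) \<le> \<eta> * prod_nrm E b + CQ * prod_nrm E b"
        using nrm_diff_le[OF F, of "DQ b z" "DQ b x"] CQ(2)[OF that] \<delta>(2)[OF z(2) that] by linarith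
      also have "\<dots> \<le> K * prod_nrm E b"
        using \<eta>(2) mult_right_mono[of \<eta> 1 "prod_nrm E b"] by (simp add: K_def algebra_simps)
      finally show ?thesis .
    qed
    have "nrm G (?D hs z - ?D hs x) \<le> (\<Sum>bs\<leftarrow>fdb hs. nrm G (DP (map ?l' bs) ?y' - DP (map ?l bs) ?y))"
      using nrm_sum_list[OF G, of "map (\<lambda>bs. DP (map ?l' bs) ?y' - DP (map ?l bs) ?y) (fdb hs)"]
      by (simp add: o_def sum_list_subtractf)
    also have "\<dots> \<le> length (fdb hs) * (\<eta>1 * ((K ^ n + CP * (n * K ^ n)) * prod_nrm E hs))"
    proof (rule sum_list_le_length)
      fix bs assume bs: "bs \<in> set (fdb hs)"
      have lb: "length bs \<le> n" "\<And>b. b \<in> set bs \<Longrightarrow> length b \<le> n" using fdb_props(1,2)[OF bs] hs by auto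
      have "nrm G (DP (map ?l' bs) ?y' - DP (map ?l' bs) ?y) \<le> \<eta>1 * prod_nrm F (map ?l' bs)"
        using \<delta>P(2)[OF y', of "map ?l' bs"] lb by simp
      also have "\<dots> \<le> \<eta>1 * (K ^ n * prod_nrm E hs)"
        using \<eta>1 by (intro mult_left_mono prod_bound[OF hs bs] l') auto
      finally have 1: "nrm G (DP (map ?l' bs) ?y' - DP (map ?l' bs) ?y) \<le> \<eta>1 * (K ^ n * prod_nrm E hs)" .
      have "nrm G (DP ([] @ map ?l' bs) ?y - DP ([] @ map ?l bs) ?y)
        \<le> CP * prod_nrm F [] * prod_list (map (prod_nrm E) bs) * (length bs * \<eta> * K ^ length bs)"
        by (rule jet_slots_lipschitz[OF F G P y, where N="length bs"])
          (use CP(2) CP(1) lb l l' \<delta>(2)[OF z(2)] K \<eta> in auto)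
      also have "\<dots> = CP * (prod_nrm E hs * (length bs * \<eta> * K ^ length bs))"
        using fdb_props(3)[OF bs] by simp
      also have "\<dots> \<le> CP * (prod_nrm E hs * (n * \<eta>1 * K ^ n))"
        using CP lb(1) \<eta> K by (intro mult_left_mono mult_mono power_increasing) auto
      finally have 2: "nrm G (DP (map ?l' bs) ?y - DP (map ?l bs) ?y) \<le> CP * (prod_nrm E hs * (n * \<eta>1 * K ^ n))" by simp
      have "nrm G (DP (map ?l' bs) ?y' - DP (map ?l bs) ?y) \<le>
          \<eta>1 * (K ^ n * prod_nrm E hs) + CP * (prod_nrm E hs * (n * \<eta>1 * K ^ n))"
        using nrm_add[OF G, of "DP (map ?l' bs) ?y' - DP (map ?l' bs) ?y" "DP (map ?l' bs) ?y - DP (map ?l bs) ?y"] 1 2 by simp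
      then show "nrm G (DP (map ?l' bs) ?y' - DP (map ?l bs) ?y) \<le> \<eta>1 * ((K ^ n + CP * (n * K ^ n)) * prod_nrm E hs)"
        by (simp add: algebra_simps)
    qed
    also have "\<dots> \<le> fact n * (\<eta>1 * ((K ^ n + CP * (n * K ^ n)) * prod_nrm E hs))"
    proof (rule mult_right_mono)
      show "real (length (fdb hs)) \<le> fact n"
        using length_fdb[of hs] hs by (metis of_nat_fact of_nat_le_iff)
    qed (use CP K \<eta>1 in simp)
    also have "\<dots> = \<eta>1 * A * prod_nrm E hs" by (simp add: A_def mult_ac)
    also have "\<dots> = \<epsilon> * prod_nrm E hs" using A by (simp add: \<eta>1_def)
    finally show "nrm G (?D hs z - ?D hs x) \<le> \<epsilon> * prod_nrm E hs" .
  qed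
qed

subsection \<open>The derivative as a function of two variables\<close>

text \<open>Terms of a higher derivative of \<open>(x, h) \<mapsto> D [h] x\<close> in which one
  direction (k, l) acts on the slot of h and leaves l there, in last place, while all other
  directions act on the base point through their first components.\<close>

fun tangent_terms :: "('e \<times> 'e) list \<Rightarrow> 'e list list" where
  "tangent_terms [] = []"
| "tangent_terms ((k, l) # hs) = (map fst hs @ [l]) # map ((#) k) (tangent_terms hs)"

lemma tangent_terms_props:
  assumes "L \<in> set (tangent_terms hs)"
  shows "length L = length hs" "prod_nrm E L \<le> prod_nrm (max_metric E E) hs"
  using assms
proof (induction hs arbitrary: L)
  case (Cons h hs)
  obtain k l where h: "h = (k, l)" by force
  have *: "prod_nrm E (map fst hs) \<le> prod_nrm (max_metric E E) hs" for hs
    by (induction hs) (auto simp: nrm_max_metric le_max_iff_disj intro!: mult_mono)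
  {
    case 1
    then show ?case using Cons by (auto simp: h)
  next
    case 2
    then consider "L = map fst hs @ [l]" | L' where "L' \<in> set (tangent_terms hs)" "L = k # L'" by (auto simp: h)
    then show ?case
    proof cases
      case 1
      have "prod_nrm E (map fst hs) * nrm E l \<le> prod_nrm (max_metric E E) hs * max (nrm E k) (nrm E l)"
        using *[of hs] by (intro mult_mono) auto
      with 1 show ?thesis by (simp add: h mult_ac)
    next
      case 2
      then show ?thesis using Cons.IH(2)[of L'] by (auto simp: h le_max_iff_disj intro!: mult_mono)
    qed
  }
qed auto

lemma length_tangent_terms [simp]: "length (tangent_terms hs) = length hs"
  by (induction hs rule: tangent_terms.induct) auto

lemma prod_nrm_map_fst: "prod_nrm E (map fst hs) \<le> prod_nrm (max_metric E G) hs"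
  by (induction hs) (auto simp: nrm_max_metric le_max_iff_disj intro!: mult_mono)

text \<open>The map is linear in h, so at most one direction can act on h: either none does, which
  gives the first summand, or exactly one does, which gives the terms in
  \<open>tangent_terms\<close>.\<close>

lemma jet_derivative:
  assumes E: "standard_metric E" and F: "standard_metric F" and J: "jet E F U D"
  shows "jet (max_metric E E) F (U \<times> UNIV)
    (\<lambda>hs z. D (map fst hs @ [snd z]) (fst z) + (\<Sum>L\<leftarrow>tangent_terms hs. D L (fst z)))"
    (is "jet ?E2 F _ ?D")
proof (rule jetI)
  have E2: "standard_metric ?E2" by (rule standard_metric_max_metric[OF E E])
  have U: "openin (mtopology_of E) U" using J by (simp add: jet_def)
  show "openin (mtopology_of ?E2) (U \<times> UNIV)"
    unfolding open_nrm[OF E2]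
  proof
    fix z :: "'a \<times> 'a" assume "z \<in> U \<times> UNIV"
    then have z: "fst z \<in> U" by auto
    obtain r where "r > 0" "\<And>y. nrm E (y - fst z) < r \<Longrightarrow> y \<in> U"
      using jet_nbhd[OF E F J z] by blast
    then show "\<exists>r>0. \<forall>y. nrm ?E2 (y - z) < r \<longrightarrow> y \<in> U \<times> UNIV"
      by (intro exI[of _ r]) (auto simp: nrm_max_metric)
  qed
  fix z :: "'a \<times> 'a" assume "z \<in> U \<times> UNIV"
  then obtain x h where z: "z = (x, h)" and x: "x \<in> U" by auto
  show "linear (\<lambda>k. ?D (k # hs) z)" for hs
  proof -
    have 1: "linear (\<lambda>k. D (fst k # map fst hs @ [h]) x)"
      using linear_compose[OF linear_fst jet_linear_hd[OF E F J x]] by (simp add: o_def)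
    have 2: "linear (\<lambda>k. D (map fst hs @ [snd k]) x)"
      using linear_compose[OF linear_snd jet_linear[OF E F J x, of "map fst hs" "[]"]] by (simp add: o_def)
    have 3: "linear (\<lambda>k. \<Sum>L\<leftarrow>tangent_terms hs. D (fst k # L) x)"
      using linear_compose[OF linear_fst jet_linear_hd[OF E F J x]] by (intro linear_sum_list) (simp add: o_def)
    have "(\<lambda>k. ?D (k # hs) z) = (\<lambda>k. D (fst k # map fst hs @ [h]) x +
        (D (map fst hs @ [snd k]) x + (\<Sum>L\<leftarrow>tangent_terms hs. D (fst k # L) x)))"
    proof
      fix k show "?D (k # hs) z = D (fst k # map fst hs @ [h]) x +
        (D (map fst hs @ [snd k]) x + (\<Sum>L\<leftarrow>tangent_terms hs. D (fst k # L) x))"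
        by (cases k) (simp add: z o_def)
    qed
    then show ?thesis using linear_compose_add[OF 1 linear_compose_add[OF 2 3]] by simp
  qed
  show "has_dir_deriv F (?D hs) z kl (?D (kl # hs) z)" for hs kl
  proof -
    obtain k l where kl: "kl = (k, l)" by force
    have d: "tends F (\<lambda>t. (D L (x + t *\<^sub>R k) - D L x) /\<^sub>R t) (D (k # L) x) (at 0)" for L
      using jet_deriv[OF E F J x] by (simp add: has_dir_deriv_iff_tends[OF F])
    have q: "tends E (\<lambda>t. (p + t *\<^sub>R v - p) /\<^sub>R t) v (at 0)" for p v :: 'a
      by (rule tends_cong[OF E tends_const[OF E]]) (simp add: eventually_at_filter)
    \<comment> \<open>The index list \<open>[()]\<close> presents the single moving slot h in the
      format of the product rule.\<close>
    have 1: "tends F (\<lambda>t. (D (map fst hs @ map (\<lambda>i. h + t *\<^sub>R l) [()]) (x + t *\<^sub>R k) - D (map fst hs @ map (\<lambda>i. h) [()]) x) /\<^sub>R t)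
       (D (k # map fst hs @ map (\<lambda>i. h) [()]) x + (\<Sum>L\<leftarrow>repl (\<lambda>i. h) (\<lambda>i. l) [()]. D (map fst hs @ L) x)) (at 0)"
      by (rule jet_curve_deriv[OF E F J x q q])
    have 2: "tends F (\<lambda>t. \<Sum>L\<leftarrow>tangent_terms hs. (D L (x + t *\<^sub>R k) - D L x) /\<^sub>R t) (\<Sum>L\<leftarrow>tangent_terms hs. D (k # L) x) (at 0)"
      by (rule tends_sum_list[OF F d])
    show ?thesis
      unfolding has_dir_deriv_iff_tends[OF F]
    proof (rule tends_cong[OF F])
      show "tends F (\<lambda>t. (D (map fst hs @ [h + t *\<^sub>R l]) (x + t *\<^sub>R k) - D (map fst hs @ [h]) x) /\<^sub>R t
           + (\<Sum>L\<leftarrow>tangent_terms hs. (D L (x + t *\<^sub>R k) - D L x) /\<^sub>R t)) (?D (kl # hs) z) (at 0)"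
        using tends_add[OF F 1 2] by (simp add: z kl o_def add.assoc)
      show "\<forall>\<^sub>F t in at 0. (D (map fst hs @ [h + t *\<^sub>R l]) (x + t *\<^sub>R k) - D (map fst hs @ [h]) x) /\<^sub>R t
           + (\<Sum>L\<leftarrow>tangent_terms hs. (D L (x + t *\<^sub>R k) - D L x) /\<^sub>R t) = (?D hs (z + t *\<^sub>R kl) - ?D hs z) /\<^sub>R t"
        by (simp add: z kl scaleR_sum_list[symmetric] sum_list_subtractf algebra_simps)
    qed
  qed
  fix n
  obtain C where C: "C \<ge> 1" "\<And>ks. length ks \<le> Suc n \<Longrightarrow> nrm F (D ks x) \<le> C * prod_nrm E ks"
    using jet_bound_le[OF E F J x] by blast
  show "\<exists>C\<ge>0. \<forall>hs. length hs = n \<longrightarrow> nrm F (?D hs z) \<le> C * prod_nrm ?E2 hs"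
  proof (intro exI conjI allI impI)
    show "0 \<le> C * nrm E h + n * C" using C by simp
    fix hs :: "('a \<times> 'a) list" assume hs: "length hs = n"
    have "nrm F (D (map fst hs @ [h]) x) \<le> C * (prod_nrm E (map fst hs) * nrm E h)"
      using C(2)[of "map fst hs @ [h]"] hs by simp
    also have "\<dots> \<le> C * (prod_nrm ?E2 hs * nrm E h)"
      using C prod_nrm_map_fst[of E hs E] by (intro mult_left_mono mult_right_mono) auto
    finally have 1: "nrm F (D (map fst hs @ [h]) x) \<le> C * (prod_nrm ?E2 hs * nrm E h)" .
    have "nrm F (\<Sum>L\<leftarrow>tangent_terms hs. D L x) \<le> (\<Sum>L\<leftarrow>tangent_terms hs. nrm F (D L x))"
      using nrm_sum_list[OF F, of "map (\<lambda>L. D L x) (tangent_terms hs)"] by (simp add: o_def)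
    also have "\<dots> \<le> length (tangent_terms hs) * (C * prod_nrm ?E2 hs)"
    proof (rule sum_list_le_length)
      fix L assume L: "L \<in> set (tangent_terms hs)"
      have "nrm F (D L x) \<le> C * prod_nrm E L" using tangent_terms_props(1)[OF L] hs by (intro C(2)) simp
      also have "\<dots> \<le> C * prod_nrm ?E2 hs" using tangent_terms_props(2)[OF L] C by (intro mult_left_mono) auto
      finally show "nrm F (D L x) \<le> C * prod_nrm ?E2 hs" .
    qed
    finally show "nrm F (?D hs z) \<le> (C * nrm E h + n * C) * prod_nrm ?E2 hs"
      using nrm_add[OF F, of "D (map fst hs @ [h]) x" "\<Sum>L\<leftarrow>tangent_terms hs. D L x"] 1 hs
      by (simp add: z algebra_simps)
  qed
  fix \<epsilon> :: real assume \<epsilon>: "\<epsilon> > 0"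
  \<comment> \<open>The denominator adds up three errors: moving the base point with slot k, where
    \<open>nrm E k\<close> is below \<open>nrm E h + 1\<close>; exchanging k for h, with constant C;
    and the n terms of \<open>tangent_terms\<close>.\<close>
  define \<eta> where "\<eta> = \<epsilon> / (nrm E h + 1 + C + n)"
  have pos: "nrm E h + 1 + C + n > 0" using C(1) mdist_nonneg[of E h 0] by linarith
  have \<eta>: "\<eta> > 0" using \<epsilon> pos by (simp add: \<eta>_def)
  obtain \<delta> where \<delta>: "\<delta> > 0" "\<And>y ks. nrm E (y - x) < \<delta> \<Longrightarrow> length ks \<le> Suc n \<Longrightarrow> nrm F (D ks y - D ks x) \<le> \<eta> * prod_nrm E ks"
    using jet_cont_le[OF E F J x \<eta>] by metis
  show "\<exists>\<delta>>0. \<forall>y\<in>U \<times> UNIV. nrm ?E2 (y - z) < \<delta> \<longrightarrow>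
      (\<forall>hs. length hs = n \<longrightarrow> nrm F (?D hs y - ?D hs z) \<le> \<epsilon> * prod_nrm ?E2 hs)"
  proof (intro exI[of _ "min \<delta> (min 1 \<eta>)"] conjI ballI impI allI)
    show "0 < min \<delta> (min 1 \<eta>)" using \<delta> \<eta> by simp
    fix w :: "'a \<times> 'a" and hs :: "('a \<times> 'a) list"
    assume w: "nrm ?E2 (w - z) < min \<delta> (min 1 \<eta>)" and hs: "length hs = n"
    obtain y k where wy: "w = (y, k)" by force
    have y: "nrm E (y - x) < \<delta>" and k: "nrm E (k - h) < 1" "nrm E (k - h) < \<eta>" using w by (auto simp: z wy)
    have k1: "nrm E k \<le> nrm E h + 1" using nrm_diff_le[OF E, of k h] k by linarith
    let ?p = "prod_nrm ?E2 hs"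
    have fp: "prod_nrm E (map fst hs) \<le> ?p" by (rule prod_nrm_map_fst)
    have "nrm F (D (map fst hs @ [k]) y - D (map fst hs @ [k]) x) \<le> \<eta> * (prod_nrm E (map fst hs) * nrm E k)"
      using \<delta>(2)[OF y, of "map fst hs @ [k]"] hs by simp
    also have "\<dots> \<le> \<eta> * (?p * (nrm E h + 1))"
      using fp k1 \<eta> by (intro mult_left_mono mult_mono) auto
    finally have 1: "nrm F (D (map fst hs @ [k]) y - D (map fst hs @ [k]) x) \<le> \<eta> * (?p * (nrm E h + 1))" .
    have "nrm F (D (map fst hs @ [k]) x - D (map fst hs @ [h]) x) = nrm F (D (map fst hs @ [k - h]) x)"
      using linear_diff[OF jet_linear[OF E F J x, of "map fst hs" "[]"], of k h] by simp
    also have "\<dots> \<le> C * (prod_nrm E (map fst hs) * nrm E (k - h))"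
      using C(2)[of "map fst hs @ [k - h]"] hs by simp
    also have "\<dots> \<le> C * (?p * \<eta>)" using fp k C by (intro mult_left_mono mult_mono) auto
    finally have 2: "nrm F (D (map fst hs @ [k]) x - D (map fst hs @ [h]) x) \<le> C * (?p * \<eta>)" .
    have "nrm F (\<Sum>L\<leftarrow>tangent_terms hs. D L y - D L x) \<le> (\<Sum>L\<leftarrow>tangent_terms hs. nrm F (D L y - D L x))"
      using nrm_sum_list[OF F, of "map (\<lambda>L. D L y - D L x) (tangent_terms hs)"] by (simp add: o_def)
    also have "\<dots> \<le> length (tangent_terms hs) * (\<eta> * ?p)"
    proof (rule sum_list_le_length)
      fix L assume L: "L \<in> set (tangent_terms hs)"
      have "nrm F (D L y - D L x) \<le> \<eta> * prod_nrm E L" using tangent_terms_props(1)[OF L] hs by (intro \<delta>(2)[OF y]) simp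
      also have "\<dots> \<le> \<eta> * ?p" using tangent_terms_props(2)[OF L] \<eta> by (intro mult_left_mono) auto
      finally show "nrm F (D L y - D L x) \<le> \<eta> * ?p" .
    qed
    finally have 3: "nrm F (\<Sum>L\<leftarrow>tangent_terms hs. D L y - D L x) \<le> n * (\<eta> * ?p)" using hs by simp
    have "?D hs w - ?D hs z = (D (map fst hs @ [k]) y - D (map fst hs @ [k]) x) +
        ((D (map fst hs @ [k]) x - D (map fst hs @ [h]) x) + (\<Sum>L\<leftarrow>tangent_terms hs. D L y - D L x))"
      by (simp add: wy z sum_list_subtractf)
    then have "nrm F (?D hs w - ?D hs z) \<le> \<eta> * (?p * (nrm E h + 1)) + (C * (?p * \<eta>) + n * (\<eta> * ?p))"
      using nrm_add[OF F] 1 2 3 by (smt (verit, best))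
    also have "\<dots> = \<eta> * (nrm E h + 1 + C + n) * ?p" by (simp add: algebra_simps)
    also have "\<eta> * (nrm E h + 1 + C + n) = \<epsilon>" using pos by (simp add: \<eta>_def)
    finally show "nrm F (?D hs w - ?D hs z) \<le> \<epsilon> * ?p" .
  qed
qed

subsection \<open>Symmetry of second derivatives\<close>

text \<open>The expression is symmetric in g and h, so its limit forces second derivatives to be
  symmetric. A mean value argument in direction g reduces it to difference quotients of
  \<open>D [g]\<close>, and these converge to the derivative in direction h.\<close>

lemma jet_second_difference:
  assumes E: "standard_metric E" and F: "standard_metric F" and J: "jet E F U D" and x: "x \<in> U"
  shows "tends F (\<lambda>t. (D [] (x + t *\<^sub>R (g + h)) - D [] (x + t *\<^sub>R g) - D [] (x + t *\<^sub>R h) + D [] x) /\<^sub>R t\<^sup>2)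
    (D [h, g] x) (at 0)"
proof (rule tends_epsI[OF F])
  show "0 \<le> 2 * ((nrm E g + nrm E h + 1) * nrm E g)" by simp
  fix \<epsilon> :: real assume \<epsilon>: "\<epsilon> > 0"
  obtain \<delta> where \<delta>: "\<delta> > 0" "\<And>t q ks. t \<noteq> 0 \<Longrightarrow> nrm E (t *\<^sub>R q) < \<delta> \<Longrightarrow> length ks = 1 \<Longrightarrow>
     nrm F ((D ks (x + t *\<^sub>R q) - D ks x) /\<^sub>R t - D (q # ks) x) \<le> \<epsilon> * (nrm E q * prod_nrm E ks)"
    using jet_uniform_deriv[OF E F J x \<epsilon>, of 1] by metis
  obtain r where r: "r > 0" "\<And>y. nrm E (y - x) < r \<Longrightarrow> y \<in> U" using jet_nbhd[OF E F J x] by blast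
  \<comment> \<open>Half the minimum, so that the sum of two vectors of size below d stays within
    both \<delta> and r.\<close>
  define d where "d = min \<delta> r / 2"
  have d: "d > 0" using \<delta> r by (simp add: d_def)
  have "\<forall>\<^sub>F t in at 0. nrm E (t *\<^sub>R g) < d" "\<forall>\<^sub>F t in at 0. nrm E (t *\<^sub>R h) < d"
    using order_tendstoD(2)[OF nrm_scaleR_tendsto[OF E] d] by auto
  moreover have "\<forall>\<^sub>F t in at (0::real). t \<noteq> 0" by (simp add: eventually_at_filter)
  ultimately show "\<forall>\<^sub>F t in at 0. nrm F ((D [] (x + t *\<^sub>R (g + h)) - D [] (x + t *\<^sub>R g) - D [] (x + t *\<^sub>R h) + D [] x) /\<^sub>R t\<^sup>2 - D [h, g] x)
      \<le> \<epsilon> * (2 * ((nrm E g + nrm E h + 1) * nrm E g))"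
  proof eventually_elim
    case (elim t)
    \<comment> \<open>The increment of this curve from 0 to 1 is the whole error to be
      estimated.\<close>
    define \<gamma> where "\<gamma> s = (1 / t\<^sup>2) *\<^sub>R (D [] (x + t *\<^sub>R h + (s * t) *\<^sub>R g) - D [] (x + (s * t) *\<^sub>R g)) - s *\<^sub>R D [h, g] x" for s
    define \<gamma>' where "\<gamma>' s = (1 / t) *\<^sub>R (D [g] (x + t *\<^sub>R h + (s * t) *\<^sub>R g) - D [g] (x + (s * t) *\<^sub>R g)) - D [h, g] x" for s
    have sg: "nrm E ((s * t) *\<^sub>R g) < d" if "0 \<le> s" "s \<le> 1" for s
      using nrm_scaleR_le[OF E, of s "t *\<^sub>R g"] that elim by simp
    have sh: "nrm E (t *\<^sub>R h + (s * t) *\<^sub>R g) < 2 * d" if "0 \<le> s" "s \<le> 1" for s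
      using nrm_add[OF E, of "t *\<^sub>R h" "(s * t) *\<^sub>R g"] sg[OF that] elim by linarith
    have inU: "x + t *\<^sub>R h + (s * t) *\<^sub>R g \<in> U" "x + (s * t) *\<^sub>R g \<in> U" if "0 \<le> s" "s \<le> 1" for s
      using r(2)[of "x + t *\<^sub>R h + (s * t) *\<^sub>R g"] r(2)[of "x + (s * t) *\<^sub>R g"] sg[OF that] sh[OF that] d
      by (auto simp: d_def algebra_simps)
    have D1: "has_dir_deriv F \<gamma> s 1 (\<gamma>' s)" if s: "0 \<le> s" "s \<le> 1" for s
    proof -
      let ?a = "x + t *\<^sub>R h + (s * t) *\<^sub>R g" and ?b = "x + (s * t) *\<^sub>R g"
      have "tends F (\<lambda>u. (1 / t\<^sup>2) *\<^sub>R ((D [] (?a + u *\<^sub>R (t *\<^sub>R g)) - D [] ?a) /\<^sub>R u - (D [] (?b + u *\<^sub>R (t *\<^sub>R g)) - D [] ?b) /\<^sub>R u) - D [h, g] x)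
        ((1 / t\<^sup>2) *\<^sub>R (D [t *\<^sub>R g] ?a - D [t *\<^sub>R g] ?b) - D [h, g] x) (at 0)"
        by (intro tends_diff[OF F] tends_scaleR[OF F] tends_const[OF F]
            jet_deriv[OF E F J inU(1)[OF s], unfolded has_dir_deriv_iff_tends[OF F]]
            jet_deriv[OF E F J inU(2)[OF s], unfolded has_dir_deriv_iff_tends[OF F]])
      also have "(1 / t\<^sup>2) *\<^sub>R (D [t *\<^sub>R g] ?a - D [t *\<^sub>R g] ?b) - D [h, g] x = \<gamma>' s"
        using linear_cmul[OF jet_linear_hd[OF E F J inU(1)[OF s], of "[]"], of t g]
          linear_cmul[OF jet_linear_hd[OF E F J inU(2)[OF s], of "[]"], of t g] elim
        by (simp add: \<gamma>'_def power2_eq_square scaleR_diff_right[symmetric] del: scaleR_diff_right)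
      finally show ?thesis
        unfolding has_dir_deriv_iff_tends[OF F]
        by (rule tends_cong[OF F])
          (auto simp: \<gamma>_def eventually_at algebra_simps intro!: exI[of _ 1])
    qed
    define B where "B = \<epsilon> * (2 * ((nrm E g + nrm E h + 1) * nrm E g))"
    have bd: "nrm F (\<gamma>' s) \<le> B" if s: "0 \<le> s" "s \<le> 1" for s
    proof -
      have ng: "nrm E (s *\<^sub>R g) \<le> nrm E g" using nrm_scaleR_le[OF E, of s g] s by simp
      have a: "nrm F ((D [g] (x + t *\<^sub>R (h + s *\<^sub>R g)) - D [g] x) /\<^sub>R t - D [h + s *\<^sub>R g, g] x) \<le> \<epsilon> * (nrm E (h + s *\<^sub>R g) * nrm E g)"
        using \<delta>(2)[of t "h + s *\<^sub>R g" "[g]"] elim sh[OF s] by (simp add: d_def algebra_simps)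
      have b: "nrm F ((D [g] (x + t *\<^sub>R (s *\<^sub>R g)) - D [g] x) /\<^sub>R t - D [s *\<^sub>R g, g] x) \<le> \<epsilon> * (nrm E (s *\<^sub>R g) * nrm E g)"
        using \<delta>(2)[of t "s *\<^sub>R g" "[g]"] elim sg[OF s] d by (simp add: d_def mult.commute)
      \<comment> \<open>Both points are compared with x itself, along the directions
        \<open>h + s g\<close> and \<open>s g\<close>; the two linear terms differ by
        \<open>D [h, g] x\<close>.\<close>
      have "\<gamma>' s = ((D [g] (x + t *\<^sub>R (h + s *\<^sub>R g)) - D [g] x) /\<^sub>R t - D [h + s *\<^sub>R g, g] x)
          - ((D [g] (x + t *\<^sub>R (s *\<^sub>R g)) - D [g] x) /\<^sub>R t - D [s *\<^sub>R g, g] x)"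
        using linear_add[OF jet_linear_hd[OF E F J x, of "[g]"], of h "s *\<^sub>R g"]
        by (simp add: \<gamma>'_def algebra_simps divide_inverse)
      then have "nrm F (\<gamma>' s) \<le> \<epsilon> * (nrm E (h + s *\<^sub>R g) * nrm E g) + \<epsilon> * (nrm E (s *\<^sub>R g) * nrm E g)"
        using nrm_diff[OF F] a b by (smt (verit, best))
      also have "\<dots> \<le> \<epsilon> * ((nrm E g + nrm E h + 1) * nrm E g) + \<epsilon> * ((nrm E g + nrm E h + 1) * nrm E g)"
      proof -
        have "nrm E (h + s *\<^sub>R g) \<le> nrm E g + nrm E h + 1" "nrm E (s *\<^sub>R g) \<le> nrm E g + nrm E h + 1"
          using nrm_add[OF E, of h "s *\<^sub>R g"] ng mdist_nonneg[of E h 0] by linarith+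
        then show ?thesis using \<epsilon> by (intro add_mono mult_left_mono mult_right_mono) auto
      qed
      finally show ?thesis by (simp add: B_def mult_ac)
    qed
    have "nrm F (\<gamma> 1 - \<gamma> 0) < B'" if "B' > B" for B'
      by (rule mean_value[OF F]) (use D1 bd that in force)
    then have "nrm F (\<gamma> 1 - \<gamma> 0) \<le> B" by (meson dense_ge less_imp_le)
    then show ?case by (simp add: \<gamma>_def B_def algebra_simps divide_inverse)
  qed
qed

lemma jet_symmetric:
  assumes E: "standard_metric E" and F: "standard_metric F" and J: "jet E F U D" and x: "x \<in> U"
  shows "D [g, h] x = D [h, g] x"
  using jet_second_difference[OF assms, of g h] jet_second_difference[OF assms, of h g]
  by (intro tends_unique[OF F, where G="at 0"]) (auto simp: algebra_simps)

section \<open>The iterated targets\<close>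

text \<open>An invariant of the iterated targets that replaces nested suprema: the elements are
  supported on lists of length n, and the two inequalities say that the distance is the best
  constant in a bound by \<open>prod_nrm\<close>.\<close>

definition level :: "'e::real_vector metric \<Rightarrow> 'f::real_vector metric \<Rightarrow> nat \<Rightarrow> ('e list \<Rightarrow> 'f) metric \<Rightarrow> bool" where
  "level E F n X \<longleftrightarrow>
     subspace (mspace X) \<and>
     (\<forall>S\<in>mspace X. \<forall>gs. length gs \<noteq> n \<longrightarrow> S gs = 0) \<and>
     (\<forall>S\<in>mspace X. \<forall>T\<in>mspace X. \<forall>gs. length gs = n \<longrightarrow>
        nrm F (S gs - T gs) \<le> mdist X S T * prod_nrm E gs) \<and>
     (\<forall>S\<in>mspace X. \<forall>T\<in>mspace X. \<forall>\<epsilon>\<ge>0.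
        (\<forall>gs. length gs = n \<longrightarrow> nrm F (S gs - T gs) \<le> \<epsilon> * prod_nrm E gs) \<longrightarrow> mdist X S T \<le> \<epsilon>)"

lemma base_code_Nil [simp]: "base_code v [] = v"
  by (simp add: base_code_def)

lemma base_code_eq_iff [simp]: "base_code v = base_code w \<longleftrightarrow> v = w"
  by (metis base_code_Nil)

lemma Metric_space_base_metric:
  "Metric_space (base_code ` mspace F) (\<lambda>S T. mdist F (S []) (T []))"
  by unfold_locales (auto simp: mdist_commute intro: mdist_triangle)

lemma map_code_Cons [simp]: "map_code L (y # ys) = L y ys"
  by (simp add: map_code_def)

lemma map_decode_map_code [simp]: "map_decode (map_code L) = L"
  by (simp add: map_decode_def map_code_def)

lemma Metric_space_map_code_metric:
  "Metric_space (map_code ` mspace m) (\<lambda>S T. mdist m (map_decode S) (map_decode T))"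
  by unfold_locales (auto simp: mdist_commute intro: mdist_triangle)

lemma mspace_base_metric [simp]: "mspace (base_metric F) = base_code ` mspace F"
  and mdist_base_metric [simp]: "mdist (base_metric F) S T = mdist F (S []) (T [])"
  unfolding base_metric_def
  by (simp_all add: Metric_space.mspace_metric[OF Metric_space_base_metric]
      Metric_space.mdist_metric[OF Metric_space_base_metric])

lemma mspace_map_code_metric [simp]: "mspace (map_code_metric m) = map_code ` mspace m"
  and mdist_map_code_metric [simp]: "mdist (map_code_metric m) S T = mdist m (map_decode S) (map_decode T)"
  unfolding map_code_metric_def
  by (simp_all add: Metric_space.mspace_metric[OF Metric_space_map_code_metric]
      Metric_space.mdist_metric[OF Metric_space_map_code_metric])

lemma level_base:
  fixes E :: "'e::real_vector metric" and F :: "'f::real_vector metric"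
  assumes F: "standard_metric F"
  shows "level E F 0 (base_metric F)"
  unfolding level_def
proof (intro conjI ballI allI impI)
  have "subspace (range (base_code :: 'f \<Rightarrow> 'e list \<Rightarrow> 'f))"
    by (rule linear_subspace_image[OF _ subspace_UNIV], rule linearI)
      (auto simp: base_code_def fun_eq_iff scaleR_fun_def)
  then show "subspace (mspace (base_metric F) :: ('e list \<Rightarrow> 'f) set)"
    by (simp add: std_mspace[OF F])
qed (use mdist_eq_nrm[OF F] in \<open>auto simp: base_code_def\<close>)

context
  fixes E :: "'e::real_vector metric" and F :: "'f::real_vector metric" and n X
  assumes E: "standard_metric E" and F: "standard_metric F" and X: "level E F n X"
begin

lemma level_subspace: "subspace (mspace X)"
  using X by (simp add: level_def)

lemma level_zero: "0 \<in> mspace X"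
  by (rule subspace_0[OF level_subspace])

lemma level_support: "S \<in> mspace X \<Longrightarrow> length gs \<noteq> n \<Longrightarrow> S gs = 0"
  using X by (simp add: level_def)

lemma level_lower:
  "S \<in> mspace X \<Longrightarrow> T \<in> mspace X \<Longrightarrow> length gs = n \<Longrightarrow> nrm F (S gs - T gs) \<le> mdist X S T * prod_nrm E gs"
  using X by (simp add: level_def)

lemma level_upper:
  "S \<in> mspace X \<Longrightarrow> T \<in> mspace X \<Longrightarrow> \<epsilon> \<ge> 0 \<Longrightarrow>
    (\<And>gs. length gs = n \<Longrightarrow> nrm F (S gs - T gs) \<le> \<epsilon> * prod_nrm E gs) \<Longrightarrow> mdist X S T \<le> \<epsilon>"
  using X by (simp add: level_def)

lemma level_lower0:
  "S \<in> mspace X \<Longrightarrow> length gs = n \<Longrightarrow> nrm F (S gs) \<le> mdist X S 0 * prod_nrm E gs"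
  using level_lower[of S 0 gs] level_zero by simp

lemma level_upper0:
  "S \<in> mspace X \<Longrightarrow> \<epsilon> \<ge> 0 \<Longrightarrow>
    (\<And>gs. length gs = n \<Longrightarrow> nrm F (S gs) \<le> \<epsilon> * prod_nrm E gs) \<Longrightarrow> mdist X S 0 \<le> \<epsilon>"
  using level_upper[of S 0] level_zero by simp

section \<open>Lipschitz maps into a level and their metric\<close>

lemma nrm_pos: "x \<noteq> 0 \<Longrightarrow> 0 < nrm E x"
  using nrm_eq_0[OF E, of x] mdist_nonneg[of E x 0] by linarith

text \<open>The distance to 0 in X is itself a best constant, so a bound on the quotients amounts to
  a bound on values with the additional factor \<open>nrm E x\<close>. At x = 0, which the quotients
  omit, linearity gives it.\<close>

lemma Lip_maps_iff:
  "L \<in> Lip_maps E X \<longleftrightarrow> linear L \<and> range L \<subseteq> mspace X \<and>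
     (\<exists>C\<ge>0. \<forall>x gs. length gs = n \<longrightarrow> nrm F (L x gs) \<le> C * nrm E x * prod_nrm E gs)"
proof (cases "linear L \<and> range L \<subseteq> mspace X")
  case True
  then have L: "linear L" "\<And>x. L x \<in> mspace X" by auto
  have "bdd_above (Lip_quotients E X L) \<longleftrightarrow>
     (\<exists>C\<ge>0. \<forall>x gs. length gs = n \<longrightarrow> nrm F (L x gs) \<le> C * nrm E x * prod_nrm E gs)"
  proof
    assume "bdd_above (Lip_quotients E X L)"
    then obtain M where M: "\<And>x. x \<noteq> 0 \<Longrightarrow> mdist X (L x) 0 / nrm E x \<le> M"
      unfolding bdd_above_def Lip_quotients_def by blast
    have "nrm F (L x gs) \<le> max M 0 * nrm E x * prod_nrm E gs" if gs: "length gs = n" for x gs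
    proof (cases "x = 0")
      case True
      then show ?thesis using linear_0[OF L(1)] by (simp add: nrm_zero[OF F] nrm_zero[OF E])
    next
      case False
      have "nrm F (L x gs) \<le> mdist X (L x) 0 * prod_nrm E gs" by (rule level_lower0[OF L(2) gs])
      also have "mdist X (L x) 0 \<le> M * nrm E x"
        using M[OF False] nrm_pos[OF False] by (simp add: pos_divide_le_eq)
      also have "M * nrm E x \<le> max M 0 * nrm E x" by (intro mult_right_mono) auto
      finally show ?thesis by (simp add: mult_right_mono)
    qed
    then show "\<exists>C\<ge>0. \<forall>x gs. length gs = n \<longrightarrow> nrm F (L x gs) \<le> C * nrm E x * prod_nrm E gs"
      by (intro exI[of _ "max M 0"]) auto
  next
    assume "\<exists>C\<ge>0. \<forall>x gs. length gs = n \<longrightarrow> nrm F (L x gs) \<le> C * nrm E x * prod_nrm E gs"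
    then obtain C where C: "C \<ge> 0" "\<And>x gs. length gs = n \<Longrightarrow> nrm F (L x gs) \<le> C * nrm E x * prod_nrm E gs"
      by blast
    have "mdist X (L x) 0 / nrm E x \<le> C" if "x \<noteq> 0" for x
      using level_upper0[OF L(2), of "C * nrm E x" x] C nrm_pos[OF that] by (simp add: pos_divide_le_eq)
    then show "bdd_above (Lip_quotients E X L)"
      unfolding bdd_above_def Lip_quotients_def by blast
  qed
  then show ?thesis using True by (simp add: Lip_maps_def)
qed (auto simp: Lip_maps_def)

lemma Lip_maps_linear: "L \<in> Lip_maps E X \<Longrightarrow> linear L"
  and Lip_maps_range: "L \<in> Lip_maps E X \<Longrightarrow> L x \<in> mspace X"
  by (auto simp: Lip_maps_def)

lemma Lip_norm_nonneg: "L \<in> Lip_maps E X \<Longrightarrow> 0 \<le> Lip_norm E X L"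
  unfolding Lip_norm_def by (rule cSup_upper) (auto simp: Lip_maps_def)

lemma Lip_norm_lower:
  assumes L: "L \<in> Lip_maps E X" and gs: "length gs = n"
  shows "nrm F (L x gs) \<le> Lip_norm E X L * nrm E x * prod_nrm E gs"
proof (cases "x = 0")
  case True
  then show ?thesis using linear_0[OF Lip_maps_linear[OF L]] by (simp add: nrm_zero[OF F] nrm_zero[OF E])
next
  case False
  have "nrm F (L x gs) \<le> mdist X (L x) 0 * prod_nrm E gs" by (rule level_lower0[OF Lip_maps_range[OF L] gs])
  also have "mdist X (L x) 0 \<le> Lip_norm E X L * nrm E x"
  proof -
    have "mdist X (L x) 0 / nrm E x \<le> Lip_norm E X L"
      unfolding Lip_norm_def by (rule cSup_upper) (use L False in \<open>auto simp: Lip_maps_def Lip_quotients_def\<close>)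
    then show ?thesis using nrm_pos[OF False] by (simp add: pos_divide_le_eq)
  qed
  finally show ?thesis by (simp add: mult_right_mono)
qed

lemma Lip_norm_upper:
  assumes L: "L \<in> Lip_maps E X" and \<epsilon>: "\<epsilon> \<ge> 0"
    and *: "\<And>x gs. length gs = n \<Longrightarrow> nrm F (L x gs) \<le> \<epsilon> * nrm E x * prod_nrm E gs"
  shows "Lip_norm E X L \<le> \<epsilon>"
  unfolding Lip_norm_def
proof (rule cSup_least)
  fix q assume "q \<in> insert 0 (Lip_quotients E X L)"
  moreover have "mdist X (L x) 0 / nrm E x \<le> \<epsilon>" if "x \<noteq> 0" for x
    using level_upper0[OF Lip_maps_range[OF L], of "\<epsilon> * nrm E x" x] * \<epsilon> nrm_pos[OF that]
    by (simp add: pos_divide_le_eq)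
  ultimately show "q \<le> \<epsilon>" using \<epsilon> by (auto simp: Lip_quotients_def)
qed simp

lemma subspace_Lip_maps: "subspace (Lip_maps E X)"
  unfolding subspace_def
proof (intro conjI ballI allI)
  show "0 \<in> Lip_maps E X"
    unfolding Lip_maps_iff using level_zero
    by (auto simp: nrm_zero[OF F] zero_fun_def[symmetric] module_hom_zero intro!: linearI exI[of _ 0])
next
  fix L H assume L: "L \<in> Lip_maps E X" and H: "H \<in> Lip_maps E X"
  show "L + H \<in> Lip_maps E X"
    unfolding Lip_maps_iff
  proof (intro conjI exI allI impI)
    show "linear (L + H)" using linear_compose_add[OF Lip_maps_linear[OF L] Lip_maps_linear[OF H]]
      by (simp add: plus_fun_def)
    show "range (L + H) \<subseteq> mspace X"
      using Lip_maps_range[OF L] Lip_maps_range[OF H] subspace_add[OF level_subspace] by auto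
    show "0 \<le> Lip_norm E X L + Lip_norm E X H" using Lip_norm_nonneg L H by simp
    show "nrm F ((L + H) x gs) \<le> (Lip_norm E X L + Lip_norm E X H) * nrm E x * prod_nrm E gs"
      if "length gs = n" for x gs
      using Lip_norm_lower[OF L that, of x] Lip_norm_lower[OF H that, of x] nrm_add[OF F, of "L x gs" "H x gs"]
      by (simp add: algebra_simps)
  qed
next
  fix c L assume L: "L \<in> Lip_maps E X"
  show "c *\<^sub>R L \<in> Lip_maps E X"
    unfolding Lip_maps_iff
  proof (intro conjI exI allI impI)
    show "linear (c *\<^sub>R L)" using linear_compose_scale_right[OF Lip_maps_linear[OF L]]
      by (simp add: scaleR_fun_def)
    show "range (c *\<^sub>R L) \<subseteq> mspace X"
      using Lip_maps_range[OF L] subspace_scale[OF level_subspace] by (auto simp: scaleR_fun_def[of c L])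
    show "0 \<le> (\<bar>c\<bar> + 1) * Lip_norm E X L" using Lip_norm_nonneg L by simp
    show "nrm F ((c *\<^sub>R L) x gs) \<le> (\<bar>c\<bar> + 1) * Lip_norm E X L * nrm E x * prod_nrm E gs"
      if "length gs = n" for x gs
      using order_trans[OF nrm_scaleR_bound[OF F, of c] mult_left_mono[OF Lip_norm_lower[OF L that, of x]]]
      by (simp add: scaleR_fun_def mult_ac)
  qed
qed

lemma Metric_space_Lip:
  "Metric_space (Lip_maps E X) (\<lambda>L H. if L \<in> Lip_maps E X \<and> H \<in> Lip_maps E X then Lip_norm E X (L - H) else 0)"
proof
  note sub = subspace_diff[OF subspace_Lip_maps]
  fix L H
  show "0 \<le> (if L \<in> Lip_maps E X \<and> H \<in> Lip_maps E X then Lip_norm E X (L - H) else 0)"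
    using Lip_norm_nonneg sub by simp
  have le: "Lip_norm E X (L - H) \<le> Lip_norm E X (H - L)" if "L \<in> Lip_maps E X" "H \<in> Lip_maps E X" for L H
  proof (rule Lip_norm_upper)
    show "nrm F ((L - H) x gs) \<le> Lip_norm E X (H - L) * nrm E x * prod_nrm E gs" if "length gs = n" for x gs
      using Lip_norm_lower[of "H - L" gs x] \<open>L \<in> _\<close> \<open>H \<in> _\<close> sub that nrm_minus_commute[OF F, of "L x gs"] by simp
  qed (use that sub Lip_norm_nonneg in auto)
  show "(if L \<in> Lip_maps E X \<and> H \<in> Lip_maps E X then Lip_norm E X (L - H) else 0) =
      (if H \<in> Lip_maps E X \<and> L \<in> Lip_maps E X then Lip_norm E X (H - L) else 0)"
    using le[of L H] le[of H L] by auto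
  assume L: "L \<in> Lip_maps E X" and H: "H \<in> Lip_maps E X"
  show "((if L \<in> Lip_maps E X \<and> H \<in> Lip_maps E X then Lip_norm E X (L - H) else 0) = 0) = (L = H)"
  proof
    assume "(if L \<in> Lip_maps E X \<and> H \<in> Lip_maps E X then Lip_norm E X (L - H) else 0) = 0"
    then have 0: "Lip_norm E X (L - H) = 0" using L H by simp
    show "L = H"
    proof (intro ext)
      fix x gs show "L x gs = H x gs"
      \<comment> \<open>The norm controls lists of length n only; on the others both maps vanish by
        the support clause of \<open>level\<close>.\<close>
      proof (cases "length gs = n")
        case True
        then have "nrm F (L x gs - H x gs) \<le> 0"
          using Lip_norm_lower[OF sub[OF L H] True, of x] 0 by simp
        then show ?thesis using nrm_eq_0[OF F, of "L x gs - H x gs"] mdist_nonneg[of F "L x gs - H x gs" 0] by simp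
      qed (simp add: level_support[OF Lip_maps_range[OF L]] level_support[OF Lip_maps_range[OF H]])
    qed
  next
    assume "L = H"
    moreover have "Lip_norm E X 0 \<le> 0"
      by (rule Lip_norm_upper[OF subspace_0[OF subspace_Lip_maps]]) (auto simp: nrm_zero[OF F])
    ultimately show "(if L \<in> Lip_maps E X \<and> H \<in> Lip_maps E X then Lip_norm E X (L - H) else 0) = 0"
      using Lip_norm_nonneg[OF subspace_0[OF subspace_Lip_maps]] by simp
  qed
  fix K assume K: "K \<in> Lip_maps E X"
  have "Lip_norm E X (L - K) \<le> Lip_norm E X (L - H) + Lip_norm E X (H - K)"
  proof (rule Lip_norm_upper[OF sub[OF L K]])
    show "0 \<le> Lip_norm E X (L - H) + Lip_norm E X (H - K)" using Lip_norm_nonneg sub L H K by simp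
    show "nrm F ((L - K) x gs) \<le> (Lip_norm E X (L - H) + Lip_norm E X (H - K)) * nrm E x * prod_nrm E gs"
      if "length gs = n" for x gs
      using Lip_norm_lower[OF sub[OF L H] that, of x] Lip_norm_lower[OF sub[OF H K] that, of x]
        nrm_add[OF F, of "L x gs - H x gs" "H x gs - K x gs"]
      by (simp add: algebra_simps)
  qed
  then show "(if L \<in> Lip_maps E X \<and> K \<in> Lip_maps E X then Lip_norm E X (L - K) else 0)
    \<le> (if L \<in> Lip_maps E X \<and> H \<in> Lip_maps E X then Lip_norm E X (L - H) else 0) +
       (if H \<in> Lip_maps E X \<and> K \<in> Lip_maps E X then Lip_norm E X (H - K) else 0)"
    using L H K by simp
qed

lemma mspace_Lip_metric: "mspace (Lip_metric E X) = Lip_maps E X"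
  unfolding Lip_metric_def by (rule Metric_space.mspace_metric[OF Metric_space_Lip])

lemma mdist_Lip_metric:
  "L \<in> Lip_maps E X \<Longrightarrow> H \<in> Lip_maps E X \<Longrightarrow> mdist (Lip_metric E X) L H = Lip_norm E X (L - H)"
  unfolding Lip_metric_def by (simp add: Metric_space.mdist_metric[OF Metric_space_Lip])

lemma Lip_metric_lower:
  assumes "L \<in> Lip_maps E X" "H \<in> Lip_maps E X" "length gs = n"
  shows "nrm F (L x gs - H x gs) \<le> mdist (Lip_metric E X) L H * nrm E x * prod_nrm E gs"
  using Lip_norm_lower[OF subspace_diff[OF subspace_Lip_maps assms(1,2)] assms(3), of x] assms
  by (simp add: mdist_Lip_metric)

lemma Lip_metric_upper:
  assumes "L \<in> Lip_maps E X" "H \<in> Lip_maps E X" "\<epsilon> \<ge> 0"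
    "\<And>x gs. length gs = n \<Longrightarrow> nrm F (L x gs - H x gs) \<le> \<epsilon> * nrm E x * prod_nrm E gs"
  shows "mdist (Lip_metric E X) L H \<le> \<epsilon>"
  using Lip_norm_upper[OF subspace_diff[OF subspace_Lip_maps assms(1,2)] assms(3)] assms
  by (simp add: mdist_Lip_metric)

section \<open>The connected component of 0 among the Lipschitz maps\<close>

abbreviation (input) "Lip_component \<equiv> connected_component_of_set (mtopology_of (Lip_metric E X)) 0"

lemma Lip_component_subset: "Lip_component \<subseteq> Lip_maps E X"
  using connected_component_of_subset_topspace[of "mtopology_of (Lip_metric E X)" 0]
  by (simp add: mspace_Lip_metric)

lemma Lip_component_maximal:
  assumes "connectedin (mtopology_of (Lip_metric E X)) S" "S \<inter> Lip_component \<noteq> {}"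
  shows "S \<subseteq> Lip_component"
proof -
  obtain s where s: "s \<in> S" "s \<in> Lip_component"
    using assms(2) unfolding ex_in_conv[symmetric] Int_iff by (elim exE conjE)
  have "connected_component_of (mtopology_of (Lip_metric E X)) 0 s" using s(2) by (rule CollectD)
  then have "connected_component_of (mtopology_of (Lip_metric E X)) 0 =
      connected_component_of (mtopology_of (Lip_metric E X)) s"
    by (simp only: connected_component_of_equiv)
  then show ?thesis using connected_component_of_maximal[OF assms(1) s(1)] by simp
qed

lemma zero_in_Lip_component: "0 \<in> Lip_component"
  using connected_component_of_refl[of "mtopology_of (Lip_metric E X)" 0] subspace_0[OF subspace_Lip_maps]
  by (simp add: mspace_Lip_metric)

lemma Lip_component_image:
  assumes c: "continuous_map (mtopology_of (Lip_metric E X)) (mtopology_of (Lip_metric E X)) f"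
    and 0: "f 0 \<in> Lip_component" and L: "L \<in> Lip_component"
  shows "f L \<in> Lip_component"
proof -
  have "f ` Lip_component \<subseteq> Lip_component"
  proof (rule Lip_component_maximal)
    show "connectedin (mtopology_of (Lip_metric E X)) (f ` Lip_component)"
      by (rule connectedin_continuous_map_image[OF c connectedin_connected_component_of])
    show "f ` Lip_component \<inter> Lip_component \<noteq> {}" using 0 zero_in_Lip_component by blast
  qed
  then show ?thesis using L by blast
qed

text \<open>Translation by an element of the component and multiplication by a scalar are Lipschitz
  maps, so they carry the component to a connected set; the image of 0 lies in the component, hence
  so does the whole image.\<close>

lemma subspace_Lip_component: "subspace Lip_component"
  unfolding subspace_def
proof (intro conjI ballI allI)
  show "0 \<in> Lip_component" by (rule zero_in_Lip_component)
next
  fix L H assume LH: "L \<in> Lip_component" "H \<in> Lip_component"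
  then have H: "H \<in> Lip_maps E X" using Lip_component_subset by blast
  have "Lipschitz_continuous_map (Lip_metric E X) (Lip_metric E X) (\<lambda>L. L + H)"
    unfolding Lipschitz_continuous_map_def mspace_Lip_metric
  proof (intro conjI exI ballI)
    show "(\<lambda>L. L + H) \<in> Lip_maps E X \<rightarrow> Lip_maps E X"
      by (rule funcsetI) (rule subspace_add[OF subspace_Lip_maps _ H])
    show "mdist (Lip_metric E X) (L + H) (K + H) \<le> 1 * mdist (Lip_metric E X) L K"
      if L: "L \<in> Lip_maps E X" and K: "K \<in> Lip_maps E X" for L K
      unfolding mdist_Lip_metric[OF L K]
        mdist_Lip_metric[OF subspace_add[OF subspace_Lip_maps L H] subspace_add[OF subspace_Lip_maps K H]]
      by (simp only: add_diff_cancel_right mult_1 order_refl)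
  qed
  from Lip_component_image[OF Lipschitz_continuous_imp_continuous_map[OF this] _ LH(1)] LH(2)
  show "L + H \<in> Lip_component" by simp
next
  fix c L assume L: "L \<in> Lip_component"
  have "Lipschitz_continuous_map (Lip_metric E X) (Lip_metric E X) (\<lambda>L. c *\<^sub>R L)"
    unfolding Lipschitz_continuous_map_def mspace_Lip_metric
  proof (intro conjI exI ballI)
    show "(\<lambda>L. c *\<^sub>R L) \<in> Lip_maps E X \<rightarrow> Lip_maps E X"
      by (rule funcsetI) (rule subspace_scale[OF subspace_Lip_maps])
    show "mdist (Lip_metric E X) (c *\<^sub>R L) (c *\<^sub>R K) \<le> (\<bar>c\<bar> + 1) * mdist (Lip_metric E X) L K"
      if LK: "L \<in> Lip_maps E X" "K \<in> Lip_maps E X" for L K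
    proof (rule Lip_metric_upper)
      show "nrm F ((c *\<^sub>R L) x gs - (c *\<^sub>R K) x gs) \<le> (\<bar>c\<bar> + 1) * mdist (Lip_metric E X) L K * nrm E x * prod_nrm E gs"
        if "length gs = n" for x gs
        using order_trans[OF nrm_scaleR_bound[OF F, of c] mult_left_mono[OF Lip_metric_lower[OF LK that, of x]]]
        by (simp add: scaleR_fun_def mult_ac scaleR_diff_right)
    qed (simp_all add: LK subspace_scale[OF subspace_Lip_maps])
  qed
  from Lip_component_image[OF Lipschitz_continuous_imp_continuous_map[OF this] _ L]
  show "c *\<^sub>R L \<in> Lip_component" using zero_in_Lip_component by simp
qed

lemma mspace_Lip_metric0: "mspace (Lip_metric0 E X) = Lip_component"
  unfolding Lip_metric0_def using Lip_component_subset by (auto simp: mspace_Lip_metric)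

text \<open>\<open>map_code\<close> puts the argument of the linear map in front of the list, so the
  extra factor \<open>nrm E x\<close> of a Lipschitz bound becomes the first factor of
  \<open>prod_nrm E (x # gs)\<close>.\<close>

lemma level_Suc: "level E F (Suc n) (map_code_metric (Lip_metric0 E X))"
  unfolding level_def mspace_map_code_metric mspace_Lip_metric0
proof (intro conjI ballI allI impI)
  show "subspace (map_code ` Lip_component)"
    by (rule linear_subspace_image[OF _ subspace_Lip_component], rule linearI)
      (auto simp: map_code_def fun_eq_iff scaleR_fun_def split: list.split)
  show "S gs = 0" if S: "S \<in> map_code ` Lip_component" and len: "length gs \<noteq> Suc n" for S gs
  proof -
    obtain L where "L \<in> Lip_component" and SL: "S = map_code L" using S by (rule imageE)
    then have L: "L \<in> Lip_maps E X" using Lip_component_subset by blast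
    show ?thesis
      using len level_support[OF Lip_maps_range[OF L]] by (auto simp: SL map_code_def split: list.split)
  qed
next
  fix S T assume S: "S \<in> map_code ` Lip_component" and T: "T \<in> map_code ` Lip_component"
  obtain L where L: "L \<in> Lip_component" "S = map_code L" using S by (rule imageE)
  obtain H where H: "H \<in> Lip_component" "T = map_code H" using T by (rule imageE)
  note L = subsetD[OF Lip_component_subset L(1)] L(2) and H = subsetD[OF Lip_component_subset H(1)] H(2)
  show "nrm F (S gs - T gs) \<le> mdist (map_code_metric (Lip_metric0 E X)) S T * prod_nrm E gs"
    if "length gs = Suc n" for gs
    using that Lip_metric_lower[OF L(1) H(1)]
    by (cases gs) (auto simp: L(2) H(2) Lip_metric0_def mult_ac)
  show "mdist (map_code_metric (Lip_metric0 E X)) S T \<le> \<epsilon>"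
    if "0 \<le> \<epsilon>" "\<forall>gs. length gs = Suc n \<longrightarrow> nrm F (S gs - T gs) \<le> \<epsilon> * prod_nrm E gs" for \<epsilon>
  proof -
    have "nrm F (L x gs - H x gs) \<le> \<epsilon> * nrm E x * prod_nrm E gs" if "length gs = n" for x gs
      using \<open>\<forall>gs. length gs = Suc n \<longrightarrow> _\<close>[rule_format, of "x # gs"] that
      by (simp add: L(2) H(2) map_code_def mult_ac)
    then show ?thesis
      using Lip_metric_upper[OF L(1) H(1) that(1)] by (simp add: L(2) H(2) Lip_metric0_def)
  qed
qed

end

primrec target :: "'e::real_vector metric \<Rightarrow> 'f::real_vector metric \<Rightarrow> nat \<Rightarrow> ('e list \<Rightarrow> 'f) metric" where
  "target E F 0 = base_metric F"
| "target E F (Suc n) = map_code_metric (Lip_metric0 E (target E F n))"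

lemma level_target:
  assumes "standard_metric E" "standard_metric F"
  shows "level E F n (target E F n)"
  by (induction n) (simp_all add: level_base level_Suc assms)

lemma has_dir_deriv_unique_metric:
  assumes "has_dir_deriv X P p h v" "has_dir_deriv X P p h w"
  shows "v = w"
  using assms unfolding has_dir_deriv_def mtopology_of_def
  by (rule Metric_space.limitin_metric_unique[OF Metric_space_mspace_mdist]) simp

lemma dd_eq: "has_dir_deriv X P p h v \<Longrightarrow> dd X P p h = v"
  unfolding dd_def using has_dir_deriv_unique_metric by blast

text \<open>The ball is the union of the segments from its center: shrinking \<open>y - x\<close> by
  a factor in [0, 1] does not increase \<open>nrm\<close>.\<close>

lemma connectedin_ball:
  assumes E: "standard_metric E"
  shows "connectedin (mtopology_of E) {y. nrm E (y - x) < r}"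
proof (cases "r > 0")
  case True
  define S where "S y = (\<lambda>t. x + t *\<^sub>R (y - x)) ` {0..1::real}" for y
  have S: "connectedin (mtopology_of E) (S y)" "x \<in> S y" "y \<in> S y" for y
  proof -
    have "continuous_map euclideanreal (mtopology_of E) (\<lambda>t. x + t *\<^sub>R (y - x))"
      unfolding continuous_map_atin atin_euclidean
    proof
      fix s :: real
      have "((\<lambda>t. nrm E ((t - s) *\<^sub>R (y - x))) \<longlongrightarrow> 0) (at s)"
        using nrm_scaleR_tendsto[OF E, of "y - x"] filterlim_at_to_0[of "\<lambda>t. nrm E ((t - s) *\<^sub>R (y - x))" "nhds 0" s]
        by simp
      then have "tends E (\<lambda>t. x + t *\<^sub>R (y - x)) (x + s *\<^sub>R (y - x)) (at s)"
        by (simp add: tends_def algebra_simps)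
      then show "limitin (mtopology_of E) (\<lambda>t. x + t *\<^sub>R (y - x)) (x + s *\<^sub>R (y - x)) (at s)"
        unfolding limitin_mtopology_of tends_def tendsto_iff
        by (simp add: std_mspace[OF E] mdist_eq_nrm[OF E, of _ "x + s *\<^sub>R (y - x)"])
    qed
    then show "connectedin (mtopology_of E) (S y)"
      unfolding S_def by (rule connectedin_continuous_map_image) simp
    have "x + 0 *\<^sub>R (y - x) \<in> S y" "x + 1 *\<^sub>R (y - x) \<in> S y" unfolding S_def by (rule imageI, simp)+
    then show "x \<in> S y" "y \<in> S y" by simp_all
  qed
  have sub: "S y \<subseteq> {y. nrm E (y - x) < r}" if "nrm E (y - x) < r" for y
  proof
    fix z assume "z \<in> S y"
    then obtain t where t: "0 \<le> t" "t \<le> 1" "z = x + t *\<^sub>R (y - x)" by (auto simp: S_def)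
    then show "z \<in> {y. nrm E (y - x) < r}" using nrm_scaleR_le[OF E, of t "y - x"] that by simp
  qed
  have "{y. nrm E (y - x) < r} = \<Union> (S ` {y. nrm E (y - x) < r})"
    using S(3) sub by blast
  also have "connectedin (mtopology_of E) \<dots>"
  proof (rule connectedin_Union)
    show "\<Inter> (S ` {y. nrm E (y - x) < r}) \<noteq> {}"
      using S(2) True by (auto simp: nrm_zero[OF E])
  qed (use S(1) in auto)
  finally show ?thesis .
next
  case False
  then have "{y. nrm E (y - x) < r} = {}"
    using mdist_nonneg[of E _ 0] by (auto simp: not_less intro: order_trans)
  then show ?thesis by simp
qed

lemma openin_ball:
  assumes E: "standard_metric E"
  shows "openin (mtopology_of E) {y. nrm E (y - x) < r}"
  unfolding open_nrm[OF E]
proof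
  fix y assume "y \<in> {y. nrm E (y - x) < r}"
  then have y: "nrm E (y - x) < r" by simp
  have "nrm E (z - x) < r" if "nrm E (z - y) < r - nrm E (y - x)" for z
    using nrm_add[OF E, of "z - y" "y - x"] that by simp
  with y show "\<exists>r'>0. \<forall>z. nrm E (z - y) < r' \<longrightarrow> z \<in> {y. nrm E (y - x) < r}"
    by (intro exI[of _ "r - nrm E (y - x)"]) auto
qed

lemma continuous_map_std_iff:
  assumes E: "standard_metric E"
  shows "continuous_map (subtopology (mtopology_of E) U) (mtopology_of X) f \<longleftrightarrow>
    f ` U \<subseteq> mspace X \<and>
    (\<forall>x\<in>U. \<forall>\<epsilon>>0. \<exists>\<delta>>0. \<forall>y\<in>U. nrm E (y - x) < \<delta> \<longrightarrow> mdist X (f y) (f x) < \<epsilon>)"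
proof -
  define g where "g x y = nrm E (y - x)" for x y
  have g: "mdist E x y = g x y" for x y
    unfolding g_def by (metis mdist_eq_nrm[OF E] mdist_commute)
  have g0: "g (y - x) 0 = g x y" for x y
    unfolding g_def using nrm_minus[OF E, of "y - x"] by simp
  show ?thesis
    unfolding continuous_map_subtopology_mtopology_of[OF subset_UNIV[of U, folded std_mspace[OF E]]] g g0
    by (simp only: mdist_commute[of X "f _" "f _"])
qed

section \<open>A criterion for b-differentiability\<close>

context
  fixes E :: "'e::real_vector metric" and F :: "'f::real_vector metric" and n X
  assumes E: "standard_metric E" and F: "standard_metric F" and X: "level E F n X"
begin

text \<open>Splitting the difference into \<open>(L - H) h\<close> and
  \<open>H (h - k)\<close>.\<close>

lemma Lip_apply_le:
  assumes L: "L \<in> Lip_maps E X" and H: "H \<in> Lip_maps E X"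
  shows "mdist X (L h) (H k) \<le> mdist (Lip_metric E X) L H * nrm E h + Lip_norm E X H * nrm E (h - k)"
proof (rule level_upper[OF E F X])
  fix gs :: "'e list" assume gs: "length gs = n"
  have "H h gs - H k gs = H (h - k) gs"
    using linear_diff[OF Lip_maps_linear[OF E F X H], of h k] by simp
  then show "nrm F (L h gs - H k gs) \<le>
     (mdist (Lip_metric E X) L H * nrm E h + Lip_norm E X H * nrm E (h - k)) * prod_nrm E gs"
    using nrm_add[OF F, of "L h gs - H h gs" "H h gs - H k gs"]
      Lip_metric_lower[OF E F X L H gs, of h] Lip_norm_lower[OF E F X H gs, of "h - k"]
    by (simp add: algebra_simps)
qed (use L H Lip_maps_range[OF E F X] Lip_norm_nonneg[OF E F X] in auto)

lemma Lip_maps_cont_lin: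
  assumes L: "L \<in> Lip_maps E X"
  shows "L \<in> cont_lin E X"
proof -
  have "continuous_map (mtopology_of E) (mtopology_of X) L"
  proof (rule Lipschitz_continuous_imp_continuous_map)
    show "Lipschitz_continuous_map E X L"
      unfolding Lipschitz_continuous_map_def
    proof (intro conjI exI ballI)
      show "L \<in> mspace E \<rightarrow> mspace X" using Lip_maps_range[OF E F X L] by auto
      have "mdist (Lip_metric E X) L L = 0" using L by (simp add: mspace_Lip_metric[OF E F X])
      then show "mdist X (L h) (L k) \<le> Lip_norm E X L * mdist E h k" for h k
        using Lip_apply_le[OF L L, of h k] mdist_eq_nrm[OF E, of h k] by simp
    qed
  qed
  then show ?thesis using Lip_maps_linear[OF E F X L] by (simp add: cont_lin_def)
qed

lemma Lip_eval_continuous: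
  assumes L: "\<And>x. x \<in> U \<Longrightarrow> L x \<in> Lip_maps E X" and U: "openin (mtopology_of E) U"
    and cL: "continuous_map (subtopology (mtopology_of E) U) (mtopology_of (Lip_metric E X)) L"
  shows "continuous_map (prod_topology (subtopology (mtopology_of E) U) (mtopology_of E)) (mtopology_of X)
    (\<lambda>(u, h). L u h)"
proof -
  interpret X: Metric_space "mspace X" "mdist X" by simp
  have cL': "\<exists>\<delta>>0. \<forall>y\<in>U. nrm E (y - x) < \<delta> \<longrightarrow> mdist (Lip_metric E X) (L y) (L x) < \<epsilon>"
    if "x \<in> U" "\<epsilon> > 0" for x \<epsilon>
    using cL that unfolding continuous_map_std_iff[OF E] by blast
  have eq: "mtopology_of X = X.mtopology" by (simp add: mtopology_of_def)
  show ?thesis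
    unfolding eq X.continuous_map_to_metric
  proof (intro ballI allI impI)
    fix z and \<epsilon> :: real
    assume "z \<in> topspace (prod_topology (subtopology (mtopology_of E) U) (mtopology_of E))" and \<epsilon>: "\<epsilon> > 0"
    then obtain x h where z: "z = (x, h)" and x: "x \<in> U" by auto
    \<comment> \<open>The sum of the coefficients of \<eta> in the estimate of
      \<open>Lip_apply_le\<close>, with \<open>nrm E k\<close> bounded by
      \<open>nrm E h + 1\<close>.\<close>
    define M where "M = Lip_norm E X (L x) + (nrm E h + 1)"
    have M: "M > 0"
      using Lip_norm_nonneg[OF E F X L[OF x]] mdist_nonneg[of E h 0] unfolding M_def by linarith
    define \<eta> where "\<eta> = \<epsilon> / (2 * M)"
    have \<eta>: "\<eta> > 0" using \<epsilon> M by (simp add: \<eta>_def)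
    obtain \<delta> where \<delta>: "\<delta> > 0" "\<And>y. y \<in> U \<Longrightarrow> nrm E (y - x) < \<delta> \<Longrightarrow> mdist (Lip_metric E X) (L y) (L x) < \<eta>"
      using cL'[OF x \<eta>] by blast
    define A where "A = {y. nrm E (y - x) < \<delta>} \<inter> U"
    define B where "B = {k. nrm E (k - h) < min 1 \<eta>}"
    have "openin (prod_topology (subtopology (mtopology_of E) U) (mtopology_of E)) (A \<times> B)"
      unfolding openin_prod_Times_iff A_def B_def using openin_ball[OF E] openin_subtopology by blast
    moreover have "z \<in> A \<times> B" using x \<delta> \<eta> by (simp add: z A_def B_def nrm_zero[OF E])
    moreover have "\<forall>w\<in>A \<times> B. (case w of (u, h) \<Rightarrow> L u h) \<in> X.mball (case z of (u, h) \<Rightarrow> L u h) \<epsilon>"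
    proof
      fix w assume "w \<in> A \<times> B"
      then obtain y k where w: "w = (y, k)" "y \<in> A" "k \<in> B" by auto
      have y: "y \<in> U" "mdist (Lip_metric E X) (L y) (L x) < \<eta>" using w \<delta> by (auto simp: A_def)
      have k: "nrm E (k - h) < 1" "nrm E (k - h) < \<eta>" using w by (auto simp: B_def)
      have k1: "nrm E k \<le> nrm E h + 1" using nrm_diff_le[OF E, of k h] k by linarith
      have "mdist X (L y k) (L x h) \<le> mdist (Lip_metric E X) (L y) (L x) * nrm E k + Lip_norm E X (L x) * nrm E (k - h)"
        by (rule Lip_apply_le[OF L[OF y(1)] L[OF x]])
      also have "\<dots> \<le> \<eta> * (nrm E h + 1) + Lip_norm E X (L x) * \<eta>"
        using y k k1 \<eta> Lip_norm_nonneg[OF E F X L[OF x]] by (intro add_mono mult_mono) auto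
      also have "\<dots> = \<eta> * M" by (simp add: M_def algebra_simps)
      also have "\<dots> = \<epsilon> / 2" using M by (simp add: \<eta>_def)
      also have "\<dots> < \<epsilon>" using \<epsilon> by simp
      finally show "(case w of (u, h) \<Rightarrow> L u h) \<in> X.mball (case z of (u, h) \<Rightarrow> L u h) \<epsilon>"
        using Lip_maps_range[OF E F X L] x y by (simp add: z w X.in_mball mdist_commute)
    qed
    ultimately show "\<exists>W. openin (prod_topology (subtopology (mtopology_of E) U) (mtopology_of E)) W \<and> z \<in> W \<and>
        (\<forall>w\<in>W. (case w of (u, h) \<Rightarrow> L u h) \<in> X.mball (case z of (u, h) \<Rightarrow> L u h) \<epsilon>)" by blast
  qed
qed

text \<open>Currying: if L u maps a compact K into the open set W, the tube lemma gives a
  neighborhood of u over which K is still mapped into W.\<close>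

lemma continuous_map_compact_open:
  assumes L: "\<And>x. x \<in> U \<Longrightarrow> L x \<in> cont_lin E X"
    and c: "continuous_map (prod_topology (subtopology (mtopology_of E) U) (mtopology_of E)) (mtopology_of X)
      (\<lambda>(u, h). L u h)"
  shows "continuous_map (subtopology (mtopology_of E) U) (compact_open E X) L"
  unfolding compact_open_def
proof (rule continuous_on_generated_topo)
  let ?T = "subtopology (mtopology_of E) U"
  fix S assume "S \<in> {{L \<in> cont_lin E X. L ` K \<subseteq> W} |K W. compactin (mtopology_of E) K \<and> openin (mtopology_of X) W}"
  then obtain K W where S: "S = {L \<in> cont_lin E X. L ` K \<subseteq> W}" and K: "compactin (mtopology_of E) K"
    and W: "openin (mtopology_of X) W" by auto
  have top: "topspace ?T = U" by (simp add: std_mspace[OF E])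
  let ?O = "{z \<in> topspace (prod_topology ?T (mtopology_of E)). (case z of (u, h) \<Rightarrow> L u h) \<in> W}"
  have O: "openin (prod_topology ?T (mtopology_of E)) ?O"
    by (rule openin_continuous_map_preimage[OF c W])
  show "openin ?T (L -` S \<inter> topspace ?T)"
  proof (subst openin_subopen, intro ballI)
    fix u assume u: "u \<in> L -` S \<inter> topspace ?T"
    have "{u} \<times> K \<subseteq> ?O" using u by (auto simp: S std_mspace[OF E])
    then obtain A B where AB: "openin ?T A" "u \<in> A" "K \<subseteq> B" "A \<times> B \<subseteq> ?O"
      using tube_lemma_right[OF O K, of u] u by blast
    have "A \<subseteq> L -` S \<inter> topspace ?T"
    proof
      fix a assume a: "a \<in> A"
      then have aU: "a \<in> U" using openin_subset[OF AB(1)] by (auto simp: top)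
      have "L a ` K \<subseteq> W"
      proof
        fix w assume "w \<in> L a ` K"
        then obtain k where k: "k \<in> K" "w = L a k" by blast
        then have "(a, k) \<in> ?O" using AB(3,4) a by blast
        then show "w \<in> W" using k(2) by simp
      qed
      then show "a \<in> L -` S \<inter> topspace ?T" using L[OF aU] aU unfolding top by (simp add: S)
    qed
    with AB show "\<exists>T. openin ?T T \<and> u \<in> T \<and> T \<subseteq> L -` S \<inter> topspace ?T" by blast
  qed
next
  show "L ` topspace (subtopology (mtopology_of E) U) \<subseteq>
     \<Union> {{L \<in> cont_lin E X. L ` K \<subseteq> W} |K W. compactin (mtopology_of E) K \<and> openin (mtopology_of X) W}"
  proof
    fix H assume "H \<in> L ` topspace (subtopology (mtopology_of E) U)"
    \<comment> \<open>For the empty compact set the subbasic set is all of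
      \<open>cont_lin E X\<close>, so every value belongs to the carrier of the generated
      topology.\<close>
    then have "H \<in> {L \<in> cont_lin E X. L ` {} \<subseteq> {}}" using L by auto
    moreover have "{L \<in> cont_lin E X. L ` {} \<subseteq> {}} \<in>
       {{L \<in> cont_lin E X. L ` K \<subseteq> W} |K W. compactin (mtopology_of E) K \<and> openin (mtopology_of X) W}"
      by (intro CollectI exI[of _ "{}"] conjI) auto
    ultimately show "H \<in> \<Union> {{L \<in> cont_lin E X. L ` K \<subseteq> W} |K W. compactin (mtopology_of E) K \<and> openin (mtopology_of X) W}"
      by (rule UnionI[rotated])
  qed
qed

text \<open>Continuity of the derivative in the operator metric is enough: it makes evaluation
  jointly continuous, and this in turn gives continuity into the compact-open topology.\<close>

lemma b_diffI:
  assumes U: "openin (mtopology_of E) U"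
    and cQ: "continuous_map (subtopology (mtopology_of E) U) (mtopology_of X) Q"
    and L: "\<And>x. x \<in> U \<Longrightarrow> L x \<in> Lip_maps E X"
    and d: "\<And>x h. x \<in> U \<Longrightarrow> has_dir_deriv X Q x h (L x h)"
    and cL: "continuous_map (subtopology (mtopology_of E) U) (mtopology_of (Lip_metric E X)) L"
  shows "b_diff E X U Q"
proof -
  have dd: "dd X Q x = L x" if "x \<in> U" for x
    by (rule ext) (rule dd_eq[OF d[OF that]])
  have top: "topspace (subtopology (mtopology_of E) U) = U" by (simp add: std_mspace[OF E])
  have eval: "continuous_map (prod_topology (subtopology (mtopology_of E) U) (mtopology_of E)) (mtopology_of X)
    (\<lambda>(u, h). L u h)" by (rule Lip_eval_continuous[OF L U cL])
  have co: "continuous_map (subtopology (mtopology_of E) U) (compact_open E X) L"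
    by (rule continuous_map_compact_open[OF Lip_maps_cont_lin[OF L] eval])
  show ?thesis
    unfolding b_diff_def keller_diff_def
  proof (intro conjI ballI)
    show "diff_at X Q p" if "p \<in> U" for p
      unfolding diff_at_def using Lip_maps_linear[OF E F X L[OF that]] d[OF that] by blast
    show "dd X Q p \<in> cont_lin E X" if "p \<in> U" for p using Lip_maps_cont_lin[OF L[OF that]] dd[OF that] by simp
    show "dd X Q p \<in> Lip_maps E X" if "p \<in> U" for p using L[OF that] dd[OF that] by simp
    show "continuous_map (subtopology (mtopology_of E) U) (compact_open E X) (dd X Q)"
      by (rule continuous_map_eq[OF co]) (simp add: dd top)
    show "continuous_map (subtopology (mtopology_of E) U) (mtopology_of (Lip_metric E X)) (dd X Q)"
      by (rule continuous_map_eq[OF cL]) (simp add: dd top)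
    show "continuous_map (prod_topology (subtopology (mtopology_of E) U) (mtopology_of E)) (mtopology_of X)
      (\<lambda>(u, h). dd X Q u h)"
      by (rule continuous_map_eq[OF eval]) (auto simp: dd)
  qed (rule U cQ)+
qed

lemma b_diff_has_dir_deriv:
  assumes "b_diff E X U Q" "x \<in> U"
  shows "has_dir_deriv X Q x h (dd X Q x h)"
proof -
  obtain M where "\<forall>h. has_dir_deriv X Q x h (M h)"
    using assms unfolding b_diff_def keller_diff_def diff_at_def by blast
  then show ?thesis using dd_eq by metis
qed

text \<open>Evaluation at gs is Lipschitz with constant \<open>prod_nrm E gs\<close>, so it
  preserves limits of difference quotients.\<close>

lemma level_has_dir_deriv:
  assumes d: "has_dir_deriv X Q x h v" and Q: "\<forall>\<^sub>F t in at 0. Q (x + t *\<^sub>R h) \<in> mspace X" "Q x \<in> mspace X"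
    and gs: "length gs = n"
  shows "has_dir_deriv F (\<lambda>y. Q y gs) x h (v gs)"
  unfolding has_dir_deriv_iff_tends[OF F]
proof (rule tends_epsI[OF F])
  show "0 \<le> prod_nrm E gs" by simp
  fix \<epsilon> :: real assume \<epsilon>: "\<epsilon> > 0"
  have v: "v \<in> mspace X" using d by (simp add: has_dir_deriv_def limitin_mtopology_of)
  have "\<forall>\<^sub>F t in at 0. (Q (x + t *\<^sub>R h) - Q x) /\<^sub>R t \<in> mspace X \<and> mdist X ((Q (x + t *\<^sub>R h) - Q x) /\<^sub>R t) v < \<epsilon>"
    using d \<epsilon> by (simp add: has_dir_deriv_def limitin_mtopology_of)
  then show "\<forall>\<^sub>F t in at 0. nrm F ((Q (x + t *\<^sub>R h) gs - Q x gs) /\<^sub>R t - v gs) \<le> \<epsilon> * prod_nrm E gs"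
  proof (rule eventually_mono)
    fix t assume t: "(Q (x + t *\<^sub>R h) - Q x) /\<^sub>R t \<in> mspace X \<and> mdist X ((Q (x + t *\<^sub>R h) - Q x) /\<^sub>R t) v < \<epsilon>"
    have "nrm F (((Q (x + t *\<^sub>R h) - Q x) /\<^sub>R t) gs - v gs) \<le> mdist X ((Q (x + t *\<^sub>R h) - Q x) /\<^sub>R t) v * prod_nrm E gs"
      using t by (intro level_lower[OF E F X _ v gs]) simp
    also have "\<dots> \<le> \<epsilon> * prod_nrm E gs" using t by (intro mult_right_mono) auto
    finally show "nrm F ((Q (x + t *\<^sub>R h) gs - Q x gs) /\<^sub>R t - v gs) \<le> \<epsilon> * prod_nrm E gs"
      by (simp add: scaleR_fun_def)
  qed
qed

end

subsection \<open>From jets to maps of class MC\<close>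

text \<open>The derivative of order k as an element of the k-th target. \<open>map_code\<close> and
  jets both put the newest direction first, so its value at gs is plainly \<open>D gs x\<close>; the
  list hs holds further directions in which it has been differentiated since.\<close>

definition jet_code :: "('e list \<Rightarrow> 'e \<Rightarrow> 'f::real_vector) \<Rightarrow> nat \<Rightarrow> 'e list \<Rightarrow> 'e \<Rightarrow> 'e list \<Rightarrow> 'f" where
  "jet_code D k hs x = (\<lambda>gs. if length gs = k then D (hs @ gs) x else 0)"

lemma jet_code_Suc: "jet_code D (Suc k) hs x = map_code (\<lambda>g. jet_code D k (hs @ [g]) x)"
  by (auto simp: jet_code_def map_code_def fun_eq_iff split: list.split)

lemma jet_code_0: "jet_code D 0 hs x = base_code (D hs x)"
  by (auto simp: jet_code_def base_code_def fun_eq_iff)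

lemma has_dir_derivI:
  assumes "v \<in> mspace X"
    "\<And>\<epsilon>. \<epsilon> > 0 \<Longrightarrow> \<forall>\<^sub>F t in at 0. (Q (x + t *\<^sub>R h) - Q x) /\<^sub>R t \<in> mspace X \<and>
       mdist X ((Q (x + t *\<^sub>R h) - Q x) /\<^sub>R t) v < \<epsilon>"
  shows "has_dir_deriv X Q x h v"
  using assms by (simp add: has_dir_deriv_def limitin_mtopology_of)

context
  fixes E :: "'e::real_vector metric" and F :: "'f::real_vector metric" and U D
  assumes E: "standard_metric E" and F: "standard_metric F" and J: "jet E F U D"
begin

lemma jet_eventually_deriv:
  assumes x: "x \<in> U" and \<epsilon>: "\<epsilon> > 0"
  shows "\<forall>\<^sub>F t in at 0. \<forall>hs. length hs = n \<longrightarrow>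
    nrm F ((D hs (x + t *\<^sub>R h) - D hs x) /\<^sub>R t - D (h # hs) x) \<le> \<epsilon> * prod_nrm E hs"
proof -
  have pos: "nrm E h + 1 > 0" using mdist_nonneg[of E h 0] by linarith
  obtain \<delta> where \<delta>: "\<delta> > 0" "\<And>t q hs. t \<noteq> 0 \<Longrightarrow> nrm E (t *\<^sub>R q) < \<delta> \<Longrightarrow> length hs = n \<Longrightarrow>
       nrm F ((D hs (x + t *\<^sub>R q) - D hs x) /\<^sub>R t - D (q # hs) x) \<le> \<epsilon> / (nrm E h + 1) * (nrm E q * prod_nrm E hs)"
    using jet_uniform_deriv[OF E F J x, of "\<epsilon> / (nrm E h + 1)"] \<epsilon> pos by (metis divide_pos_pos)
  have "\<forall>\<^sub>F t in at 0. nrm E (t *\<^sub>R h) < \<delta>"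
    by (rule order_tendstoD(2)[OF nrm_scaleR_tendsto[OF E] \<delta>(1)])
  moreover have "\<forall>\<^sub>F t in at (0::real). t \<noteq> 0" by (simp add: eventually_at_filter)
  ultimately show ?thesis
  proof eventually_elim
    case (elim t)
    show ?case
    proof (intro allI impI)
      fix hs :: "'e list" assume hs: "length hs = n"
      have "\<epsilon> / (nrm E h + 1) * (nrm E h * prod_nrm E hs) \<le> \<epsilon> * prod_nrm E hs"
      proof -
        have "\<epsilon> / (nrm E h + 1) * nrm E h \<le> \<epsilon>" using \<epsilon> pos by (simp add: field_simps)
        from mult_right_mono[OF this, of "prod_nrm E hs"] show ?thesis by (simp add: mult_ac)
      qed
      then show "nrm F ((D hs (x + t *\<^sub>R h) - D hs x) /\<^sub>R t - D (h # hs) x) \<le> \<epsilon> * prod_nrm E hs"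
        using \<delta>(2)[OF elim(2,1) hs] by linarith
    qed
  qed
qed

context
  fixes k
  assumes mem: "\<And>hs x. hs \<noteq> [] \<Longrightarrow> x \<in> U \<Longrightarrow> jet_code D k hs x \<in> mspace (target E F k)"
begin

abbreviation (input) "jet_map hs x \<equiv> (\<lambda>g. jet_code D k (hs @ [g]) x)"

lemma jet_map_Lip:
  assumes x: "x \<in> U"
  shows "jet_map hs x \<in> Lip_maps E (target E F k)"
  unfolding Lip_maps_iff[OF E F level_target[OF E F]]
proof (intro conjI)
  show "linear (jet_map hs x)"
    using linear_add[OF jet_linear[OF E F J x, of hs]] linear_cmul[OF jet_linear[OF E F J x, of hs]]
    by (intro linearI ext) (simp_all add: jet_code_def scaleR_fun_def)
  show "range (jet_map hs x) \<subseteq> mspace (target E F k)" using mem x by auto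
  obtain C where C: "C \<ge> 0" "\<And>ks. length ks = Suc (length hs + k) \<Longrightarrow> nrm F (D ks x) \<le> C * prod_nrm E ks"
    using jet_bound[OF E F J x] by blast
  show "\<exists>C\<ge>0. \<forall>h gs. length gs = k \<longrightarrow> nrm F (jet_map hs x h gs) \<le> C * nrm E h * prod_nrm E gs"
  proof (intro exI[of _ "C * prod_nrm E hs"] conjI allI impI)
    fix h and gs :: "'e list" assume "length gs = k"
    then show "nrm F (jet_map hs x h gs) \<le> C * prod_nrm E hs * nrm E h * prod_nrm E gs"
      using C(2)[of "hs @ h # gs"] by (simp add: jet_code_def mult_ac)
  qed (use C in simp)
qed

lemma jet_map_continuous:
  "continuous_map (subtopology (mtopology_of E) U) (mtopology_of (Lip_metric E (target E F k))) (jet_map hs)"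
  unfolding continuous_map_std_iff[OF E]
proof (intro conjI ballI allI impI)
  show "jet_map hs ` U \<subseteq> mspace (Lip_metric E (target E F k))"
    using jet_map_Lip by (auto simp: mspace_Lip_metric[OF E F level_target[OF E F]])
  fix x and \<epsilon> :: real assume x: "x \<in> U" and \<epsilon>: "\<epsilon> > 0"
  define \<eta> where "\<eta> = \<epsilon> / (2 * (prod_nrm E hs + 1))"
  have pos: "prod_nrm E hs + 1 > 0" using prod_nrm_nonneg[of E hs] by linarith
  have \<eta>: "\<eta> > 0" using \<epsilon> pos by (simp add: \<eta>_def)
  have \<eta>p: "\<eta> * prod_nrm E hs < \<epsilon>" using \<epsilon> pos prod_nrm_nonneg[of E hs]
    unfolding \<eta>_def by (simp add: field_simps add_pos_nonneg)
  obtain \<delta> where \<delta>: "\<delta> > 0" "\<And>y ks. nrm E (y - x) < \<delta> \<Longrightarrow> length ks = Suc (length hs + k) \<Longrightarrow>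
      nrm F (D ks y - D ks x) \<le> \<eta> * prod_nrm E ks"
    using jet_cont[OF E F J x \<eta>] by metis
  show "\<exists>\<delta>>0. \<forall>y\<in>U. nrm E (y - x) < \<delta> \<longrightarrow>
      mdist (Lip_metric E (target E F k)) (jet_map hs y) (jet_map hs x) < \<epsilon>"
  proof (intro exI[of _ \<delta>] conjI ballI impI \<delta>(1))
    fix y assume y: "y \<in> U" "nrm E (y - x) < \<delta>"
    have "mdist (Lip_metric E (target E F k)) (jet_map hs y) (jet_map hs x) \<le> \<eta> * prod_nrm E hs"
    proof (rule Lip_metric_upper[OF E F level_target[OF E F] jet_map_Lip[OF y(1)] jet_map_Lip[OF x]])
      show "nrm F (jet_map hs y g gs - jet_map hs x g gs) \<le> \<eta> * prod_nrm E hs * nrm E g * prod_nrm E gs"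
        if "length gs = k" for g gs
        using \<delta>(2)[OF y(2), of "hs @ g # gs"] that by (simp add: jet_code_def mult_ac)
    qed (use \<eta> in simp)
    with \<eta>p show "mdist (Lip_metric E (target E F k)) (jet_map hs y) (jet_map hs x) < \<epsilon>" by linarith
  qed
qed

text \<open>Differences of a continuous map on a connected set stay in the component of 0.\<close>

lemma jet_map_diff_component:
  assumes V: "V \<subseteq> U" "connectedin (mtopology_of E) V" and xy: "x \<in> V" "y \<in> V"
  shows "jet_map hs y - jet_map hs x \<in> connected_component_of_set (mtopology_of (Lip_metric E (target E F k))) 0"
proof -
  let ?L = "Lip_metric E (target E F k)"
  have x: "x \<in> U" using V xy by blast
  note sub = subspace_diff[OF subspace_Lip_maps[OF E F level_target[OF E F]]]
  have "continuous_map (mtopology_of ?L) (mtopology_of ?L) (\<lambda>L. L - jet_map hs x)"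
  proof (rule Lipschitz_continuous_imp_continuous_map)
    show "Lipschitz_continuous_map ?L ?L (\<lambda>L. L - jet_map hs x)"
      unfolding Lipschitz_continuous_map_def mspace_Lip_metric[OF E F level_target[OF E F]]
    proof (intro conjI exI ballI)
      show "(\<lambda>L. L - jet_map hs x) \<in> Lip_maps E (target E F k) \<rightarrow> Lip_maps E (target E F k)"
        by (rule funcsetI) (rule sub[OF _ jet_map_Lip[OF x]])
      show "mdist ?L (L - jet_map hs x) (K - jet_map hs x) \<le> 1 * mdist ?L L K"
        if L: "L \<in> Lip_maps E (target E F k)" and K: "K \<in> Lip_maps E (target E F k)" for L K
        unfolding mdist_Lip_metric[OF E F level_target[OF E F] L K]
          mdist_Lip_metric[OF E F level_target[OF E F] sub[OF L jet_map_Lip[OF x]] sub[OF K jet_map_Lip[OF x]]]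
        by simp
    qed
  qed
  then have "continuous_map (subtopology (mtopology_of E) U) (mtopology_of ?L) (\<lambda>y. jet_map hs y - jet_map hs x)"
    using continuous_map_compose[OF jet_map_continuous] by (simp add: o_def)
  moreover have "connectedin (subtopology (mtopology_of E) U) V"
    using V by (simp add: connectedin_subtopology)
  ultimately have "connectedin (mtopology_of ?L) ((\<lambda>y. jet_map hs y - jet_map hs x) ` V)"
    by (rule connectedin_continuous_map_image)
  moreover have "0 \<in> (\<lambda>y. jet_map hs y - jet_map hs x) ` V" using xy(1) by (rule image_eqI[rotated]) simp
  ultimately have "(\<lambda>y. jet_map hs y - jet_map hs x) ` V \<subseteq> connected_component_of_set (mtopology_of ?L) 0"
    by (rule connected_component_of_maximal)
  from this[unfolded image_subset_iff, rule_format, OF xy(2)] show ?thesis .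
qed

text \<open>Difference quotients along a short segment lie in the component of 0: differences do,
  since the ball is connected, and the component is a subspace. It is also closed, so it contains
  their limit, the directional derivative.\<close>

lemma jet_map_component:
  assumes x: "x \<in> U"
  shows "jet_map (h # hs) x \<in> connected_component_of_set (mtopology_of (Lip_metric E (target E F k))) 0"
proof -
  let ?L = "Lip_metric E (target E F k)"
  note subm = subspace_Lip_maps[OF E F level_target[OF E F]]
  obtain r where r: "r > 0" "\<And>y. nrm E (y - x) < r \<Longrightarrow> y \<in> U" using jet_nbhd[OF E F J x] by blast
  have ev: "\<forall>\<^sub>F t in at 0. nrm E (t *\<^sub>R h) < r"
    by (rule order_tendstoD(2)[OF nrm_scaleR_tendsto[OF E] r(1)])
  show ?thesis
  proof (rule limitin_closedin)
    have "has_dir_deriv ?L (jet_map hs) x h (jet_map (h # hs) x)"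
    proof (rule has_dir_derivI)
      show "jet_map (h # hs) x \<in> mspace ?L"
        by (simp only: mspace_Lip_metric[OF E F level_target[OF E F]] jet_map_Lip[OF x])
      fix \<epsilon> :: real assume \<epsilon>: "\<epsilon> > 0"
      define \<eta> where "\<eta> = \<epsilon> / (2 * (prod_nrm E hs + 1))"
      have pos: "prod_nrm E hs + 1 > 0" using prod_nrm_nonneg[of E hs] by linarith
      have \<eta>: "\<eta> > 0" using \<epsilon> pos by (simp add: \<eta>_def)
      have \<eta>p: "\<eta> * prod_nrm E hs < \<epsilon>" using \<epsilon> pos prod_nrm_nonneg[of E hs]
        unfolding \<eta>_def by (simp add: field_simps add_pos_nonneg)
      show "\<forall>\<^sub>F t in at 0. (jet_map hs (x + t *\<^sub>R h) - jet_map hs x) /\<^sub>R t \<in> mspace ?L \<and>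
        mdist ?L ((jet_map hs (x + t *\<^sub>R h) - jet_map hs x) /\<^sub>R t) (jet_map (h # hs) x) < \<epsilon>"
        using ev jet_eventually_deriv[OF x \<eta>, of "Suc (length hs + k)" h]
      proof eventually_elim
        case (elim t)
        have xt: "x + t *\<^sub>R h \<in> U" using r(2)[of "x + t *\<^sub>R h"] elim by simp
        have m: "(jet_map hs (x + t *\<^sub>R h) - jet_map hs x) /\<^sub>R t \<in> Lip_maps E (target E F k)"
          by (intro subspace_scale[OF subm] subspace_diff[OF subm] jet_map_Lip x xt)
        have "mdist ?L ((jet_map hs (x + t *\<^sub>R h) - jet_map hs x) /\<^sub>R t) (jet_map (h # hs) x) \<le> \<eta> * prod_nrm E hs"
        proof (rule Lip_metric_upper[OF E F level_target[OF E F] m jet_map_Lip[OF x]])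
          show "nrm F (((jet_map hs (x + t *\<^sub>R h) - jet_map hs x) /\<^sub>R t) g gs - jet_map (h # hs) x g gs)
             \<le> \<eta> * prod_nrm E hs * nrm E g * prod_nrm E gs" if "length gs = k" for g gs
            using elim(2)[rule_format, of "hs @ g # gs"] that by (simp add: jet_code_def scaleR_fun_def mult_ac)
        qed (use \<eta> in simp)
        with m \<eta>p show ?case unfolding mspace_Lip_metric[OF E F level_target[OF E F]] by linarith
      qed
    qed
    then show "limitin (mtopology_of ?L) (\<lambda>t. (jet_map hs (x + t *\<^sub>R h) - jet_map hs x) /\<^sub>R t) (jet_map (h # hs) x) (at 0)"
      by (simp only: has_dir_deriv_def)
    show "closedin (mtopology_of ?L) (connected_component_of_set (mtopology_of ?L) 0)"
      by (rule closedin_connected_component_of)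
    show "\<forall>\<^sub>F t in at 0. (jet_map hs (x + t *\<^sub>R h) - jet_map hs x) /\<^sub>R t \<in> connected_component_of_set (mtopology_of ?L) 0"
      using ev
    proof eventually_elim
      case (elim t)
      show ?case
      proof (rule subspace_scale[OF subspace_Lip_component[OF E F level_target[OF E F]]])
        show "jet_map hs (x + t *\<^sub>R h) - jet_map hs x \<in> connected_component_of_set (mtopology_of ?L) 0"
          by (rule jet_map_diff_component[OF _ connectedin_ball[OF E, of x r]])
            (use r elim in \<open>auto simp: nrm_zero[OF E]\<close>)
      qed
    qed
  qed simp
qed

end

text \<open>Induction on the level: membership at level k makes the coded maps continuous into the
  space of Lipschitz maps, and \<open>jet_map_component\<close> then places their derivatives in its
  component of 0. The list hs is nonempty because at positive levels the derivative itself need not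
  lie in the component, only differences of its values and their limits do.\<close>

lemma jet_code_mem:
  assumes "hs \<noteq> []" "x \<in> U"
  shows "jet_code D k hs x \<in> mspace (target E F k)"
  using assms
proof (induction k arbitrary: hs x)
  case 0
  then show ?case by (simp add: jet_code_0 std_mspace[OF F])
next
  case (Suc k)
  obtain h hs' where "hs = h # hs'" using Suc.prems by (cases hs) auto
  then show ?case
    using jet_map_component[of k x h hs', OF Suc.IH Suc.prems(2)] Suc.prems(2)
    unfolding jet_code_Suc target.simps mspace_map_code_metric mspace_Lip_metric0[OF E F level_target[OF E F]]
    by (auto intro!: imageI)
qed

lemmas jet_map_Lip' = jet_map_Lip[OF jet_code_mem]
  and jet_map_continuous' = jet_map_continuous[OF jet_code_mem]
  and jet_map_diff_component' = jet_map_diff_component[OF jet_code_mem]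

text \<open>The constant c stands for the value at x0 that the recursion of \<open>MC_code\<close>
  subtracts to bring the map into the component of 0.\<close>

lemma jet_b_diff:
  assumes V: "V \<subseteq> U" "openin (mtopology_of E) V"
    and Q: "\<And>x. x \<in> V \<Longrightarrow> Q x = jet_code D k [] x - c" "\<And>x. x \<in> V \<Longrightarrow> Q x \<in> mspace (target E F k)"
  shows "continuous_map (subtopology (mtopology_of E) V) (mtopology_of (target E F k)) Q"
    and "b_diff E (target E F k) V Q"
    and "x \<in> V \<Longrightarrow> dd (target E F k) Q x = (\<lambda>g. jet_code D k [g] x)"
proof -
  let ?X = "target E F k"
  show cQ: "continuous_map (subtopology (mtopology_of E) V) (mtopology_of ?X) Q"
    unfolding continuous_map_std_iff[OF E]
  proof (intro conjI ballI allI impI)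
    show "Q ` V \<subseteq> mspace ?X" using Q(2) by auto
    fix x and \<epsilon> :: real assume x: "x \<in> V" and \<epsilon>: "\<epsilon> > 0"
    have xU: "x \<in> U" using x V by blast
    obtain \<delta> where \<delta>: "\<delta> > 0" "\<And>y ks. nrm E (y - x) < \<delta> \<Longrightarrow> length ks = k \<Longrightarrow>
        nrm F (D ks y - D ks x) \<le> (\<epsilon> / 2) * prod_nrm E ks"
      using jet_cont[OF E F J xU, of "\<epsilon> / 2"] \<epsilon> by (metis half_gt_zero)
    show "\<exists>\<delta>>0. \<forall>y\<in>V. nrm E (y - x) < \<delta> \<longrightarrow> mdist ?X (Q y) (Q x) < \<epsilon>"
    proof (intro exI[of _ \<delta>] conjI ballI impI \<delta>(1))
      fix y assume y: "y \<in> V" "nrm E (y - x) < \<delta>"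
      have "mdist ?X (Q y) (Q x) \<le> \<epsilon> / 2"
      proof (rule level_upper[OF E F level_target[OF E F] Q(2)[OF y(1)] Q(2)[OF x]])
        show "nrm F (Q y gs - Q x gs) \<le> \<epsilon> / 2 * prod_nrm E gs" if "length gs = k" for gs
          using \<delta>(2)[OF y(2) that] that by (simp add: Q(1)[OF y(1)] Q(1)[OF x] jet_code_def)
      qed (use \<epsilon> in simp)
      then show "mdist ?X (Q y) (Q x) < \<epsilon>" using \<epsilon> by linarith
    qed
  qed
  have d: "has_dir_deriv ?X Q x h (jet_code D k [h] x)" if x: "x \<in> V" for x h
  proof (rule has_dir_derivI)
    have xU: "x \<in> U" using x V by blast
    show m: "jet_code D k [h] x \<in> mspace ?X" by (rule jet_code_mem) (use xU in auto)
    fix \<epsilon> :: real assume \<epsilon>: "\<epsilon> > 0"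
    show "\<forall>\<^sub>F t in at 0. (Q (x + t *\<^sub>R h) - Q x) /\<^sub>R t \<in> mspace ?X \<and>
       mdist ?X ((Q (x + t *\<^sub>R h) - Q x) /\<^sub>R t) (jet_code D k [h] x) < \<epsilon>"
      using eventually_line_in_open[OF E V(2) x, of h] jet_eventually_deriv[OF xU half_gt_zero[OF \<epsilon>], of k h]
    proof eventually_elim
      case (elim t)
      note subs = level_subspace[OF E F level_target[OF E F]]
      have m': "(Q (x + t *\<^sub>R h) - Q x) /\<^sub>R t \<in> mspace ?X"
        by (intro subspace_scale[OF subs] subspace_diff[OF subs] Q(2) x elim(1))
      have "mdist ?X ((Q (x + t *\<^sub>R h) - Q x) /\<^sub>R t) (jet_code D k [h] x) \<le> \<epsilon> / 2"
      proof (rule level_upper[OF E F level_target[OF E F] m' m])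
        show "nrm F (((Q (x + t *\<^sub>R h) - Q x) /\<^sub>R t) gs - jet_code D k [h] x gs) \<le> \<epsilon> / 2 * prod_nrm E gs"
          if "length gs = k" for gs
          using elim(2)[rule_format, OF that] that
          by (simp add: Q(1)[OF elim(1)] Q(1)[OF x] jet_code_def scaleR_fun_def)
      qed (use \<epsilon> in simp)
      with m' \<epsilon> show ?case by linarith
    qed
  qed
  show "dd ?X Q x = (\<lambda>g. jet_code D k [g] x)" if "x \<in> V"
    by (rule ext) (rule dd_eq[OF d[OF that]])
  show "b_diff E ?X V Q"
  proof (rule b_diffI[OF E F level_target[OF E F] V(2) cQ _ d])
    show "(\<lambda>g. jet_code D k [g] x) \<in> Lip_maps E ?X" if "x \<in> V" for x
      using jet_map_Lip'[where hs = "[]" and k = k and x = x] that V by auto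
    show "continuous_map (subtopology (mtopology_of E) V) (mtopology_of (Lip_metric E ?X)) (\<lambda>x g. jet_code D k [g] x)"
      using continuous_map_from_subtopology_mono[OF jet_map_continuous'[where hs = "[]" and k = k] V(1)] by simp
  qed
qed

text \<open>Balls serve as the connected neighborhoods. On a ball around x0 the derivative minus its
  value at x0 is the coded jet of the next level minus a constant, so the induction generalizes over
  the level, the set and the constant.\<close>

lemma jet_MC_code:
  assumes V: "V \<subseteq> U" "openin (mtopology_of E) V"
    and Q: "\<And>x. x \<in> V \<Longrightarrow> Q x = jet_code D k [] x - c" "\<And>x. x \<in> V \<Longrightarrow> Q x \<in> mspace (target E F k)"
  shows "MC_code m E (target E F k) V Q"
  using assms
proof (induction m arbitrary: k V Q c)
  case 0
  then show ?case using jet_b_diff(1)[OF 0] by simp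
next
  case (Suc m)
  note b = jet_b_diff[OF Suc.prems]
  show ?case
  proof (cases m)
    case 0
    then show ?thesis using b(2) by simp
  next
    case (Suc m')
    have "\<exists>W. x0 \<in> W \<and> W \<subseteq> V \<and> openin (mtopology_of E) W \<and> connectedin (mtopology_of E) W \<and>
        MC_code (Suc m') E (map_code_metric (Lip_metric0 E (target E F k))) W
          (\<lambda>x. map_code (dd (target E F k) Q x - dd (target E F k) Q x0))" if x0: "x0 \<in> V" for x0
    proof -
      obtain r where r: "r > 0" "\<And>y. nrm E (y - x0) < r \<Longrightarrow> y \<in> V"
        using Suc.prems(2) x0 unfolding open_nrm[OF E] by auto
      define W where "W = {y. nrm E (y - x0) < r}"
      have W: "x0 \<in> W" "W \<subseteq> V" "W \<subseteq> U" "openin (mtopology_of E) W" "connectedin (mtopology_of E) W"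
        using r Suc.prems(1) openin_ball[OF E] connectedin_ball[OF E] by (auto simp: W_def nrm_zero[OF E])
      have eq: "map_code (dd (target E F k) Q x - dd (target E F k) Q x0) = jet_code D (Suc k) [] x - jet_code D (Suc k) [] x0"
        if "x \<in> W" for x
        using b(3)[of x] b(3)[of x0] that W x0
        by (auto simp: jet_code_Suc map_code_def fun_eq_iff split: list.split)
      have "MC_code m E (target E F (Suc k)) W (\<lambda>x. map_code (dd (target E F k) Q x - dd (target E F k) Q x0))"
      proof (rule Suc.IH[OF W(3,4) eq])
        fix x assume x: "x \<in> W"
        have "(\<lambda>g. jet_code D k ([] @ [g]) x) - (\<lambda>g. jet_code D k ([] @ [g]) x0)
           \<in> connected_component_of_set (mtopology_of (Lip_metric E (target E F k))) 0"
          by (rule jet_map_diff_component'[OF _ _ W(3,5,1) x])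
        moreover have "dd (target E F k) Q x - dd (target E F k) Q x0 =
           (\<lambda>g. jet_code D k ([] @ [g]) x) - (\<lambda>g. jet_code D k ([] @ [g]) x0)"
          using b(3)[of x] b(3)[of x0] x W x0 by auto
        ultimately show "map_code (dd (target E F k) Q x - dd (target E F k) Q x0) \<in> mspace (target E F (Suc k))"
          unfolding target.simps mspace_map_code_metric mspace_Lip_metric0[OF E F level_target[OF E F]] by simp
      qed
      then show ?thesis using W Suc by (intro exI[of _ W]) simp
    qed
    then show ?thesis using b(2) Suc by simp
  qed
qed

theorem jet_imp_MC_inf:
  assumes P: "\<And>x. x \<in> U \<Longrightarrow> P x = D [] x"
  shows "MC_inf E F U P"
  unfolding MC_inf_def MC_def
proof
  fix m
  have "MC_code m E (target E F 0) U (\<lambda>x. base_code (P x))"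
    by (rule jet_MC_code[OF order_refl jet_open[OF E F J], where c = 0])
      (simp_all add: jet_code_0 P std_mspace[OF F])
  then show "MC_code m E (base_metric F) U (\<lambda>x. base_code (P x))" by simp
qed

end

subsection \<open>From maps of class MC to jets\<close>

primrec iter_dd :: "'f::real_vector metric \<Rightarrow> ('e::real_vector \<Rightarrow> 'f) \<Rightarrow> 'e list \<Rightarrow> 'e \<Rightarrow> 'f" where
  "iter_dd F P [] = P"
| "iter_dd F P (h # hs) = (\<lambda>x. dd F (iter_dd F P hs) x h)"

text \<open>The last entry of the list is the derivative taken first. The recursion of
  \<open>MC_code\<close> splits off this one, whereas the definition of \<open>iter_dd\<close>
  splits off the newest.\<close>

lemma iter_dd_snoc: "iter_dd F P (hs @ [h]) = iter_dd F (iter_dd F P [h]) hs"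
  by (induction hs) auto

context
  fixes E :: "'e::real_vector metric" and F :: "'f::real_vector metric" and V
  assumes E: "standard_metric E" and F: "standard_metric F" and V: "openin (mtopology_of E) V"
begin

lemma has_dir_deriv_add_const:
  assumes eq: "\<And>y. y \<in> V \<Longrightarrow> P y = P' y + c" and x: "x \<in> V"
  shows "has_dir_deriv F P x h v \<longleftrightarrow> has_dir_deriv F P' x h v"
proof -
  have ev: "\<forall>\<^sub>F t in at 0. (P (x + t *\<^sub>R h) - P x) /\<^sub>R t = (P' (x + t *\<^sub>R h) - P' x) /\<^sub>R t"
    using eventually_line_in_open[OF E V x, of h] by (rule eventually_mono) (simp add: eq x)
  have ev': "\<forall>\<^sub>F t in at 0. (P' (x + t *\<^sub>R h) - P' x) /\<^sub>R t = (P (x + t *\<^sub>R h) - P x) /\<^sub>R t"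
    using ev by (rule eventually_mono) (rule sym)
  show ?thesis
    unfolding has_dir_deriv_iff_tends[OF F]
    using tends_cong[OF F _ ev] tends_cong[OF F _ ev'] by blast
qed

lemma dd_add_const:
  assumes "\<And>y. y \<in> V \<Longrightarrow> P y = P' y + c" "x \<in> V"
  shows "dd F P x h = dd F P' x h"
proof -
  have "has_dir_deriv F P x h = has_dir_deriv F P' x h"
    by (rule ext) (rule has_dir_deriv_add_const[OF assms])
  then show ?thesis by (simp add: dd_def)
qed

text \<open>\<open>MC_code\<close> continues with the derivative minus its value at a point. From
  order 1 on derivatives do not see this constant, and only the values on the open set V
  matter.\<close>

lemma iter_dd_add_const:
  assumes eq: "\<And>y. y \<in> V \<Longrightarrow> P y = P' y + c" and "x \<in> V" "hs \<noteq> []"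
  shows "iter_dd F P hs x = iter_dd F P' hs x"
  using assms(2,3)
proof (induction hs arbitrary: x)
  case (Cons h hs)
  show ?case
  proof (cases "hs = []")
    case True
    then show ?thesis using dd_add_const[OF eq Cons.prems(1)] by simp
  next
    case False
    have "iter_dd F P hs y = iter_dd F P' hs y + 0" if "y \<in> V" for y
      using Cons.IH[OF that False] by simp
    from dd_add_const[OF this Cons.prems(1)] show ?thesis by simp
  qed
qed simp

end

lemma continuous_map_stdD:
  assumes E: "standard_metric E"
    and c: "continuous_map (subtopology (mtopology_of E) U) (mtopology_of X) f" and x: "x \<in> U" and \<epsilon>: "\<epsilon> > 0"
  obtains \<delta> where "\<delta> > 0" "\<And>y. y \<in> U \<Longrightarrow> nrm E (y - x) < \<delta> \<Longrightarrow> mdist X (f y) (f x) < \<epsilon>"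
proof -
  have "\<exists>\<delta>>0. \<forall>y\<in>U. nrm E (y - x) < \<delta> \<longrightarrow> mdist X (f y) (f x) < \<epsilon>"
    by (rule conjunct2[OF c[unfolded continuous_map_std_iff[OF E]], rule_format, OF x \<epsilon>])
  then show thesis using that by blast
qed

text \<open>The clauses of \<open>jet\<close> up to order m + 1 for the components
  \<open>Q y gs\<close> of a map into a target of level k. The bounds carry the factor
  \<open>prod_nrm E gs\<close>, so that the entries of gs can later be regarded as directions
  too.\<close>

definition part_jet :: "'e::real_vector metric \<Rightarrow> 'f::real_vector metric \<Rightarrow> nat \<Rightarrow> nat \<Rightarrow> 'e set \<Rightarrow>
    ('e \<Rightarrow> 'e list \<Rightarrow> 'f) \<Rightarrow> bool" where
  "part_jet E F k m V Q \<longleftrightarrow>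
     (\<forall>x\<in>V. \<forall>hs h gs. length hs \<le> m \<longrightarrow> length gs = k \<longrightarrow>
        has_dir_deriv F (iter_dd F (\<lambda>y. Q y gs) hs) x h (iter_dd F (\<lambda>y. Q y gs) (h # hs) x)) \<and>
     (\<forall>x\<in>V. \<forall>hs gs. length hs \<le> m \<longrightarrow> length gs = k \<longrightarrow>
        linear (\<lambda>h. iter_dd F (\<lambda>y. Q y gs) (h # hs) x)) \<and>
     (\<forall>x\<in>V. \<forall>n\<le>Suc m. \<exists>C\<ge>0. \<forall>hs gs. length hs = n \<longrightarrow> length gs = k \<longrightarrow>
        nrm F (iter_dd F (\<lambda>y. Q y gs) hs x) \<le> C * prod_nrm E hs * prod_nrm E gs) \<and>
     (\<forall>x\<in>V. \<forall>n\<le>Suc m. \<forall>\<epsilon>>0. \<exists>\<delta>>0. \<forall>y\<in>V. nrm E (y - x) < \<delta> \<longrightarrow>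
        (\<forall>hs gs. length hs = n \<longrightarrow> length gs = k \<longrightarrow>
          nrm F (iter_dd F (\<lambda>y. Q y gs) hs y - iter_dd F (\<lambda>y. Q y gs) hs x)
            \<le> \<epsilon> * prod_nrm E hs * prod_nrm E gs))"

context
  fixes E :: "'e::real_vector metric" and F :: "'f::real_vector metric" and k X V Q
  assumes E: "standard_metric E" and F: "standard_metric F" and X: "level E F k X"
    and b: "b_diff E X V Q"
begin

lemma b_diff_open: "openin (mtopology_of E) V"
  using b by (simp add: b_diff_def keller_diff_def)

lemma b_diff_range: "x \<in> V \<Longrightarrow> Q x \<in> mspace X"
  using b unfolding b_diff_def keller_diff_def continuous_map_std_iff[OF E] by blast

lemma b_diff_Lip: "x \<in> V \<Longrightarrow> dd X Q x \<in> Lip_maps E X"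
  using b by (simp add: b_diff_def)

lemma b_diff_component_deriv:
  assumes x: "x \<in> V" and gs: "length gs = k"
  shows "has_dir_deriv F (\<lambda>y. Q y gs) x h (dd X Q x h gs)"
proof (rule level_has_dir_deriv[OF E F X b_diff_has_dir_deriv[OF E F X b x] _ b_diff_range[OF x] gs])
  show "\<forall>\<^sub>F t in at 0. Q (x + t *\<^sub>R h) \<in> mspace X"
    using eventually_line_in_open[OF E b_diff_open x] by (rule eventually_mono) (rule b_diff_range)
qed

lemma b_diff_component_dd:
  assumes x: "x \<in> V" and gs: "length gs = k"
  shows "dd F (\<lambda>y. Q y gs) x h = dd X Q x h gs"
  by (rule dd_eq[OF b_diff_component_deriv[OF assms]])

text \<open>The metric of X controls order 0 and the operator metric controls order 1; both are best
  constants, which yields bounds on values uniform in gs.\<close>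

lemma b_diff_part_jet: "part_jet E F k 0 V Q"
  unfolding part_jet_def
proof (intro conjI ballI allI impI)
  fix x hs h and gs :: "'e list" assume *: "x \<in> V" "length (hs :: 'e list) \<le> 0" "length gs = k"
  then show "has_dir_deriv F (iter_dd F (\<lambda>y. Q y gs) hs) x h (iter_dd F (\<lambda>y. Q y gs) (h # hs) x)"
    using b_diff_component_deriv[OF *(1,3)] b_diff_component_dd[OF *(1,3)] by simp
next
  fix x hs and gs :: "'e list" assume *: "x \<in> V" "length (hs :: 'e list) \<le> 0" "length gs = k"
  have "linear (\<lambda>h. dd X Q x h gs)"
    using Lip_maps_linear[OF E F X b_diff_Lip[OF *(1)]]
    by (intro linearI) (simp_all add: linear_add linear_cmul scaleR_fun_def)
  then show "linear (\<lambda>h. iter_dd F (\<lambda>y. Q y gs) (h # hs) x)"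
    using * b_diff_component_dd[OF *(1,3)] by simp
next
  fix x and n :: nat assume x: "x \<in> V" and "n \<le> Suc 0"
  then consider "n = 0" | "n = 1" by linarith
  then show "\<exists>C\<ge>0. \<forall>hs gs. length hs = n \<longrightarrow> length gs = k \<longrightarrow>
        nrm F (iter_dd F (\<lambda>y. Q y gs) hs x) \<le> C * prod_nrm E hs * prod_nrm E gs"
  proof cases
    case 1
    then show ?thesis using level_lower0[OF E F X b_diff_range[OF x]]
      by (intro exI[of _ "mdist X (Q x) 0"]) auto
  next
    case 2
    show ?thesis
    proof (intro exI[of _ "Lip_norm E X (dd X Q x)"] conjI allI impI)
      show "0 \<le> Lip_norm E X (dd X Q x)" by (rule Lip_norm_nonneg[OF E F X b_diff_Lip[OF x]])
      fix hs gs :: "'e list" assume *: "length hs = n" "length gs = k"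
      obtain h where "hs = [h]" using * 2 by (auto simp: length_Suc_conv)
      then show "nrm F (iter_dd F (\<lambda>y. Q y gs) hs x) \<le> Lip_norm E X (dd X Q x) * prod_nrm E hs * prod_nrm E gs"
        using Lip_norm_lower[OF E F X b_diff_Lip[OF x] *(2), of h] by (simp add: b_diff_component_dd[OF x *(2)])
    qed
  qed
next
  fix x and n :: nat and \<epsilon> :: real assume x: "x \<in> V" and "n \<le> Suc 0" and \<epsilon>: "\<epsilon> > 0"
  then consider "n = 0" | "n = 1" by linarith
  then show "\<exists>\<delta>>0. \<forall>y\<in>V. nrm E (y - x) < \<delta> \<longrightarrow> (\<forall>hs gs. length hs = n \<longrightarrow> length gs = k \<longrightarrow>
          nrm F (iter_dd F (\<lambda>y. Q y gs) hs y - iter_dd F (\<lambda>y. Q y gs) hs x) \<le> \<epsilon> * prod_nrm E hs * prod_nrm E gs)"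
  proof cases
    case 1
    have "continuous_map (subtopology (mtopology_of E) V) (mtopology_of X) Q"
      using b by (simp add: b_diff_def keller_diff_def)
    then obtain \<delta> where \<delta>: "\<delta> > 0" "\<And>y. y \<in> V \<Longrightarrow> nrm E (y - x) < \<delta> \<Longrightarrow> mdist X (Q y) (Q x) < \<epsilon>"
      by (rule continuous_map_stdD[OF E _ x \<epsilon>]) blast+
    show ?thesis
    proof (intro exI[of _ \<delta>] conjI \<delta>(1) ballI impI allI)
      fix y and hs gs :: "'e list" assume y: "y \<in> V" "nrm E (y - x) < \<delta>" and *: "length hs = n" "length gs = k"
      have "nrm F (Q y gs - Q x gs) \<le> mdist X (Q y) (Q x) * prod_nrm E gs"
        by (rule level_lower[OF E F X b_diff_range[OF y(1)] b_diff_range[OF x] *(2)])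
      also have "\<dots> \<le> \<epsilon> * prod_nrm E gs" using \<delta>(2)[OF y] by (intro mult_right_mono) auto
      finally show "nrm F (iter_dd F (\<lambda>y. Q y gs) hs y - iter_dd F (\<lambda>y. Q y gs) hs x) \<le> \<epsilon> * prod_nrm E hs * prod_nrm E gs"
        using * 1 by simp
    qed
  next
    case 2
    have "continuous_map (subtopology (mtopology_of E) V) (mtopology_of (Lip_metric E X)) (dd X Q)"
      using b by (simp add: b_diff_def)
    then obtain \<delta> where \<delta>: "\<delta> > 0" "\<And>y. y \<in> V \<Longrightarrow> nrm E (y - x) < \<delta> \<Longrightarrow> mdist (Lip_metric E X) (dd X Q y) (dd X Q x) < \<epsilon>"
      by (rule continuous_map_stdD[OF E _ x \<epsilon>]) blast+
    show ?thesis
    proof (intro exI[of _ \<delta>] conjI \<delta>(1) ballI impI allI)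
      fix y and hs gs :: "'e list" assume y: "y \<in> V" "nrm E (y - x) < \<delta>" and *: "length hs = n" "length gs = k"
      obtain h where h: "hs = [h]" using * 2 by (auto simp: length_Suc_conv)
      have "nrm F (dd X Q y h gs - dd X Q x h gs) \<le> mdist (Lip_metric E X) (dd X Q y) (dd X Q x) * nrm E h * prod_nrm E gs"
        by (rule Lip_metric_lower[OF E F X b_diff_Lip[OF y(1)] b_diff_Lip[OF x] *(2)])
      also have "\<dots> \<le> \<epsilon> * nrm E h * prod_nrm E gs" using \<delta>(2)[OF y] by (intro mult_right_mono) auto
      finally show "nrm F (iter_dd F (\<lambda>y. Q y gs) hs y - iter_dd F (\<lambda>y. Q y gs) hs x) \<le> \<epsilon> * prod_nrm E hs * prod_nrm E gs"
        by (simp add: h b_diff_component_dd[OF x *(2)] b_diff_component_dd[OF y(1) *(2)])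
    qed
  qed
qed

text \<open>Differentiating first in direction g turns the component of Q at gs into the component
  at \<open>g # gs\<close> of the coded derivative, one level higher, where one order less is asked
  for. The value subtracted at x is a constant and is felt only when no further derivative is
  taken.\<close>

lemma part_jet_Suc:
  assumes step: "\<And>x. x \<in> V \<Longrightarrow> \<exists>W. x \<in> W \<and> W \<subseteq> V \<and> openin (mtopology_of E) W \<and>
      part_jet E F (Suc k) m W (\<lambda>y. map_code (dd X Q y - dd X Q x))"
  shows "part_jet E F k (Suc m) V Q"
proof -
  note base = b_diff_part_jet[unfolded part_jet_def]
  let ?P = "\<lambda>gs y. Q y gs"
  have main: "\<exists>W P'. x \<in> W \<and> W \<subseteq> V \<and> openin (mtopology_of E) W \<and> part_jet E F (Suc k) m W P' \<and>
     (\<forall>hs g gs. hs \<noteq> [] \<longrightarrow> length gs = k \<longrightarrow> (\<forall>y\<in>W.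
        iter_dd F (?P gs) (hs @ [g]) y = iter_dd F (\<lambda>y. P' y (g # gs)) hs y)) \<and>
     (\<forall>hs g gs. length gs = k \<longrightarrow> (\<exists>c. \<forall>y\<in>W.
        iter_dd F (?P gs) (hs @ [g]) y = iter_dd F (\<lambda>y. P' y (g # gs)) hs y + c))" if x: "x \<in> V" for x
  proof -
    obtain W where W: "x \<in> W" "W \<subseteq> V" "openin (mtopology_of E) W"
      "part_jet E F (Suc k) m W (\<lambda>y. map_code (dd X Q y - dd X Q x))" using step[OF x] by blast
    have eq: "iter_dd F (?P gs) [g] y = map_code (dd X Q y - dd X Q x) (g # gs) + dd X Q x g gs"
      if "y \<in> W" "length gs = k" for y g gs
      using that W(2) by (simp add: b_diff_component_dd subset_iff)
    have 1: "iter_dd F (?P gs) (hs @ [g]) y = iter_dd F (\<lambda>y. map_code (dd X Q y - dd X Q x) (g # gs)) hs y"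
      if "hs \<noteq> []" "length gs = k" "y \<in> W" for hs g gs y
      unfolding iter_dd_snoc
      by (rule iter_dd_add_const[OF E F W(3) eq]) (use that in auto)
    have 2: "\<exists>c. \<forall>y\<in>W. iter_dd F (?P gs) (hs @ [g]) y =
        iter_dd F (\<lambda>y. map_code (dd X Q y - dd X Q x) (g # gs)) hs y + c" if "length gs = k" for hs g gs
    proof (cases "hs = []")
      case True
      then show ?thesis using eq[OF _ that] by auto
    next
      case False
      then show ?thesis using 1[OF False that] by (intro exI[of _ 0]) auto
    qed
    show ?thesis using W 1 2
      by (intro exI[of _ W] exI[of _ "\<lambda>y. map_code (dd X Q y - dd X Q x)"]) blast
  qed
  show ?thesis
    unfolding part_jet_def
  proof (intro conjI ballI allI impI)
    fix x h and hs gs :: "'e list" assume x: "x \<in> V" and *: "length hs \<le> Suc m" "length gs = k"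
    show "has_dir_deriv F (iter_dd F (?P gs) hs) x h (iter_dd F (?P gs) (h # hs) x)"
    proof (cases hs rule: rev_cases)
      case Nil
      then show ?thesis using base x * by simp
    next
      case (snoc hs' g)
      obtain W P' where W: "x \<in> W" "openin (mtopology_of E) W" and pj: "part_jet E F (Suc k) m W P'" and
        eq1: "\<And>hs g. hs \<noteq> [] \<Longrightarrow> iter_dd F (?P gs) (hs @ [g]) x = iter_dd F (\<lambda>y. P' y (g # gs)) hs x" and
        eq2: "\<And>hs g. \<exists>c. \<forall>y\<in>W. iter_dd F (?P gs) (hs @ [g]) y = iter_dd F (\<lambda>y. P' y (g # gs)) hs y + c"
        using main[OF x] *(2) by metis
      obtain c where c: "\<And>y. y \<in> W \<Longrightarrow> iter_dd F (?P gs) (hs' @ [g]) y = iter_dd F (\<lambda>y. P' y (g # gs)) hs' y + c"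
        using eq2 by blast
      have "has_dir_deriv F (iter_dd F (\<lambda>y. P' y (g # gs)) hs') x h (iter_dd F (\<lambda>y. P' y (g # gs)) (h # hs') x)"
        using pj W(1) * snoc unfolding part_jet_def by simp
      moreover have "has_dir_deriv F (iter_dd F (?P gs) (hs' @ [g])) x h v \<longleftrightarrow>
          has_dir_deriv F (iter_dd F (\<lambda>y. P' y (g # gs)) hs') x h v" for v
        by (rule has_dir_deriv_add_const[OF E F W(2) _ W(1)]) (rule c)
      ultimately have "has_dir_deriv F (iter_dd F (?P gs) (hs' @ [g])) x h (iter_dd F (\<lambda>y. P' y (g # gs)) (h # hs') x)"
        by blast
      then show ?thesis using eq1[of "h # hs'" g] snoc by simp
    qed
  next
    fix x and hs gs :: "'e list" assume x: "x \<in> V" and *: "length hs \<le> Suc m" "length gs = k"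
    show "linear (\<lambda>h. iter_dd F (?P gs) (h # hs) x)"
    proof (cases hs rule: rev_cases)
      case Nil
      then show ?thesis using base x * by simp
    next
      case (snoc hs' g)
      obtain W P' where W: "x \<in> W" and pj: "part_jet E F (Suc k) m W P'" and
        eq1: "\<And>hs g. hs \<noteq> [] \<Longrightarrow> iter_dd F (?P gs) (hs @ [g]) x = iter_dd F (\<lambda>y. P' y (g # gs)) hs x"
        using main[OF x] *(2) by metis
      have "linear (\<lambda>h. iter_dd F (\<lambda>y. P' y (g # gs)) (h # hs') x)"
        using pj W * snoc unfolding part_jet_def by simp
      then show ?thesis using eq1[of "_ # hs'" g] snoc by simp
    qed
  next
    fix x n assume x: "x \<in> V" and n: "n \<le> Suc (Suc m)"
    show "\<exists>C\<ge>0. \<forall>hs gs. length hs = n \<longrightarrow> length gs = k \<longrightarrow>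
        nrm F (iter_dd F (?P gs) hs x) \<le> C * prod_nrm E hs * prod_nrm E gs"
    \<comment> \<open>Orders 0 and 1 come from b-differentiability: in order 1 no derivative is left
      for the coded map, and its subtracted constant would enter the bound.\<close>
    proof (cases "n \<le> 1")
      case True
      then show ?thesis using base x by simp
    next
      case False
      then obtain n' where n': "n = Suc n'" "n' \<noteq> 0" "n' \<le> Suc m" using n by (cases n) auto
      obtain W P' where W: "x \<in> W" and pj: "part_jet E F (Suc k) m W P'" and
        eq1: "\<And>hs g gs. hs \<noteq> [] \<Longrightarrow> length gs = k \<Longrightarrow> iter_dd F (?P gs) (hs @ [g]) x = iter_dd F (\<lambda>y. P' y (g # gs)) hs x"
        using main[OF x] by metis
      have "\<exists>C\<ge>0. \<forall>hs gs. length hs = n' \<longrightarrow> length gs = Suc k \<longrightarrow>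
          nrm F (iter_dd F (\<lambda>y. P' y gs) hs x) \<le> C * prod_nrm E hs * prod_nrm E gs"
        using pj W n' unfolding part_jet_def by simp
      then obtain C where C: "C \<ge> 0" "\<And>hs gs. length hs = n' \<Longrightarrow> length gs = Suc k \<Longrightarrow>
          nrm F (iter_dd F (\<lambda>y. P' y gs) hs x) \<le> C * prod_nrm E hs * prod_nrm E gs" by blast
      show ?thesis
      proof (intro exI[of _ C] conjI C(1) allI impI)
        fix hs gs :: "'e list" assume *: "length hs = n" "length gs = k"
        obtain hs' g where hs: "hs = hs' @ [g]" using * n' by (cases hs rule: rev_cases) auto
        show "nrm F (iter_dd F (?P gs) hs x) \<le> C * prod_nrm E hs * prod_nrm E gs"
          using C(2)[of hs' "g # gs"] eq1[of hs' gs g] * n' by (auto simp: hs mult_ac)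
      qed
    qed
  next
    fix x n and \<epsilon> :: real assume x: "x \<in> V" and n: "n \<le> Suc (Suc m)" and \<epsilon>: "\<epsilon> > 0"
    show "\<exists>\<delta>>0. \<forall>y\<in>V. nrm E (y - x) < \<delta> \<longrightarrow> (\<forall>hs gs. length hs = n \<longrightarrow> length gs = k \<longrightarrow>
          nrm F (iter_dd F (?P gs) hs y - iter_dd F (?P gs) hs x) \<le> \<epsilon> * prod_nrm E hs * prod_nrm E gs)"
    proof (cases "n \<le> 1")
      case True
      then show ?thesis using base x \<epsilon> by simp
    next
      case False
      then obtain n' where n': "n = Suc n'" "n' \<noteq> 0" "n' \<le> Suc m" using n by (cases n) auto
      obtain W P' where W: "x \<in> W" "openin (mtopology_of E) W" and pj: "part_jet E F (Suc k) m W P'" and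
        eq1: "\<And>hs g gs y. hs \<noteq> [] \<Longrightarrow> length gs = k \<Longrightarrow> y \<in> W \<Longrightarrow> iter_dd F (?P gs) (hs @ [g]) y = iter_dd F (\<lambda>y. P' y (g # gs)) hs y"
        using main[OF x] by metis
      obtain r where r: "r > 0" "\<And>y. nrm E (y - x) < r \<Longrightarrow> y \<in> W" using W unfolding open_nrm[OF E] by auto
      have "\<exists>\<delta>>0. \<forall>y\<in>W. nrm E (y - x) < \<delta> \<longrightarrow> (\<forall>hs gs. length hs = n' \<longrightarrow> length gs = Suc k \<longrightarrow>
          nrm F (iter_dd F (\<lambda>y. P' y gs) hs y - iter_dd F (\<lambda>y. P' y gs) hs x) \<le> \<epsilon> * prod_nrm E hs * prod_nrm E gs)"
        using pj W n' \<epsilon> unfolding part_jet_def by simp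
      then obtain \<delta> where \<delta>: "\<delta> > 0" "\<And>y hs gs. y \<in> W \<Longrightarrow> nrm E (y - x) < \<delta> \<Longrightarrow> length hs = n' \<Longrightarrow> length gs = Suc k \<Longrightarrow>
          nrm F (iter_dd F (\<lambda>y. P' y gs) hs y - iter_dd F (\<lambda>y. P' y gs) hs x) \<le> \<epsilon> * prod_nrm E hs * prod_nrm E gs" by blast
      show ?thesis
      proof (intro exI[of _ "min r \<delta>"] conjI allI impI ballI)
        show "0 < min r \<delta>" using r \<delta> by simp
        fix y and hs gs :: "'e list" assume y: "nrm E (y - x) < min r \<delta>" and *: "length hs = n" "length gs = k"
        have yW: "y \<in> W" using r(2) y by simp
        obtain hs' g where hs: "hs = hs' @ [g]" using * n' by (cases hs rule: rev_cases) auto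
        show "nrm F (iter_dd F (?P gs) hs y - iter_dd F (?P gs) hs x) \<le> \<epsilon> * prod_nrm E hs * prod_nrm E gs"
          using \<delta>(2)[OF yW, of hs' "g # gs"] eq1[OF _ _ yW, of hs' gs g] eq1[OF _ _ W(1), of hs' gs g] * n' y
          by (auto simp: hs mult_ac)
      qed
    qed
  qed
qed

end

lemma MC_code_imp_part_jet:
  assumes E: "standard_metric E" and F: "standard_metric F"
  shows "MC_code (Suc m) E (target E F k) V Q \<Longrightarrow> part_jet E F k m V Q"
proof (induction m arbitrary: k V Q)
  case 0
  then show ?case using b_diff_part_jet[OF E F level_target[OF E F]] by simp
next
  case (Suc m)
  have b: "b_diff E (target E F k) V Q" using Suc.prems by simp
  show ?case
  proof (rule part_jet_Suc[OF E F level_target[OF E F] b])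
    fix x assume "x \<in> V"
    then obtain W where "x \<in> W" "W \<subseteq> V" "openin (mtopology_of E) W"
      "MC_code (Suc m) E (target E F (Suc k)) W (\<lambda>y. map_code (dd (target E F k) Q y - dd (target E F k) Q x))"
      using Suc.prems by auto
    then show "\<exists>W. x \<in> W \<and> W \<subseteq> V \<and> openin (mtopology_of E) W \<and>
      part_jet E F (Suc k) m W (\<lambda>y. map_code (dd (target E F k) Q y - dd (target E F k) Q x))"
      using Suc.IH by blast
  qed
qed

text \<open>Each clause concerns a single order and is read off \<open>part_jet\<close> with m equal
  to that order. At level 0 the only list gs is empty, so the coding disappears.\<close>

theorem MC_inf_imp_jet:
  assumes E: "standard_metric E" and F: "standard_metric F" and P: "MC_inf E F U P"
  shows "jet E F U (iter_dd F P)"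
proof -
  have pj: "part_jet E F 0 m U (\<lambda>x. base_code (P x))" for m
    using P by (intro MC_code_imp_part_jet[OF E F]) (simp add: MC_inf_def MC_def)
  have eq: "(\<lambda>y. base_code (P y) []) = P" by simp
  show ?thesis
  proof (rule jetI)
    show "openin (mtopology_of E) U"
      using P by (auto simp: MC_inf_def MC_def dest: spec[of _ 0])
    fix x assume x: "x \<in> U"
    show "linear (\<lambda>h. iter_dd F P (h # hs) x)" for hs
      using pj[of "length hs"] x unfolding part_jet_def by (metis eq le_refl list.size(3))
    show "has_dir_deriv F (iter_dd F P hs) x h (iter_dd F P (h # hs) x)" for hs h
      using pj[of "length hs"] x unfolding part_jet_def by (metis eq le_refl list.size(3))
    fix n
    have "\<exists>C\<ge>0. \<forall>hs gs. length hs = n \<longrightarrow> length gs = 0 \<longrightarrow>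
        nrm F (iter_dd F (\<lambda>y. base_code (P y) gs) hs x) \<le> C * prod_nrm E hs * prod_nrm E gs"
      using pj[of n] x unfolding part_jet_def by simp
    then show "\<exists>C\<ge>0. \<forall>hs. length hs = n \<longrightarrow> nrm F (iter_dd F P hs x) \<le> C * prod_nrm E hs" by simp
    fix \<epsilon> :: real assume "\<epsilon> > 0"
    then have "\<exists>\<delta>>0. \<forall>y\<in>U. nrm E (y - x) < \<delta> \<longrightarrow> (\<forall>hs gs. length hs = n \<longrightarrow> length gs = 0 \<longrightarrow>
        nrm F (iter_dd F (\<lambda>y. base_code (P y) gs) hs y - iter_dd F (\<lambda>y. base_code (P y) gs) hs x)
          \<le> \<epsilon> * prod_nrm E hs * prod_nrm E gs)"
      using pj[of n] x unfolding part_jet_def by simp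
    then show "\<exists>\<delta>>0. \<forall>y\<in>U. nrm E (y - x) < \<delta> \<longrightarrow>
        (\<forall>hs. length hs = n \<longrightarrow> nrm F (iter_dd F P hs y - iter_dd F P hs x) \<le> \<epsilon> * prod_nrm E hs)" by simp
  qed
qed

section \<open>Closure properties of the class MC\<close>

lemma MC_inf_open: "MC_inf E F U P \<Longrightarrow> openin (mtopology_of E) U"
  by (auto simp: MC_inf_def MC_def dest: spec[of _ 0])

lemma MC_inf_subset:
  assumes E: "standard_metric E" and F: "standard_metric F"
    and "MC_inf E F U P" "V \<subseteq> U" "openin (mtopology_of E) V"
  shows "MC_inf E F V P"
  by (rule jet_imp_MC_inf[OF E F jet_subset[OF MC_inf_imp_jet[OF E F assms(3)] assms(4,5)]]) simp

lemma MC_inf_cong: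
  assumes E: "standard_metric E" and F: "standard_metric F"
    and "MC_inf E F U P" "\<And>x. x \<in> U \<Longrightarrow> Q x = P x"
  shows "MC_inf E F U Q"
  by (rule jet_imp_MC_inf[OF E F MC_inf_imp_jet[OF E F assms(3)]]) (simp add: assms(4))

lemma MC_inf_compose:
  assumes E: "standard_metric E" and F: "standard_metric F" and G: "standard_metric G"
    and Q: "MC_inf E F U Q" and P: "MC_inf F G V P" and UV: "\<And>x. x \<in> U \<Longrightarrow> Q x \<in> V"
  shows "MC_inf E G U (\<lambda>x. P (Q x))"
  by (rule jet_imp_MC_inf[OF E G jet_compose[OF E F G MC_inf_imp_jet[OF E F Q] MC_inf_imp_jet[OF F G P]]])
    (simp_all add: UV)

lemma MC_inf_Pair:
  assumes E: "standard_metric E" and F: "standard_metric F" and G: "standard_metric G"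
    and Q: "MC_inf E F U Q" and P: "MC_inf E G U P"
  shows "MC_inf E (max_metric F G) U (\<lambda>x. (Q x, P x))"
  by (rule jet_imp_MC_inf[OF E standard_metric_max_metric[OF F G]
      jet_Pair[OF E F G MC_inf_imp_jet[OF E F Q] MC_inf_imp_jet[OF E G P]]]) simp

lemma openin_UNIV_std: "standard_metric E \<Longrightarrow> openin (mtopology_of E) UNIV"
  using openin_topspace[of "mtopology_of E"] by (simp add: std_mspace)

lemma MC_inf_linear:
  assumes E: "standard_metric E" and F: "standard_metric F"
    and l: "linear l" and b: "\<And>h. nrm F (l h) \<le> C * nrm E h" and C: "C \<ge> 0"
    and U: "openin (mtopology_of E) U"
  shows "MC_inf E F U l"
  by (rule MC_inf_subset[OF E F jet_imp_MC_inf[OF E F jet_linear_map[OF E F l b C]] subset_UNIV U]) simp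

lemma MC_inf_derivative:
  assumes E: "standard_metric E" and F: "standard_metric F" and J: "jet E F U D"
  shows "MC_inf (max_metric E E) F (U \<times> UNIV) (\<lambda>(x, h). D [h] x)"
  by (rule jet_imp_MC_inf[OF standard_metric_max_metric[OF E E] F jet_derivative[OF E F J]]) auto

text \<open>The derivative of \<open>(x, g) \<mapsto> D [g] x\<close> in direction (h, l). With l =
  0 it shows the second derivative to be of class MC jointly in the point and both
  directions.\<close>

lemma MC_inf_second_derivative:
  assumes E: "standard_metric E" and F: "standard_metric F" and J: "jet E F U D"
  shows "MC_inf (max_metric (max_metric E E) (max_metric E E)) F ((U \<times> UNIV) \<times> UNIV)
    (\<lambda>((x, g), (h, l)). D [h, g] x + D [l] x)"
  by (rule MC_inf_cong[OF _ F MC_inf_derivative[OF standard_metric_max_metric[OF E E] F jet_derivative[OF E F J]]])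
    (auto intro!: standard_metric_max_metric E)

lemma openin_Times_std:
  assumes E: "standard_metric E" and F: "standard_metric F" and U: "openin (mtopology_of E) U"
    and V: "openin (mtopology_of F) V"
  shows "openin (mtopology_of (max_metric E F)) (U \<times> V)"
  unfolding open_nrm[OF standard_metric_max_metric[OF E F]]
proof
  fix z assume "z \<in> U \<times> V"
  then have z: "fst z \<in> U" "snd z \<in> V" by auto
  obtain r s where "r > 0" "\<And>y. nrm E (y - fst z) < r \<Longrightarrow> y \<in> U" "s > 0" "\<And>y. nrm F (y - snd z) < s \<Longrightarrow> y \<in> V"
    using U V z unfolding open_nrm[OF E] open_nrm[OF F] by metis
  then show "\<exists>r>0. \<forall>y. nrm (max_metric E F) (y - z) < r \<longrightarrow> y \<in> U \<times> V"
    by (intro exI[of _ "min r s"]) (auto simp: nrm_max_metric)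
qed

section \<open>Mutually inverse maps preserving a base coordinate\<close>

text \<open>\<open>P\<close> and \<open>G\<close> are the jets of the local forms of a fiber preserving diffeomorphism
  \<open>T\<^sup>2M \<rightarrow> TM \<oplus> TM\<close> and of its inverse.\<close>

locale fiber_diffeo =
  fixes F :: "'f::real_vector metric" and W1 W2 and P G :: "('f \<times> 'f \<times> 'f) list \<Rightarrow> 'f \<times> 'f \<times> 'f \<Rightarrow> 'f \<times> 'f \<times> 'f"
  assumes F: "standard_metric F"
    and P: "jet (max_metric F (max_metric F F)) (max_metric F (max_metric F F)) W1 P"
    and G: "jet (max_metric F (max_metric F F)) (max_metric F (max_metric F F)) W2 G"
    and PW: "\<And>w. w \<in> W1 \<Longrightarrow> P [] w \<in> W2" and GP: "\<And>w. w \<in> W1 \<Longrightarrow> G [] (P [] w) = w"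
    and GW: "\<And>w. w \<in> W2 \<Longrightarrow> G [] w \<in> W1" and PG: "\<And>w. w \<in> W2 \<Longrightarrow> P [] (G [] w) = w"
    and fst_P: "\<And>w. w \<in> W1 \<Longrightarrow> fst (P [] w) = fst w"
begin

abbreviation "F3 \<equiv> max_metric F (max_metric F F)"

lemma F2: "standard_metric (max_metric F F)"
  by (rule standard_metric_max_metric[OF F F])

lemma F3: "standard_metric F3"
  by (rule standard_metric_max_metric[OF F F2])

definition \<tau> :: "'f \<Rightarrow> 'f \<Rightarrow> 'f \<Rightarrow> 'f" where
  "\<tau> x g h = (1/2) *\<^sub>R snd (snd (G [P [(0, h, 0), (0, g, 0)] (x, 0, 0)] (P [] (x, 0, 0))))"

lemma tends_line:
  assumes E: "standard_metric E"
  shows "tends E (\<lambda>t. (x + t *\<^sub>R u - x) /\<^sub>R t) u (at 0)"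
  by (rule tends_cong[OF E tends_const[OF E]]) (simp add: eventually_at_filter)

text \<open>The chain rule for the two composites, which are the identity near the point because
  both domains are open.\<close>

lemma deriv_inverse:
  assumes w: "w \<in> W1"
  shows "G [P [u] w] (P [] w) = u" "P [G [u] (P [] w)] w = u"
proof -
  have 1: "tends F3 (\<lambda>t. (G [] (P [] (w + t *\<^sub>R u)) - G [] (P [] w)) /\<^sub>R t) (G [P [u] w] (P [] w)) (at 0)"
    by (rule jet_chain_rule[OF F3 F3 G PW[OF w] jet_deriv[OF F3 F3 P w, unfolded has_dir_deriv_iff_tends[OF F3]]])
  have 2: "tends F3 (\<lambda>t. (G [] (P [] (w + t *\<^sub>R u)) - G [] (P [] w)) /\<^sub>R t) u (at 0)"
    by (rule tends_cong[OF F3 tends_line[OF F3]], rule eventually_mono[OF eventually_line_in_open[OF F3 jet_open[OF F3 F3 P] w, of u]])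
      (simp add: GP w)
  show "G [P [u] w] (P [] w) = u" by (rule tends_unique[OF F3 1 2]) simp
  let ?z = "P [] w"
  have z: "?z \<in> W2" "G [] ?z = w" by (auto simp: PW GP w)
  have 1: "tends F3 (\<lambda>t. (P [] (G [] (?z + t *\<^sub>R u)) - P [] (G [] ?z)) /\<^sub>R t) (P [G [u] ?z] (G [] ?z)) (at 0)"
    by (rule jet_chain_rule[OF F3 F3 P GW[OF z(1)] jet_deriv[OF F3 F3 G z(1), unfolded has_dir_deriv_iff_tends[OF F3]]])
  have 2: "tends F3 (\<lambda>t. (P [] (G [] (?z + t *\<^sub>R u)) - P [] (G [] ?z)) /\<^sub>R t) u (at 0)"
    by (rule tends_cong[OF F3 tends_line[OF F3]], rule eventually_mono[OF eventually_line_in_open[OF F3 jet_open[OF F3 F3 G] z(1), of u]])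
      (simp add: PG z(1))
  show "P [G [u] (P [] w)] w = u" using tends_unique[OF F3 1 2] z by simp
qed

text \<open>The base component of P is the linear projection \<open>fst\<close>, so its second
  derivative vanishes: second derivatives of P are vertical, and a fiberwise coordinate change can
  be applied to them.\<close>

lemma fst_deriv:
  assumes w: "w \<in> W1"
  shows "fst (P [u] w) = fst u" "fst (P [u, v] w) = 0"
proof -
  have d: "has_dir_deriv F (\<lambda>y. fst (P hs y)) w h (fst (P (h # hs) w))" if "w \<in> W1" for hs h w
    using jet_deriv[OF F3 F3 P that, of hs h] by (simp add: has_dir_deriv_max_metric[OF F F2])
  have 1: "fst (P [u] w) = fst u" if w: "w \<in> W1" for u w
  proof (rule has_dir_deriv_unique[OF F d[OF w]])
    show "has_dir_deriv F (\<lambda>y. fst (P [] y)) w u (fst u)"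
    proof (rule has_dir_deriv_cong_ev[OF F])
      show "has_dir_deriv F fst w u (fst u)"
        using tends_line[OF F, of "fst w" "fst u"] by (simp add: has_dir_deriv_iff_tends[OF F])
      show "\<forall>\<^sub>F t in at 0. fst (w + t *\<^sub>R u) = fst (P [] (w + t *\<^sub>R u))"
        using eventually_line_in_open[OF F3 jet_open[OF F3 F3 P] w, of u]
        by (rule eventually_mono) (simp add: fst_P)
    qed (simp add: fst_P w)
  qed
  show "fst (P [u] w) = fst u" by (rule 1[OF w])
  show "fst (P [u, v] w) = 0"
  proof (rule has_dir_deriv_unique[OF F d[OF w]])
    show "has_dir_deriv F (\<lambda>y. fst (P [v] y)) w u 0"
    proof (rule has_dir_deriv_cong_ev[OF F])
      show "has_dir_deriv F (\<lambda>y. fst v) w u 0"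
        using tends_const[OF F, of 0] by (simp add: has_dir_deriv_iff_tends[OF F])
      show "\<forall>\<^sub>F t in at 0. fst v = fst (P [v] (w + t *\<^sub>R u))"
        using eventually_line_in_open[OF F3 jet_open[OF F3 F3 P] w, of u]
        by (rule eventually_mono) (simp add: 1)
    qed (simp add: 1 w)
  qed
qed

lemma fst_deriv_G:
  assumes w: "w \<in> W1"
  shows "fst (G [v] (P [] w)) = fst v"
  using fst_deriv(1)[OF w, of "G [v] (P [] w)"] deriv_inverse(2)[OF w, of v] by simp

text \<open>Linearity in h is that of a jet in its newest direction; the symmetry of second
  derivatives carries it over to g.\<close>

lemma \<tau>_bilinear:
  assumes x: "(x, 0, 0) \<in> W1"
  shows "linear (\<tau> x g)" "linear (\<lambda>g. \<tau> x g h)" "\<tau> x g h = \<tau> x h g"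
proof -
  let ?w = "(x, 0, 0)"
  note LG = jet_linear_hd[OF F3 F3 G PW[OF x], of "[]"]
  have l: "linear (\<lambda>v. (1/2) *\<^sub>R snd (snd (G [v] (P [] ?w))))"
    using linear_add[OF LG] linear_cmul[OF LG] by (intro linearI) (auto simp: algebra_simps)
  have e: "linear (\<lambda>h. (0, h, 0) :: 'f \<times> 'f \<times> 'f)" by (intro linearI) auto
  have "linear (\<lambda>h. P [(0, h, 0), (0, g, 0)] ?w)"
    using linear_compose[OF e jet_linear_hd[OF F3 F3 P x, of "[(0, g, 0)]"]] by (simp add: o_def)
  from linear_compose[OF this l] show "linear (\<tau> x g)" by (simp add: o_def \<tau>_def[abs_def])
  show sym: "\<tau> x g h = \<tau> x h g" for g h
    unfolding \<tau>_def by (subst jet_symmetric[OF F3 F3 P x]) simp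
  have "linear (\<tau> x h)" for h
  proof -
    have "linear (\<lambda>k. P [(0, k, 0), (0, h, 0)] ?w)"
      using linear_compose[OF e jet_linear_hd[OF F3 F3 P x, of "[(0, h, 0)]"]] by (simp add: o_def)
    from linear_compose[OF this l] show ?thesis by (simp add: o_def \<tau>_def[abs_def])
  qed
  moreover have "(\<lambda>g. \<tau> x g h) = \<tau> x h" using sym by auto
  ultimately show "linear (\<lambda>g. \<tau> x g h)" by simp
qed

lemma \<tau>_Lip:
  assumes x: "(x, 0, 0) \<in> W1"
  shows "\<tau> x g \<in> Lip_maps F F"
proof -
  let ?w = "(x, 0, 0)"
  obtain C where C: "C \<ge> 0" "\<And>hs. length hs = 2 \<Longrightarrow> nrm F3 (P hs ?w) \<le> C * prod_nrm F3 hs"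
    using jet_bound[OF F3 F3 P x] by blast
  obtain C' where C': "C' \<ge> 0" "\<And>hs. length hs = 1 \<Longrightarrow> nrm F3 (G hs (P [] ?w)) \<le> C' * prod_nrm F3 hs"
    using jet_bound[OF F3 F3 G PW[OF x]] by blast
  have b: "nrm F (\<tau> x g h) \<le> (C' * C * nrm F g) * nrm F h" for h
  proof -
    let ?v = "P [(0, h, 0), (0, g, 0)] ?w"
    have "nrm F (\<tau> x g h) \<le> nrm F (snd (snd (G [?v] (P [] ?w))))"
      unfolding \<tau>_def by (rule nrm_scaleR_le[OF F]) simp
    also have "\<dots> \<le> nrm F3 (G [?v] (P [] ?w))" by (simp add: nrm_max_metric)
    also have "\<dots> \<le> C' * nrm F3 ?v" using C'(2)[of "[?v]"] by simp
    also have "\<dots> \<le> C' * (C * (nrm F h * nrm F g))"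
      using C(2)[of "[(0, h, 0), (0, g, 0)]"] C'(1)
      by (intro mult_left_mono) (simp_all add: nrm_zero[OF F] max_absorb1 max_absorb2)
    finally show ?thesis by (simp add: mult_ac)
  qed
  have "bdd_above (Lip_quotients F F (\<tau> x g))"
    unfolding bdd_above_def Lip_quotients_def
  proof (intro exI ballI)
    fix q assume "q \<in> {nrm F (\<tau> x g y) / nrm F y |y. y \<noteq> 0}"
    then obtain y where y: "y \<noteq> 0" "q = nrm F (\<tau> x g y) / nrm F y" by blast
    have "nrm F y > 0" using y nrm_eq_0[OF F, of y] mdist_nonneg[of F y 0] by linarith
    then show "q \<le> C' * C * nrm F g" using b[of y] y by (simp add: pos_divide_le_eq)
  qed
  then show ?thesis using \<tau>_bilinear(1)[OF x] by (simp add: Lip_maps_def std_mspace[OF F])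
qed

text \<open>A composite of maps known to be of class MC: linear insertions of x, g and h, the map P
  with its second derivative, the derivative of G, and a scaled projection.\<close>

lemma \<tau>_MC_inf:
  assumes O: "openin (mtopology_of F) U" and U: "\<And>x. x \<in> U \<Longrightarrow> (x, 0, 0) \<in> W1"
  shows "MC_inf (max_metric (max_metric F F) F) F ((U \<times> UNIV) \<times> UNIV) (\<lambda>((x, g), h). \<tau> x g h)"
proof -
  let ?E = "max_metric (max_metric F F) F" and ?S = "(U \<times> UNIV) \<times> UNIV :: (('f \<times> 'f) \<times> 'f) set"
  have E: "standard_metric ?E" by (rule standard_metric_max_metric[OF F2 F])
  have S: "openin (mtopology_of ?E) ?S"
    by (intro openin_Times_std F F2 O openin_UNIV_std)
  have F33: "standard_metric (max_metric F3 F3)" by (rule standard_metric_max_metric[OF F3 F3])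
  have F3333: "standard_metric (max_metric (max_metric F3 F3) (max_metric F3 F3))"
    by (rule standard_metric_max_metric[OF F33 F33])
  have l1: "MC_inf ?E F3 ?S (\<lambda>z. (fst (fst z), 0, 0))"
    by (rule MC_inf_linear[OF E F3 _ _ zero_le_one S])
      (auto simp: nrm_max_metric nrm_zero[OF F] intro!: linearI)
  \<comment> \<open>The final entry 0 removes the term \<open>P [l] x\<close> of
    \<open>MC_inf_second_derivative\<close> and leaves the second derivative alone.\<close>
  have l2: "MC_inf ?E (max_metric (max_metric F3 F3) (max_metric F3 F3)) ?S
     (\<lambda>z. (((fst (fst z), 0, 0), (0, snd (fst z), 0)), ((0, snd z, 0), 0)))"
    by (rule MC_inf_linear[OF E F3333 _ _ zero_le_one S])
      (auto simp: nrm_max_metric nrm_zero[OF F] intro!: linearI)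
  have Q1: "MC_inf ?E F3 ?S (\<lambda>z. P [] (fst (fst z), 0, 0))"
    by (rule MC_inf_compose[OF E F3 F3 l1 jet_imp_MC_inf[OF F3 F3 P]]) (auto simp: U)
  have Q2: "MC_inf ?E F3 ?S (\<lambda>z. (\<lambda>((x, g), (h, l)). P [h, g] x + P [l] x)
     (((fst (fst z), 0, 0), (0, snd (fst z), 0)), ((0, snd z, 0), 0)))"
    by (rule MC_inf_compose[OF E F3333 F3 l2 MC_inf_second_derivative[OF F3 F3 P]]) (auto simp: U)
  have "MC_inf ?E F3 ?S (\<lambda>z. (\<lambda>(x, h). G [h] x) (P [] (fst (fst z), 0, 0),
     (\<lambda>((x, g), (h, l)). P [h, g] x + P [l] x)
     (((fst (fst z), 0, 0), (0, snd (fst z), 0)), ((0, snd z, 0), 0))))"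
    by (rule MC_inf_compose[OF E F33 F3 MC_inf_Pair[OF E F3 F3 Q1 Q2] MC_inf_derivative[OF F3 F3 G]])
      (auto simp: U PW)
  moreover have "MC_inf F3 F UNIV (\<lambda>v. (1/2) *\<^sub>R snd (snd v))"
    by (rule MC_inf_linear[OF F3 F _ _ zero_le_one openin_UNIV_std[OF F3]])
      (auto simp: algebra_simps nrm_max_metric intro!: linearI order_trans[OF nrm_scaleR_le[OF F]])
  ultimately have "MC_inf ?E F ?S (\<lambda>z. (1/2) *\<^sub>R snd (snd ((\<lambda>(x, h). G [h] x) (P [] (fst (fst z), 0, 0),
     (\<lambda>((x, g), (h, l)). P [h, g] x + P [l] x)
     (((fst (fst z), 0, 0), (0, snd (fst z), 0)), ((0, snd z, 0), 0))))))"
    by (rule MC_inf_compose[OF E F3 F]) simp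
  then show ?thesis
  proof (rule MC_inf_cong[OF E F])
    fix z assume "z \<in> ?S"
    then have x: "(fst (fst z), 0, 0) \<in> W1" using U by auto
    have "P [0] (fst (fst z), 0, 0) = 0" by (rule linear_0[OF jet_linear_hd[OF F3 F3 P x]])
    then show "(case z of (xa, x) \<Rightarrow> (case xa of (x, g) \<Rightarrow> \<tau> x g) x) = (1/2) *\<^sub>R snd (snd ((\<lambda>(x, h). G [h] x) (P [] (fst (fst z), 0, 0),
     (\<lambda>((x, g), (h, l)). P [h, g] x + P [l] x)
     (((fst (fst z), 0, 0), (0, snd (fst z), 0)), ((0, snd z, 0), 0)))))"
      by (auto simp: \<tau>_def split: prod.split)
  qed
qed

end

lemma tends_linear_map:
  assumes E: "standard_metric E" and F: "standard_metric F" and l: "linear l" and b: "\<And>h. nrm F (l h) \<le> C * nrm E h"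
    and f: "tends E f y G"
  shows "tends F (\<lambda>t. l (f t)) (l y) G"
proof (rule tends_le[OF F])
  show "((\<lambda>t. C * nrm E (f t - y)) \<longlongrightarrow> 0) G"
    by (rule tendsto_mult_right_zero) (use f in \<open>simp add: tends_def\<close>)
  show "\<forall>\<^sub>F t in G. nrm F (l (f t) - l y) \<le> C * nrm E (f t - y)"
    using b by (simp add: linear_diff[OF l, symmetric])
qed

text \<open>The hypothesis \<open>comp\<close> says that the local forms \<open>P\<close> and \<open>P'\<close> correspond to each other under
  a coordinate change with jet \<open>Ds\<close>. Differentiating it twice along the curve \<open>(x, s g, 0)\<close>, whose image
  in the second chart is \<open>(y, s g', s\<^sup>2 q)\<close> with \<open>q\<close> the second derivative of the coordinate change in
  direction \<open>g\<close>, gives the transformation law on the diagonal; polarization does the rest.\<close>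

lemma fiber_diffeo_transformation:
  assumes A: "fiber_diffeo F W1 W2 P G" and A': "fiber_diffeo F W1' W2' P' G'"
    and Ds: "jet F F \<Sigma> Ds" and x: "x \<in> \<Sigma>" and w0: "(x, 0, 0) \<in> W1"
    and comp: "\<And>g k. (x, g, k) \<in> W1 \<Longrightarrow> (Ds [] x, Ds [g] x, Ds [g, g] x + Ds [k] x) \<in> W1' \<and>
      P' [] (Ds [] x, Ds [g] x, Ds [g, g] x + Ds [k] x) =
        (Ds [] x, Ds [fst (snd (P [] (x, g, k)))] x, Ds [snd (snd (P [] (x, g, k)))] x)"
  shows "fiber_diffeo.\<tau> P' G' (Ds [] x) (Ds [g] x) (Ds [h] x) + Ds [h, g] x = Ds [fiber_diffeo.\<tau> P G x g h] x"
proof -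
  interpret A: fiber_diffeo F W1 W2 P G by (rule A)
  interpret A': fiber_diffeo F W1' W2' P' G' by (rule A')
  note F = A.F and F3 = A.F3
  let ?F3 = "max_metric F (max_metric F F)"
  define d where "d v = Ds [v] x" for v
  \<comment> \<open>Over the fixed base point x the change of charts of
    \<open>TM \<oplus> TM\<close> is linear on the fiber; S is this linear map, taken on vertical
    vectors.\<close>
  define S where "S u = (0 :: 'a, d (fst (snd u)), d (snd (snd u)))" for u :: "'a \<times> 'a \<times> 'a"
  define q where "q g = Ds [g, g] x" for g
  let ?y = "Ds [] x" and ?w = "(x, 0 :: 'a, 0 :: 'a)" and ?w' = "(Ds [] x, 0 :: 'a, 0 :: 'a)"
  have d: "linear d" unfolding d_def by (rule jet_linear_hd[OF F F Ds x])
  have S: "linear S" using linear_add[OF d] linear_cmul[OF d] by (intro linearI) (auto simp: S_def)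
  obtain C where C: "C \<ge> 0" "\<And>v. nrm F (d v) \<le> C * nrm F v"
  proof -
    obtain C where C: "C \<ge> 0" "\<And>hs. length hs = 1 \<Longrightarrow> nrm F (Ds hs x) \<le> C * prod_nrm F hs"
      using jet_bound[OF F F Ds x] by blast
    have "nrm F (d v) \<le> C * nrm F v" for v using C(2)[of "[v]"] by (simp add: d_def)
    with C(1) show thesis by (rule that)
  qed
  have Sb: "nrm ?F3 (S u) \<le> C * nrm ?F3 u" for u
  proof -
    have "nrm F (d (fst (snd u))) \<le> C * nrm ?F3 u" "nrm F (d (snd (snd u))) \<le> C * nrm ?F3 u"
      by (rule order_trans[OF C(2)], rule mult_left_mono[OF _ C(1)], simp add: nrm_max_metric)+
    then show ?thesis using C(1) by (simp add: S_def nrm_zero[OF F])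
  qed
  have w0': "?w' \<in> W1'" and P0: "P' [] ?w' = (?y, d (fst (snd (P [] ?w))), d (snd (snd (P [] ?w))))"
    using comp[OF w0] linear_0[OF d] linear_0[OF jet_linear_hd[OF F F Ds x, of "[0]"]] by (auto simp: d_def)
  \<comment> \<open>The first identity is wanted for every vertical u, since \<open>comm\<close>
    applies it to \<open>?M v\<close>; the second is applied to \<open>(0, g, 0)\<close>.\<close>
  have key: "P' [S u] ?w' = S (P [u] ?w)"
    "P' [S u, S u] ?w' + P' [2 *\<^sub>R (0, 0, q (fst (snd u)))] ?w' = S (P [u, u] ?w)"
    if u: "fst u = 0" for u
  proof -
    define b where "b = (0 :: 'a, 0 :: 'a, q (fst (snd u)))"
    \<comment> \<open>The image of the line \<open>?w + s u\<close> under the change of charts of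
      T2M: its quadratic term comes from the second derivative of the coordinate change.\<close>
    define c where "c s = ?w' + s *\<^sub>R S u + s\<^sup>2 *\<^sub>R b" for s :: real
    have qs: "Ds [s *\<^sub>R v, s *\<^sub>R v] x = s\<^sup>2 *\<^sub>R q v" for s v
      using linear_cmul[OF jet_linear[OF F F Ds x, of "[]" "[s *\<^sub>R v]"], of s v]
        linear_cmul[OF jet_linear[OF F F Ds x, of "[v]" "[]"], of s v]
      by (simp add: q_def power2_eq_square)
    have line: "?w + s *\<^sub>R u = (x, s *\<^sub>R fst (snd u), s *\<^sub>R snd (snd u))" for s
      using u by (cases u) auto
    have c: "c s = (?y, Ds [s *\<^sub>R fst (snd u)] x, Ds [s *\<^sub>R fst (snd u), s *\<^sub>R fst (snd u)] x + Ds [s *\<^sub>R snd (snd u)] x)" for s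
      using linear_cmul[OF d] unfolding qs by (simp add: c_def b_def S_def d_def)
    have cW: "c s \<in> W1'" and Pc: "P' [] (c s) = (?y, 0, 0) + S (P [] (?w + s *\<^sub>R u))" if "?w + s *\<^sub>R u \<in> W1" for s
      using comp[of "s *\<^sub>R fst (snd u)" "s *\<^sub>R snd (snd u)"] that unfolding c line
      by (simp_all add: S_def d_def)
    have cd: "tends ?F3 (\<lambda>t. (c (s + t) - c s) /\<^sub>R t) (S u + (2 * s) *\<^sub>R b) (at 0)" for s
    proof -
      have "tends ?F3 (\<lambda>t. t *\<^sub>R b) 0 (at 0)"
        using nrm_scaleR_tendsto[OF F3, of b] by (simp add: tends_def)
      from tends_add[OF F3 tends_const[OF F3, of "S u + (2 * s) *\<^sub>R b"] this]
      have "tends ?F3 (\<lambda>t. S u + (2 * s) *\<^sub>R b + t *\<^sub>R b) (S u + (2 * s) *\<^sub>R b) (at 0)" by simp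
      then show ?thesis
      proof (rule tends_cong[OF F3])
        have "S u + (2 * s) *\<^sub>R b + t *\<^sub>R b = (c (s + t) - c s) /\<^sub>R t" if "t \<noteq> 0" for t
        proof -
          have "c (s + t) - c s = t *\<^sub>R (S u + (2 * s) *\<^sub>R b + t *\<^sub>R b)"
            by (simp add: c_def power2_eq_square algebra_simps scaleR_left_distrib[symmetric] del: scaleR_left_distrib)
          then show ?thesis using that by simp
        qed
        then show "\<forall>\<^sub>F t in at 0. S u + (2 * s) *\<^sub>R b + t *\<^sub>R b = (c (s + t) - c s) /\<^sub>R t"
          by (simp add: eventually_at_filter)
      qed
    qed
    \<comment> \<open>\<open>comp\<close> is differentiated along c at every admissible s and not
      only at 0, because the result has to be differentiated once more.\<close>
    have first: "P' [S u + (2 * s) *\<^sub>R b] (c s) = S (P [u] (?w + s *\<^sub>R u))" if s: "?w + s *\<^sub>R u \<in> W1" for s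
    proof -
      have 1: "tends ?F3 (\<lambda>t. (P' [] (c (s + t)) - P' [] (c s)) /\<^sub>R t) (P' [S u + (2 * s) *\<^sub>R b] (c s)) (at 0)"
        by (rule jet_chain_rule[OF F3 F3 A'.P cW[OF s] cd])
      have 2: "tends ?F3 (\<lambda>t. S ((P [] (?w + s *\<^sub>R u + t *\<^sub>R u) - P [] (?w + s *\<^sub>R u)) /\<^sub>R t)) (S (P [u] (?w + s *\<^sub>R u))) (at 0)"
        by (rule tends_linear_map[OF F3 F3 S Sb jet_deriv[OF F3 F3 A.P s, unfolded has_dir_deriv_iff_tends[OF F3]]])
      have "tends ?F3 (\<lambda>t. (P' [] (c (s + t)) - P' [] (c s)) /\<^sub>R t) (S (P [u] (?w + s *\<^sub>R u))) (at 0)"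
      proof (rule tends_cong[OF F3 2], rule eventually_mono[OF eventually_line_in_open[OF F3 jet_open[OF F3 F3 A.P] s, of u]])
        fix t assume t: "?w + s *\<^sub>R u + t *\<^sub>R u \<in> W1"
        have eq: "?w + s *\<^sub>R u + t *\<^sub>R u = ?w + (s + t) *\<^sub>R u" by (simp only: scaleR_left_distrib add.assoc)
        show "S ((P [] (?w + s *\<^sub>R u + t *\<^sub>R u) - P [] (?w + s *\<^sub>R u)) /\<^sub>R t) = (P' [] (c (s + t)) - P' [] (c s)) /\<^sub>R t"
          unfolding eq using Pc[OF t[unfolded eq]] Pc[OF s] by (simp add: linear_cmul[OF S] linear_diff[OF S])
      qed
      from tends_unique[OF F3 1 this] show ?thesis by simp
    qed
    have c0: "c 0 = ?w'" by (simp add: c_def)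
    show "P' [S u] ?w' = S (P [u] ?w)" using first[of 0] w0 c0 by simp
    \<comment> \<open>The second differentiation: the moving base point \<open>c t\<close> produces
      the second derivative of P', and the moving slot \<open>S u + 2 t b\<close>, the velocity of
      c, produces the term with \<open>2 b\<close>.\<close>
    have "tends ?F3 (\<lambda>t. (P' ([] @ map (\<lambda>i. S u + (2 * t) *\<^sub>R b) [()]) (c t) - P' ([] @ map (\<lambda>i. S u) [()]) ?w') /\<^sub>R t)
       (P' (S u # [] @ map (\<lambda>i. S u) [()]) ?w' + (\<Sum>L\<leftarrow>repl (\<lambda>i. S u) (\<lambda>i. 2 *\<^sub>R b) [()]. P' ([] @ L) ?w')) (at 0)"
    proof (rule jet_curve_deriv[OF F3 F3 A'.P w0'])
      show "tends ?F3 (\<lambda>t. (c t - ?w') /\<^sub>R t) (S u) (at 0)" using cd[of 0] by (simp add: c0)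
      show "tends ?F3 (\<lambda>t. (S u + (2 * t) *\<^sub>R b - S u) /\<^sub>R t) (2 *\<^sub>R b) (at 0)"
        by (rule tends_cong[OF F3 tends_const[OF F3]]) (simp add: eventually_at_filter)
    qed
    then have 1: "tends ?F3 (\<lambda>t. (P' [S u + (2 * t) *\<^sub>R b] (c t) - P' [S u] ?w') /\<^sub>R t)
       (P' [S u, S u] ?w' + P' [2 *\<^sub>R b] ?w') (at 0)" by simp
    have 2: "tends ?F3 (\<lambda>t. S ((P [u] (?w + t *\<^sub>R u) - P [u] ?w) /\<^sub>R t)) (S (P [u, u] ?w)) (at 0)"
      by (rule tends_linear_map[OF F3 F3 S Sb jet_deriv[OF F3 F3 A.P w0, unfolded has_dir_deriv_iff_tends[OF F3]]])
    have "tends ?F3 (\<lambda>t. (P' [S u + (2 * t) *\<^sub>R b] (c t) - P' [S u] ?w') /\<^sub>R t) (S (P [u, u] ?w)) (at 0)"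
    proof (rule tends_cong[OF F3 2], rule eventually_mono[OF eventually_line_in_open[OF F3 jet_open[OF F3 F3 A.P] w0, of u]])
      fix t assume "?w + t *\<^sub>R u \<in> W1"
      then show "S ((P [u] (?w + t *\<^sub>R u) - P [u] ?w) /\<^sub>R t) = (P' [S u + (2 * t) *\<^sub>R b] (c t) - P' [S u] ?w') /\<^sub>R t"
        using first[of t] first[of 0] w0 by (simp add: c0 linear_cmul[OF S] linear_diff[OF S])
    qed
    from tends_unique[OF F3 1 this]
    show "P' [S u, S u] ?w' + P' [2 *\<^sub>R (0, 0, q (fst (snd u)))] ?w' = S (P [u, u] ?w)" by (simp add: b_def)
  qed
  let ?M = "\<lambda>v. G [v] (P [] ?w)" and ?M' = "\<lambda>v. G' [v] (P' [] ?w')"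
  have M': "linear ?M'" by (rule jet_linear_hd[OF F3 F3 A'.G A'.PW[OF w0']])
  \<comment> \<open>S intertwines the first derivatives of P and P' on vertical vectors, hence also
    their inverses, the derivatives of G and G'.\<close>
  have comm: "?M' (S v) = S (?M v)" if v: "fst v = 0" for v
  proof -
    have "fst (?M v) = 0" using A.fst_deriv_G[OF w0] v by simp
    from key(1)[OF this] have "P' [S (?M v)] ?w' = S v" by (simp add: A.deriv_inverse(2)[OF w0])
    then show ?thesis using A'.deriv_inverse(1)[OF w0', of "S (?M v)"] by simp
  qed
  \<comment> \<open>Applying \<open>?M'\<close> to the second identity frees the inhomogeneous term
    \<open>2 q g\<close> from the derivative of P'; half of the last component is the law for h =
    g.\<close>
  have diag: "A'.\<tau> ?y (d g) (d g) + q g = d (A.\<tau> x g g)" for g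
  proof -
    let ?u = "(0 :: 'a, g, 0 :: 'a)"
    have Su: "S ?u = (0, d g, 0)" using linear_0[OF d] by (simp add: S_def)
    have "?M' (P' [S ?u, S ?u] ?w') + ?M' (P' [2 *\<^sub>R (0, 0, q g)] ?w') = ?M' (S (P [?u, ?u] ?w))"
    proof -
      have "P' [S ?u, S ?u] ?w' + P' [2 *\<^sub>R (0, 0, q g)] ?w' = S (P [?u, ?u] ?w)"
        using key(2)[of ?u] by simp
      from arg_cong[OF this, of ?M'] show ?thesis unfolding linear_add[OF M'] .
    qed
    also have "?M' (P' [2 *\<^sub>R (0, 0, q g)] ?w') = 2 *\<^sub>R (0, 0, q g)" by (rule A'.deriv_inverse(1)[OF w0'])
    also have "?M' (S (P [?u, ?u] ?w)) = S (?M (P [?u, ?u] ?w))"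
      by (rule comm) (rule A.fst_deriv(2)[OF w0])
    finally have "(1/2) *\<^sub>R snd (snd (?M' (P' [S ?u, S ?u] ?w') + 2 *\<^sub>R (0, 0, q g))) = (1/2) *\<^sub>R d (snd (snd (?M (P [?u, ?u] ?w))))"
      by (simp add: S_def)
    then show ?thesis
      by (simp add: A'.\<tau>_def A.\<tau>_def Su linear_cmul[OF d] scaleR_right_distrib)
  qed
  \<comment> \<open>The defect of the law is symmetric and additive and vanishes on the diagonal, so
    it vanishes.\<close>
  define B where "B g h = A'.\<tau> ?y (d g) (d h) + Ds [h, g] x - d (A.\<tau> x g h)" for g h
  have B0: "B g g = 0" for g using diag[of g] by (simp add: B_def q_def)
  have dsym: "Ds [h, g] x = Ds [g, h] x" for g h by (rule jet_symmetric[OF F F Ds x])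
  have Bsym: "B g h = B h g" for g h
    unfolding B_def using A'.\<tau>_bilinear(3)[OF w0'] A.\<tau>_bilinear(3)[OF w0] dsym by metis
  have Badd: "B (g + h) k = B g k + B h k" for g h k
    unfolding B_def dsym[of k]
    using linear_add[OF A'.\<tau>_bilinear(2)[OF w0'], of "d h" "d g" "d k"] linear_add[OF A.\<tau>_bilinear(2)[OF w0], of h g k]
      linear_add[OF d] linear_add[OF jet_linear_hd[OF F F Ds x, of "[k]"], of g h] by (simp add: algebra_simps)
  have "B (g + h) (g + h) = (B g g + B h g) + (B g h + B h h)"
    unfolding Badd[of g h "g + h"] Bsym[of g "g + h"] Bsym[of h "g + h"] Badd[of g h] by (simp only: add_ac)
  then have "B g h + B g h = 0" by (simp add: B0 Bsym[of h g])
  then have "2 *\<^sub>R B g h = 0" by (simp only: scaleR_2)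
  then have "B g h = 0" by simp
  then show ?thesis by (simp add: B_def d_def)
qed

section \<open>Curves and tangent vectors\<close>

text \<open>Common interface of M and TM, so that the tangent construction can be applied twice. A
  transition map is given by a jet on some open set that contains the chart image of the overlap;
  thus the image of a tangent chart need not be known at this stage.\<close>

locale charted =
  fixes G :: "'g::real_vector metric" and N :: "('n, 'g) mfd"
  assumes G: "standard_metric G" and model: "model N = G"
    and cover: "p \<in> pts N \<Longrightarrow> \<exists>(U, \<phi>)\<in>atlas N. p \<in> U"
    and chart_open: "(U, \<phi>) \<in> atlas N \<Longrightarrow> openin (topo N) U"
    and transition_jet: "(U, \<phi>) \<in> atlas N \<Longrightarrow> (V, \<psi>) \<in> atlas N \<Longrightarrow>
      \<exists>S D. jet G G S D \<and> (\<forall>p\<in>U \<inter> V. \<phi> p \<in> S \<and> D [] (\<phi> p) = \<psi> p)"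
begin

lemma smooth_curve_pts: "smooth_curve N c \<Longrightarrow> c t \<in> pts N"
  by (auto simp: smooth_curve_def continuous_map_def)

lemma obtain_chart:
  assumes "p \<in> pts N"
  obtains U \<phi> where "(U, \<phi>) \<in> atlas N" "p \<in> U"
  using cover[OF assms] by auto

lemma curve_open:
  assumes "smooth_curve N c" "openin (topo N) B"
  shows "open (c -` B)"
proof -
  have "openin euclidean {t \<in> topspace euclidean. c t \<in> B}"
    using assms by (intro openin_continuous_map_preimage) (auto simp: smooth_curve_def)
  then show ?thesis by (simp add: vimage_def)
qed

lemma curve_eventually:
  assumes "smooth_curve N c" "openin (topo N) B" "c t \<in> B"
  shows "\<forall>\<^sub>F s in at 0. c (t + s) \<in> B"
proof -
  have "open ((\<lambda>s. t + s) -` (c -` B))"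
    by (intro open_vimage curve_open assms continuous_intros)
  then show ?thesis
    unfolding eventually_at_topological using assms(3) by (intro exI[of _ "(\<lambda>s. t + s) -` (c -` B)"]) auto
qed

lemma obtain_smooth_curve:
  assumes c: "smooth_curve N c" and U: "(U, \<phi>) \<in> atlas N"
  obtains D where "\<And>t. t \<in> c -` U \<Longrightarrow> D (0::nat) t = \<phi> (c t)"
    "\<And>n t. t \<in> c -` U \<Longrightarrow> has_dir_deriv G (D n) t 1 (D (Suc n) t)"
proof -
  have "\<forall>(U, \<phi>)\<in>atlas N. \<exists>D :: nat \<Rightarrow> real \<Rightarrow> 'g.
        (\<forall>t\<in>c -` U. D 0 t = \<phi> (c t)) \<and>
        (\<forall>n. \<forall>t\<in>c -` U. has_dir_deriv (model N) (D n) t 1 (D (Suc n) t))"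
    using c unfolding smooth_curve_def by (rule conjunct2)
  from bspec[OF this U] obtain D :: "nat \<Rightarrow> real \<Rightarrow> 'g" where
    "\<forall>t\<in>c -` U. D 0 t = \<phi> (c t)" "\<forall>n. \<forall>t\<in>c -` U. has_dir_deriv G (D n) t 1 (D (Suc n) t)"
    unfolding model by auto
  then show thesis by (intro that[of D]) simp_all
qed

lemma has_dir_deriv_velocity:
  assumes c: "smooth_curve N c" and U: "(U, \<phi>) \<in> atlas N" "c 0 \<in> U"
  shows "has_dir_deriv G (\<phi> \<circ> c) 0 1 (velocity G (\<phi> \<circ> c))"
proof -
  obtain D :: "nat \<Rightarrow> real \<Rightarrow> 'g" where D: "\<And>t. t \<in> c -` U \<Longrightarrow> D 0 t = \<phi> (c t)"
    "\<And>n t. t \<in> c -` U \<Longrightarrow> has_dir_deriv G (D n) t 1 (D (Suc n) t)"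
    by (rule obtain_smooth_curve[OF c U(1)]) blast
  have "has_dir_deriv G (\<phi> \<circ> c) 0 1 (D 1 0)"
  proof (rule has_dir_deriv_cong_ev[OF G])
    show "has_dir_deriv G (D 0) 0 1 (D 1 0)" using D(2)[of 0 0] U by simp
    show "\<forall>\<^sub>F t in at 0. D 0 (0 + t *\<^sub>R 1) = (\<phi> \<circ> c) (0 + t *\<^sub>R 1)"
      using curve_eventually[OF c chart_open[OF U(1)], of 0] U(2) D(1) by (auto elim: eventually_mono)
  qed (use D(1)[of 0] U in simp)
  then show ?thesis unfolding velocity_def by (simp add: has_dir_deriv_the[OF G])
qed

lemma velocityI: "has_dir_deriv G \<gamma> 0 1 v \<Longrightarrow> velocity G \<gamma> = v"
  unfolding velocity_def by (rule has_dir_deriv_the[OF G])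

lemma tends_velocity:
  assumes c: "smooth_curve N c" and U: "(U, \<phi>) \<in> atlas N" "c 0 \<in> U"
  shows "tends G (\<lambda>t. (\<phi> (c t) - \<phi> (c 0)) /\<^sub>R t) (velocity G (\<phi> \<circ> c)) (at 0)"
  using has_dir_deriv_velocity[OF assms] by (simp add: has_dir_deriv_iff_tends[OF G] o_def)

lemma velocity_change:
  assumes c: "smooth_curve N c" and U: "(U, \<phi>) \<in> atlas N" "c 0 \<in> U" and V: "(V, \<psi>) \<in> atlas N" "c 0 \<in> V"
    and D: "jet G G S D" "\<And>p. p \<in> U \<inter> V \<Longrightarrow> \<phi> p \<in> S \<and> D [] (\<phi> p) = \<psi> p"
  shows "velocity G (\<psi> \<circ> c) = D [velocity G (\<phi> \<circ> c)] (\<phi> (c 0))"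
proof (rule velocityI)
  have S: "\<phi> (c 0) \<in> S" using D(2) U V by blast
  have "tends G (\<lambda>t. (D [] (\<phi> (c t)) - D [] (\<phi> (c 0))) /\<^sub>R t) (D [velocity G (\<phi> \<circ> c)] (\<phi> (c 0))) (at 0)"
    by (rule jet_chain_rule[OF G G D(1) S tends_velocity[OF c U]])
  moreover have "\<forall>\<^sub>F t in at 0. c t \<in> U \<inter> V"
    using curve_eventually[OF c openin_Int[OF chart_open[OF U(1)] chart_open[OF V(1)]], of 0] U V by simp
  ultimately have "tends G (\<lambda>t. (\<psi> (c t) - \<psi> (c 0)) /\<^sub>R t) (D [velocity G (\<phi> \<circ> c)] (\<phi> (c 0))) (at 0)"
    by (rule tends_cong[OF G, OF _ eventually_mono]) (use D(2) U V in auto)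
  then show "has_dir_deriv G (\<psi> \<circ> c) 0 1 (D [velocity G (\<phi> \<circ> c)] (\<phi> (c 0)))"
    by (simp add: has_dir_deriv_iff_tends[OF G] o_def)
qed

lemma velocity_eq_transfer:
  assumes c: "smooth_curve N c" "smooth_curve N c'" "c 0 = c' 0"
    and U: "(U, \<phi>) \<in> atlas N" "c 0 \<in> U" and V: "(V, \<psi>) \<in> atlas N" "c 0 \<in> V"
    and eq: "velocity G (\<phi> \<circ> c) = velocity G (\<phi> \<circ> c')"
  shows "velocity G (\<psi> \<circ> c) = velocity G (\<psi> \<circ> c')"
proof -
  obtain S D where D: "jet G G S D" "\<And>p. p \<in> U \<inter> V \<Longrightarrow> \<phi> p \<in> S \<and> D [] (\<phi> p) = \<psi> p"
    using transition_jet[OF U(1) V(1)] by blast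
  show ?thesis
    using velocity_change[OF c(1) U V D] velocity_change[OF c(2) U(1) _ V(1) _ D] U V c(3) eq by simp
qed

text \<open>\<open>same_1jet\<close> asks for some chart; the transition rule for velocities lets
  any chart at the point decide.\<close>

lemma same_1jet_iff:
  assumes c: "smooth_curve N c" "smooth_curve N c'" and U: "(U, \<phi>) \<in> atlas N" "c 0 \<in> U"
  shows "same_1jet N c c' \<longleftrightarrow> c 0 = c' 0 \<and> velocity G (\<phi> \<circ> c) = velocity G (\<phi> \<circ> c')"
proof
  assume "same_1jet N c c'"
  then obtain V \<psi> where "c 0 = c' 0" "(V, \<psi>) \<in> atlas N" "c 0 \<in> V" "velocity G (\<psi> \<circ> c) = velocity G (\<psi> \<circ> c')"
    unfolding same_1jet_def model by blast
  then show "c 0 = c' 0 \<and> velocity G (\<phi> \<circ> c) = velocity G (\<phi> \<circ> c')"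
    using velocity_eq_transfer[OF c] U by blast
qed (use U in \<open>auto simp: same_1jet_def model\<close>)

text \<open>Names the choice on which \<open>tproj\<close>, \<open>tchart\<close> and
  \<open>tangent_map\<close> are built. Only its membership in the jet is used, so base point and
  velocity do not depend on it.\<close>

definition rep :: "(real \<Rightarrow> 'n) set \<Rightarrow> real \<Rightarrow> 'n" where
  "rep \<xi> = (SOME c. c \<in> \<xi>)"

lemma jet1_refl:
  assumes c: "smooth_curve N c"
  shows "c \<in> jet1 N c"
proof -
  obtain U \<phi> where "(U, \<phi>) \<in> atlas N" "c 0 \<in> U" by (rule obtain_chart[OF smooth_curve_pts[OF c, of 0]])
  then show ?thesis using c by (auto simp: jet1_def same_1jet_def)
qed

lemma rep_jet1:
  assumes c: "smooth_curve N c"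
  shows "smooth_curve N (rep (jet1 N c))" "rep (jet1 N c) 0 = c 0"
    "(U, \<phi>) \<in> atlas N \<Longrightarrow> c 0 \<in> U \<Longrightarrow> velocity G (\<phi> \<circ> rep (jet1 N c)) = velocity G (\<phi> \<circ> c)"
proof -
  have "rep (jet1 N c) \<in> jet1 N c"
    unfolding rep_def by (rule someI[of "\<lambda>c'. c' \<in> jet1 N c", OF jet1_refl[OF c]])
  then have *: "smooth_curve N (rep (jet1 N c))" "same_1jet N c (rep (jet1 N c))"
    by (auto simp: jet1_def)
  show "smooth_curve N (rep (jet1 N c))" by (rule *)
  show "rep (jet1 N c) 0 = c 0" using *(2) by (simp add: same_1jet_def)
  show "velocity G (\<phi> \<circ> rep (jet1 N c)) = velocity G (\<phi> \<circ> c)" if "(U, \<phi>) \<in> atlas N" "c 0 \<in> U"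
    using * same_1jet_iff[OF c *(1) that] by simp
qed

lemma tproj_eq_rep: "tproj \<xi> = rep \<xi> 0"
  by (simp add: tproj_def rep_def)

lemma tchart_eq_rep: "tchart G \<phi> \<xi> = (\<phi> (tproj \<xi>), velocity G (\<phi> \<circ> rep \<xi>))"
  by (simp add: tchart_def rep_def)

lemma tproj_jet1: "smooth_curve N c \<Longrightarrow> tproj (jet1 N c) = c 0"
  by (simp add: tproj_eq_rep rep_jet1)

lemma tchart_jet1:
  "smooth_curve N c \<Longrightarrow> (U, \<phi>) \<in> atlas N \<Longrightarrow> c 0 \<in> U \<Longrightarrow> tchart G \<phi> (jet1 N c) = (\<phi> (c 0), velocity G (\<phi> \<circ> c))"
  by (simp add: tchart_eq_rep tproj_jet1 rep_jet1)

lemma jet1_in_tangent_set: "smooth_curve N c \<Longrightarrow> jet1 N c \<in> tangent_set N"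
  by (simp add: tangent_set_def)

lemma rep_smooth: "\<xi> \<in> tangent_set N \<Longrightarrow> smooth_curve N (rep \<xi>)"
  by (auto simp: tangent_set_def rep_jet1)

lemma jet1_eqI:
  assumes c: "smooth_curve N c" "smooth_curve N c'" and eq: "c 0 = c' 0"
    and U: "(U, \<phi>) \<in> atlas N" "c 0 \<in> U" and v: "velocity G (\<phi> \<circ> c) = velocity G (\<phi> \<circ> c')"
  shows "jet1 N c = jet1 N c'"
  unfolding jet1_def
  using same_1jet_iff[OF c(1) _ U] same_1jet_iff[OF c(2) _ U(1)] U eq v by auto

lemma jet1_rep: "\<xi> \<in> tangent_set N \<Longrightarrow> jet1 N (rep \<xi>) = \<xi>"
proof -
  assume "\<xi> \<in> tangent_set N"
  then obtain c where c: "smooth_curve N c" "\<xi> = jet1 N c" by (auto simp: tangent_set_def)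
  obtain U \<phi> where U: "(U, \<phi>) \<in> atlas N" "c 0 \<in> U" by (rule obtain_chart[OF smooth_curve_pts[OF c(1), of 0]])
  show ?thesis
    unfolding c(2) by (rule jet1_eqI[OF rep_jet1(1)[OF c(1)] c(1) rep_jet1(2)[OF c(1)] U(1)])
      (simp_all only: rep_jet1(2)[OF c(1)] rep_jet1(3)[OF c(1) U] U(2))
qed

lemma tproj_pts: "\<xi> \<in> tangent_set N \<Longrightarrow> tproj \<xi> \<in> pts N"
  using smooth_curve_pts[OF rep_smooth] by (simp add: tproj_eq_rep)

lemma tangent_eqI:
  assumes "\<xi> \<in> tangent_set N" "\<eta> \<in> tangent_set N" "tproj \<xi> = tproj \<eta>" "(U, \<phi>) \<in> atlas N" "tproj \<xi> \<in> U"
    and "snd (tchart G \<phi> \<xi>) = snd (tchart G \<phi> \<eta>)"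
  shows "\<xi> = \<eta>"
proof -
  have "jet1 N (rep \<xi>) = jet1 N (rep \<eta>)"
    by (rule jet1_eqI[OF rep_smooth[OF assms(1)] rep_smooth[OF assms(2)] _ assms(4)])
      (use assms(3,5,6) in \<open>simp_all add: tproj_eq_rep tchart_eq_rep\<close>)
  then show ?thesis using assms by (simp add: jet1_rep)
qed

lemma tchart_change:
  assumes \<xi>: "\<xi> \<in> tangent_set N" and U: "(U, \<phi>) \<in> atlas N" "tproj \<xi> \<in> U" and V: "(V, \<psi>) \<in> atlas N" "tproj \<xi> \<in> V"
    and D: "jet G G S D" "\<And>p. p \<in> U \<inter> V \<Longrightarrow> \<phi> p \<in> S \<and> D [] (\<phi> p) = \<psi> p"
  shows "tchart G \<psi> \<xi> = (D [] (\<phi> (tproj \<xi>)), D [snd (tchart G \<phi> \<xi>)] (\<phi> (tproj \<xi>)))"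
  using velocity_change[OF rep_smooth[OF \<xi>] U(1) _ V(1) _ D] D(2)[of "tproj \<xi>"] U V
  by (simp add: tchart_eq_rep tproj_eq_rep)

section \<open>Constant and rescaled curves\<close>

lemma has_dir_deriv_0:
  "has_dir_deriv G (\<lambda>t. c) t 1 0"
  using tends_const[OF G, of 0] by (simp add: has_dir_deriv_iff_tends[OF G])

lemma smooth_curve_const:
  assumes p: "p \<in> pts N"
  shows "smooth_curve N (\<lambda>t. p)"
  unfolding smooth_curve_def
proof (intro conjI ballI)
  show "continuous_map euclideanreal (topo N) (\<lambda>t. p)" using p by simp
  fix a assume "a \<in> atlas N"
  obtain U \<phi> where a: "a = (U, \<phi>)" by force
  have "\<exists>D::nat \<Rightarrow> real \<Rightarrow> 'g. (\<forall>t\<in>(\<lambda>t. p) -` U. D 0 t = \<phi> p) \<and>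
      (\<forall>n. \<forall>t\<in>(\<lambda>t. p) -` U. has_dir_deriv (model N) (D n) t 1 (D (Suc n) t))"
    by (intro exI[of _ "\<lambda>n t. if n = 0 then \<phi> p else 0"]) (auto simp: model has_dir_deriv_0)
  then show "case a of (U, \<phi>) \<Rightarrow> \<exists>D::nat \<Rightarrow> real \<Rightarrow> 'g. (\<forall>t\<in>(\<lambda>t. p) -` U. D 0 t = \<phi> p) \<and>
      (\<forall>n. \<forall>t\<in>(\<lambda>t. p) -` U. has_dir_deriv (model N) (D n) t 1 (D (Suc n) t))" by (simp add: a)
qed

lemma velocity_const: "velocity G (\<lambda>t. v) = 0"
  by (rule velocityI) (rule has_dir_deriv_0)

lemma has_dir_deriv_rescale:
  assumes d: "has_dir_deriv G f (a * t) 1 v" and a: "a \<noteq> 0"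
  shows "has_dir_deriv G (\<lambda>t. f (a * t)) t 1 (a *\<^sub>R v)"
proof -
  have "filterlim (\<lambda>s. a * s) (at 0) (at (0::real))"
    using a by (intro filterlim_atI) (auto intro!: tendsto_eq_intros simp: eventually_at_filter)
  from filterlim_compose[OF d[unfolded has_dir_deriv_iff_tends[OF G] tends_def] this]
  have "tends G (\<lambda>s. (f (a * t + a * s) - f (a * t)) /\<^sub>R (a * s)) v (at 0)" by (simp add: tends_def)
  from tends_scaleR[OF G this, of a] have "tends G (\<lambda>s. a *\<^sub>R ((f (a * t + a * s) - f (a * t)) /\<^sub>R (a * s))) (a *\<^sub>R v) (at 0)" .
  moreover have "(\<lambda>s. a *\<^sub>R ((f (a * t + a * s) - f (a * t)) /\<^sub>R (a * s))) = (\<lambda>s. (f (a * (t + s *\<^sub>R 1)) - f (a * t)) /\<^sub>R s)"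
    using a by (intro ext) (simp add: distrib_left)
  ultimately show ?thesis
    unfolding has_dir_deriv_iff_tends[OF G] by simp
qed

text \<open>The derivative of order n acquires the factor \<open>a ^ n\<close>. Rescaling time turns
  a short velocity into any multiple of it, which is how all velocities are reached later.\<close>

lemma smooth_curve_rescale:
  assumes c: "smooth_curve N c" and a: "a \<noteq> 0"
  shows "smooth_curve N (\<lambda>t. c (a * t))"
  unfolding smooth_curve_def
proof (intro conjI ballI)
  have "continuous_map euclideanreal euclideanreal (\<lambda>t. a * t)" by (simp add: continuous_on_mult_left continuous_on_id)
  from continuous_map_compose[OF this] c show "continuous_map euclideanreal (topo N) (\<lambda>t. c (a * t))"
    by (auto simp: smooth_curve_def o_def)
  fix b assume b: "b \<in> atlas N"
  obtain U \<phi> where U: "b = (U, \<phi>)" by force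
  obtain D :: "nat \<Rightarrow> real \<Rightarrow> 'g" where D: "\<And>t. t \<in> c -` U \<Longrightarrow> D 0 t = \<phi> (c t)"
    "\<And>n t. t \<in> c -` U \<Longrightarrow> has_dir_deriv G (D n) t 1 (D (Suc n) t)"
    by (rule obtain_smooth_curve[OF c b[unfolded U]]) blast
  have "\<exists>D::nat \<Rightarrow> real \<Rightarrow> 'g. (\<forall>t\<in>(\<lambda>t. c (a * t)) -` U. D 0 t = \<phi> (c (a * t))) \<and>
      (\<forall>n. \<forall>t\<in>(\<lambda>t. c (a * t)) -` U. has_dir_deriv (model N) (D n) t 1 (D (Suc n) t))"
  proof (intro exI[of _ "\<lambda>n t. a ^ n *\<^sub>R D n (a * t)"] conjI ballI allI)
    fix n t assume t: "t \<in> (\<lambda>t. c (a * t)) -` U"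
    have "has_dir_deriv G (\<lambda>t. D n (a * t)) t 1 (a *\<^sub>R D (Suc n) (a * t))"
      by (rule has_dir_deriv_rescale[OF D(2) a]) (use t in simp)
    then have "has_dir_deriv G (\<lambda>t. a ^ n *\<^sub>R D n (a * t)) t 1 (a ^ n *\<^sub>R a *\<^sub>R D (Suc n) (a * t))"
      unfolding has_dir_deriv_iff_tends[OF G]
      by (rule tends_cong[OF G tends_scaleR[OF G]]) (simp add: algebra_simps)
    then show "has_dir_deriv (model N) (\<lambda>t. a ^ n *\<^sub>R D n (a * t)) t 1 (a ^ Suc n *\<^sub>R D (Suc n) (a * t))"
      by (simp add: model mult.commute)
  qed (use D(1) in auto)
  then show "case b of (U, \<phi>) \<Rightarrow> \<exists>D::nat \<Rightarrow> real \<Rightarrow> 'g. (\<forall>t\<in>(\<lambda>t. c (a * t)) -` U. D 0 t = \<phi> (c (a * t))) \<and>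
      (\<forall>n. \<forall>t\<in>(\<lambda>t. c (a * t)) -` U. has_dir_deriv (model N) (D n) t 1 (D (Suc n) t))" by (simp add: U)
qed

lemma velocity_rescale:
  assumes c: "smooth_curve N c" and U: "(U, \<phi>) \<in> atlas N" "c 0 \<in> U" and a: "a \<noteq> 0"
  shows "velocity G (\<phi> \<circ> (\<lambda>t. c (a * t))) = a *\<^sub>R velocity G (\<phi> \<circ> c)"
  using has_dir_deriv_rescale[of "\<phi> \<circ> c" a 0, OF _ a] has_dir_deriv_velocity[OF c U]
  by (intro velocityI) (simp add: o_def)

section \<open>The tangent bundle as a space with charts\<close>

lemma tangent_set_generated:
  "topspace (topo (tangent_bundle N)) = tangent_set N"
  "(U, \<phi>) \<in> atlas N \<Longrightarrow> openin (topo (tangent_bundle N)) {\<xi> \<in> tangent_set N. tproj \<xi> \<in> U}"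
  "(U, \<phi>) \<in> atlas N \<Longrightarrow> openin (mtopology_of (max_metric G G)) W \<Longrightarrow>
    openin (topo (tangent_bundle N)) {\<xi> \<in> tangent_set N. tproj \<xi> \<in> U \<and> tchart G \<phi> \<xi> \<in> W}"
proof -
  let ?B = "{{\<xi>\<in>tangent_set N. tproj \<xi> \<in> U \<and> tchart (model N) \<phi> \<xi> \<in> W} | U \<phi> W.
          (U, \<phi>) \<in> atlas N \<and> openin (mtopology_of (max_metric (model N) (model N))) W}"
  have topo: "topo (tangent_bundle N) = topology_generated_by ?B" by (simp add: tangent_bundle_def)
  show 1: "openin (topo (tangent_bundle N)) {\<xi> \<in> tangent_set N. tproj \<xi> \<in> U \<and> tchart G \<phi> \<xi> \<in> W}"
    if "(U, \<phi>) \<in> atlas N" "openin (mtopology_of (max_metric G G)) W" for U \<phi> W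
    unfolding topo using that by (intro topology_generated_by_Basis) (auto simp: model)
  show 2: "openin (topo (tangent_bundle N)) {\<xi> \<in> tangent_set N. tproj \<xi> \<in> U}" if "(U, \<phi>) \<in> atlas N" for U \<phi>
    using 1[OF that openin_UNIV_std[OF standard_metric_max_metric[OF G G]]] by simp
  show "topspace (topo (tangent_bundle N)) = tangent_set N"
  proof
    show "topspace (topo (tangent_bundle N)) \<subseteq> tangent_set N"
      unfolding topo topology_generated_by_topspace by blast
    show "tangent_set N \<subseteq> topspace (topo (tangent_bundle N))"
    proof
      fix \<xi> assume \<xi>: "\<xi> \<in> tangent_set N"
      obtain U \<phi> where U: "(U, \<phi>) \<in> atlas N" "tproj \<xi> \<in> U" by (rule obtain_chart[OF tproj_pts[OF \<xi>]])
      then show "\<xi> \<in> topspace (topo (tangent_bundle N))" using openin_subset[OF 2[OF U(1)]] \<xi> by blast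
    qed
  qed
qed

text \<open>Tangent charts change by \<open>(x, h) \<mapsto> (D [] x, D [h] x)\<close>, which is of
  class MC on all of \<open>S \<times> UNIV\<close>, whichever velocities occur.\<close>

lemma charted_tangent_bundle: "charted (max_metric G G) (tangent_bundle N)"
proof
  show G2: "standard_metric (max_metric G G)" by (rule standard_metric_max_metric[OF G G])
  show "model (tangent_bundle N) = max_metric G G" by (simp add: tangent_bundle_def model)
  have atlas: "atlas (tangent_bundle N) = (\<lambda>(U, \<phi>). ({\<xi>\<in>tangent_set N. tproj \<xi> \<in> U}, tchart G \<phi>)) ` atlas N"
    by (simp add: tangent_bundle_def model)
  show "\<exists>(U, \<phi>)\<in>atlas (tangent_bundle N). p \<in> U" if "p \<in> pts (tangent_bundle N)" for p
  proof -
    have p: "p \<in> tangent_set N" using that by (simp add: tangent_set_generated)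
    obtain U \<phi> where U: "(U, \<phi>) \<in> atlas N" "tproj p \<in> U" by (rule obtain_chart[OF tproj_pts[OF p]])
    show ?thesis
      unfolding atlas using U p by (intro bexI[of _ "({\<xi>\<in>tangent_set N. tproj \<xi> \<in> U}, tchart G \<phi>)"]) (auto intro: rev_image_eqI)
  qed
  show "openin (topo (tangent_bundle N)) U" if "(U, \<phi>) \<in> atlas (tangent_bundle N)" for U \<phi>
    using that tangent_set_generated(2) unfolding atlas by auto
  fix TU \<Phi> TV \<Psi> assume "(TU, \<Phi>) \<in> atlas (tangent_bundle N)" "(TV, \<Psi>) \<in> atlas (tangent_bundle N)"
  then obtain U \<phi> V \<psi> where U: "(U, \<phi>) \<in> atlas N" "TU = {\<xi>\<in>tangent_set N. tproj \<xi> \<in> U}" "\<Phi> = tchart G \<phi>"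
    and V: "(V, \<psi>) \<in> atlas N" "TV = {\<xi>\<in>tangent_set N. tproj \<xi> \<in> V}" "\<Psi> = tchart G \<psi>"
    unfolding atlas by auto
  obtain S D where D: "jet G G S D" "\<And>p. p \<in> U \<inter> V \<Longrightarrow> \<phi> p \<in> S \<and> D [] (\<phi> p) = \<psi> p"
    using transition_jet[OF U(1) V(1)] by blast
  let ?T = "\<lambda>z. (D [] (fst z), (\<lambda>(x, h). D [h] x) z)"
  have O: "openin (mtopology_of (max_metric G G)) (S \<times> UNIV)"
    by (intro openin_Times_std G openin_UNIV_std jet_open[OF G G D(1)])
  have "MC_inf (max_metric G G) G (S \<times> UNIV) (\<lambda>z. D [] (fst z))"
    by (rule MC_inf_compose[OF G2 G G _ jet_imp_MC_inf[OF G G D(1)]], rule MC_inf_linear[OF G2 G linear_fst _ zero_le_one O])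
      (auto simp: nrm_max_metric)
  from MC_inf_imp_jet[OF G2 G2 MC_inf_Pair[OF G2 G G this MC_inf_derivative[OF G G D(1)]]]
  have J: "jet (max_metric G G) (max_metric G G) (S \<times> UNIV) (iter_dd (max_metric G G) ?T)" .
  have "\<forall>p\<in>TU \<inter> TV. \<Phi> p \<in> S \<times> UNIV \<and> iter_dd (max_metric G G) ?T [] (\<Phi> p) = \<Psi> p"
  proof
    fix p assume p: "p \<in> TU \<inter> TV"
    have "\<Psi> p = (D [] (\<phi> (tproj p)), D [snd (\<Phi> p)] (\<phi> (tproj p)))"
      unfolding U(3) V(3) by (rule tchart_change[OF _ U(1) _ V(1) _ D]) (use p U V in auto)
    moreover have "\<Phi> p = (\<phi> (tproj p), snd (\<Phi> p))" by (simp add: U(3) tchart_eq_rep)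
    ultimately show "\<Phi> p \<in> S \<times> UNIV \<and> iter_dd (max_metric G G) ?T [] (\<Phi> p) = \<Psi> p"
      using D(2)[of "tproj p"] p U V by (metis (no_types, lifting) IntE IntI SigmaI UNIV_I case_prod_conv fst_conv iter_dd.simps(1) mem_Collect_eq)
  qed
  with J show "\<exists>S D. jet (max_metric G G) (max_metric G G) S D \<and> (\<forall>p\<in>TU \<inter> TV. \<Phi> p \<in> S \<and> D [] (\<Phi> p) = \<Psi> p)"
    by blast
qed

end

section \<open>The double tangent bundle\<close>

locale frechet_manifold =
  fixes F :: "'f::real_vector metric" and M :: "('m, 'f) mfd"
  assumes F: "standard_metric F" and M: "bounded_frechet_manifold F M"
begin

lemma model_M: "model M = F"
  using M by (simp add: bounded_frechet_manifold_def)

lemma chart_props: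
  assumes "(U, \<phi>) \<in> atlas M"
  shows "openin (topo M) U" "openin (mtopology_of F) (\<phi> ` U)" "inj_on \<phi> U"
    "homeomorphic_map (subtopology (topo M) U) (subtopology (mtopology_of F) (\<phi> ` U)) \<phi>"
proof -
  have *: "\<forall>(U, \<phi>)\<in>atlas M. openin (topo M) U \<and> openin (mtopology_of F) (\<phi> ` U) \<and>
        homeomorphic_map (subtopology (topo M) U) (subtopology (mtopology_of F) (\<phi> ` U)) \<phi>"
    using M by (simp add: bounded_frechet_manifold_def)
  from bspec[OF this assms] show 1: "openin (topo M) U" "openin (mtopology_of F) (\<phi> ` U)"
    "homeomorphic_map (subtopology (topo M) U) (subtopology (mtopology_of F) (\<phi> ` U)) \<phi>" by auto
  have "topspace (subtopology (topo M) U) = U" using openin_subset[OF 1(1)] by auto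
  with homeomorphic_imp_injective_map[OF 1(3)] show "inj_on \<phi> U" by simp
qed

sublocale charted F M
proof
  show "standard_metric F" by (rule F)
  show "model M = F" by (rule model_M)
  have "(\<Union>(U, \<phi>)\<in>atlas M. U) = pts M" using M by (simp add: bounded_frechet_manifold_def)
  then show "\<exists>(U, \<phi>)\<in>atlas M. p \<in> U" if "p \<in> pts M" for p using that by auto
  show "openin (topo M) U" if "(U, \<phi>) \<in> atlas M" for U \<phi> by (rule chart_props[OF that])
  fix U \<phi> V \<psi> assume U: "(U, \<phi>) \<in> atlas M" and V: "(V, \<psi>) \<in> atlas M"
  have *: "\<forall>(U, \<phi>)\<in>atlas M. \<forall>(V, \<psi>)\<in>atlas M. MC_inf F F (\<phi> ` (U \<inter> V)) (\<psi> \<circ> inv_into U \<phi>)"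
    using M by (simp add: bounded_frechet_manifold_def)
  have "MC_inf F F (\<phi> ` (U \<inter> V)) (\<psi> \<circ> inv_into U \<phi>)" using bspec[OF bspec[OF * U, simplified] V] by simp
  from MC_inf_imp_jet[OF F F this]
  show "\<exists>S D. jet F F S D \<and> (\<forall>p\<in>U \<inter> V. \<phi> p \<in> S \<and> D [] (\<phi> p) = \<psi> p)"
    using inv_into_f_f[OF chart_props(3)[OF U]] by (intro exI conjI) auto
qed

abbreviation "TM \<equiv> tangent_bundle M"
abbreviation "FF \<equiv> max_metric F F"

sublocale tb: charted FF TM
  by (rule charted_tangent_bundle)

lemma atlas_TM: "atlas TM = (\<lambda>(U, \<phi>). ({\<xi>\<in>tangent_set M. tproj \<xi> \<in> U}, tchart F \<phi>)) ` atlas M"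
  by (simp add: tangent_bundle_def model_M)

lemma chart_TM: "(U, \<phi>) \<in> atlas M \<Longrightarrow> ({\<xi>\<in>tangent_set M. tproj \<xi> \<in> U}, tchart F \<phi>) \<in> atlas TM"
  unfolding atlas_TM by (rule rev_image_eqI) auto

lemma pts_TM: "pts TM = tangent_set M"
  by (rule tangent_set_generated)

lemma pts_TTM: "pts (tangent_bundle TM) = tangent_set TM"
  by (rule tb.tangent_set_generated)

lemma continuous_tproj: "continuous_map (topo TM) (topo M) tproj"
  unfolding continuous_map_def
proof (intro conjI allI impI)
  show "tproj \<in> topspace (topo TM) \<rightarrow> topspace (topo M)" using tproj_pts by (auto simp: pts_TM)
  fix B assume B: "openin (topo M) B"
  show "openin (topo TM) {\<xi> \<in> topspace (topo TM). tproj \<xi> \<in> B}"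
  proof (subst openin_subopen, intro ballI)
    fix \<xi> assume "\<xi> \<in> {\<xi> \<in> topspace (topo TM). tproj \<xi> \<in> B}"
    then have \<xi>: "\<xi> \<in> tangent_set M" "tproj \<xi> \<in> B" by (auto simp: pts_TM)
    obtain U \<phi> where U: "(U, \<phi>) \<in> atlas M" "tproj \<xi> \<in> U" by (rule obtain_chart[OF tproj_pts[OF \<xi>(1)]])
    note cp = chart_props[OF U(1)]
    have "openin (subtopology (topo M) U) (U \<inter> B)"
      using B by (simp add: openin_subtopology_Int2)
    then have "openin (subtopology (mtopology_of F) (\<phi> ` U)) (\<phi> ` (U \<inter> B))"
      using homeomorphic_imp_open_map[OF cp(4)] by (simp add: open_map_def)
    then have "openin (mtopology_of F) (\<phi> ` (U \<inter> B))" using cp(2) openin_trans_full by blast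
    then have O: "openin (mtopology_of FF) (\<phi> ` (U \<inter> B) \<times> UNIV)"
      by (intro openin_Times_std F openin_UNIV_std)
    let ?T = "{\<zeta> \<in> tangent_set M. tproj \<zeta> \<in> U \<and> tchart F \<phi> \<zeta> \<in> \<phi> ` (U \<inter> B) \<times> UNIV}"
    have sub: "?T \<subseteq> {\<xi> \<in> topspace (topo TM). tproj \<xi> \<in> B}"
    proof
      fix \<zeta> assume "\<zeta> \<in> ?T"
      then have \<zeta>: "\<zeta> \<in> tangent_set M" "tproj \<zeta> \<in> U" "\<phi> (tproj \<zeta>) \<in> \<phi> ` (U \<inter> B)" by (auto simp: tchart_eq_rep)
      then have "tproj \<zeta> \<in> B" using inj_onD[OF cp(3)] by blast
      then show "\<zeta> \<in> {\<xi> \<in> topspace (topo TM). tproj \<xi> \<in> B}" using \<zeta> by (simp add: pts_TM)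
    qed
    have mem: "\<xi> \<in> ?T" using \<xi> U by (simp add: tchart_eq_rep)
    show "\<exists>T. openin (topo TM) T \<and> \<xi> \<in> T \<and> T \<subseteq> {\<xi> \<in> topspace (topo TM). tproj \<xi> \<in> B}"
      by (intro exI[of _ ?T] conjI tangent_set_generated(3)[OF U(1) O] mem sub)
  qed
qed

text \<open>In charts the projection is the first component, so the first components of the
  successive derivatives of c serve for the projected curve.\<close>

lemma smooth_tproj:
  assumes c: "smooth_curve TM c"
  shows "smooth_curve M (tproj \<circ> c)"
  unfolding smooth_curve_def
proof (intro conjI ballI)
  show "continuous_map euclideanreal (topo M) (tproj \<circ> c)"
    by (rule continuous_map_compose[OF _ continuous_tproj]) (use c in \<open>simp add: smooth_curve_def\<close>)
  fix a assume a: "a \<in> atlas M"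
  obtain U \<phi> where U: "a = (U, \<phi>)" by force
  let ?TU = "{\<xi>\<in>tangent_set M. tproj \<xi> \<in> U}"
  obtain D where D: "\<And>t. t \<in> c -` ?TU \<Longrightarrow> D (0::nat) t = tchart F \<phi> (c t)"
    "\<And>n t. t \<in> c -` ?TU \<Longrightarrow> has_dir_deriv FF (D n) t 1 (D (Suc n) t)"
    by (rule tb.obtain_smooth_curve[OF c chart_TM[OF a[unfolded U]]]) blast
  have v: "c -` ?TU = (tproj \<circ> c) -` U" using tb.smooth_curve_pts[OF c] by (auto simp: pts_TM)
  have "\<exists>D::nat \<Rightarrow> real \<Rightarrow> 'f. (\<forall>t\<in>(tproj \<circ> c) -` U. D 0 t = \<phi> ((tproj \<circ> c) t)) \<and>
      (\<forall>n. \<forall>t\<in>(tproj \<circ> c) -` U. has_dir_deriv (model M) (D n) t 1 (D (Suc n) t))"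
    using D unfolding v
    by (intro exI[of _ "\<lambda>n t. fst (D n t)"]) (auto simp: model_M tchart_eq_rep has_dir_deriv_max_metric[OF F F])
  then show "case a of (U, \<phi>) \<Rightarrow> \<exists>D::nat \<Rightarrow> real \<Rightarrow> 'f. (\<forall>t\<in>(tproj \<circ> c) -` U. D 0 t = \<phi> ((tproj \<circ> c) t)) \<and>
      (\<forall>n. \<forall>t\<in>(tproj \<circ> c) -` U. has_dir_deriv (model M) (D n) t 1 (D (Suc n) t))" by (simp add: U)
qed

lemma tangent_map_tproj: "tangent_map M tproj \<Upsilon> = jet1 M (tproj \<circ> tb.rep \<Upsilon>)"
  by (simp add: tangent_map_def tb.rep_def)

lemma ttchart_eq_rep: "ttchart F \<phi> \<Upsilon> = (tchart F \<phi> (tproj \<Upsilon>), velocity FF (tchart F \<phi> \<circ> tb.rep \<Upsilon>))"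
  by (simp add: ttchart_def tb.tchart_eq_rep)

section \<open>Double tangent vectors in charts\<close>

context
  fixes \<Upsilon> assumes \<Upsilon>: "\<Upsilon> \<in> tangent_set TM"
begin

lemma pi2_eq: "pi2 M \<Upsilon> = tproj (tproj \<Upsilon>)"
  using smooth_tproj[OF tb.rep_smooth[OF \<Upsilon>]]
  by (simp add: pi2_def tangent_map_tproj tproj_jet1 tb.tproj_eq_rep)

lemma tproj_TT: "tproj \<Upsilon> \<in> tangent_set M"
  using tb.tproj_pts[OF \<Upsilon>] by (simp add: pts_TM)

lemma pi2_pts: "pi2 M \<Upsilon> \<in> pts M"
  using tproj_pts[OF tproj_TT] by (simp add: pi2_eq)

lemma fst_ttchart: "fst (fst (ttchart F \<phi> \<Upsilon>)) = \<phi> (pi2 M \<Upsilon>)"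
  by (simp add: ttchart_eq_rep tchart_eq_rep pi2_eq)

lemma tends_ttchart:
  assumes U: "(U, \<phi>) \<in> atlas M" "pi2 M \<Upsilon> \<in> U"
  shows "tends FF (\<lambda>t. (tchart F \<phi> (tb.rep \<Upsilon> t) - tchart F \<phi> (tproj \<Upsilon>)) /\<^sub>R t) (snd (ttchart F \<phi> \<Upsilon>)) (at 0)"
  using tb.tends_velocity[OF tb.rep_smooth[OF \<Upsilon>] chart_TM[OF U(1)]] U(2) tproj_TT
  by (simp add: ttchart_eq_rep tb.tproj_eq_rep pi2_eq)

lemma ttchart_velocity:
  assumes U: "(U, \<phi>) \<in> atlas M" "pi2 M \<Upsilon> \<in> U"
  shows "fst (snd (ttchart F \<phi> \<Upsilon>)) = velocity F (\<phi> \<circ> (tproj \<circ> tb.rep \<Upsilon>))"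
proof (rule velocityI[symmetric])
  show "has_dir_deriv F (\<phi> \<circ> (tproj \<circ> tb.rep \<Upsilon>)) 0 1 (fst (snd (ttchart F \<phi> \<Upsilon>)))"
    using tends_ttchart[OF U]
    by (simp add: has_dir_deriv_iff_tends[OF F] tends_max_metric[OF F F] o_def tchart_eq_rep tb.tproj_eq_rep)
qed

text \<open>Along a curve in TM the fiber coordinate transforms by \<open>D [g] f\<close>. Its
  derivative has one term for the moving base point, the inhomogeneous \<open>D [h, g] f\<close>,
  and one for the moving fiber coordinate, \<open>D [k] f\<close>.\<close>

lemma ttchart_change:
  assumes U: "(U, \<phi>) \<in> atlas M" "pi2 M \<Upsilon> \<in> U" and V: "(V, \<psi>) \<in> atlas M" "pi2 M \<Upsilon> \<in> V"
    and D: "jet F F S D" "\<And>p. p \<in> U \<inter> V \<Longrightarrow> \<phi> p \<in> S \<and> D [] (\<phi> p) = \<psi> p"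
    and tt: "ttchart F \<phi> \<Upsilon> = ((f, g), (h, k))"
  shows "ttchart F \<psi> \<Upsilon> = ((D [] f, D [g] f), (D [h] f, D [h, g] f + D [k] f))"
proof -
  let ?c = "tb.rep \<Upsilon>"
  have f: "f = \<phi> (pi2 M \<Upsilon>)" using fst_ttchart[of \<phi>] tt by simp
  have S: "f \<in> S" using D(2) U V f by simp
  have tp: "tchart F \<phi> (tproj \<Upsilon>) = (f, g)" using tt by (simp add: ttchart_eq_rep)
  have ch: "tchart F \<psi> \<xi> = (D [] (fst (tchart F \<phi> \<xi>)), D [snd (tchart F \<phi> \<xi>)] (fst (tchart F \<phi> \<xi>)))"
    if "\<xi> \<in> tangent_set M" "tproj \<xi> \<in> U" "tproj \<xi> \<in> V" for \<xi>
    using tchart_change[OF that(1) U(1) that(2) V(1) that(3) D] by (simp add: tchart_eq_rep)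
  have tp': "tchart F \<psi> (tproj \<Upsilon>) = (D [] f, D [g] f)"
    using ch[OF tproj_TT] U V tp by (simp add: pi2_eq)
  have t1: "tends F (\<lambda>t. (fst (tchart F \<phi> (?c t)) - f) /\<^sub>R t) h (at 0)"
    and t2: "tends F (\<lambda>t. (snd (tchart F \<phi> (?c t)) - g) /\<^sub>R t) k (at 0)"
    using tends_ttchart[OF U] by (simp_all add: tt tp tends_max_metric[OF F F])
  have 1: "tends F (\<lambda>t. (D [] (fst (tchart F \<phi> (?c t))) - D [] f) /\<^sub>R t) (D [h] f) (at 0)"
    by (rule jet_chain_rule[OF F F D(1) S t1])
  have 2: "tends F (\<lambda>t. (D ([] @ map (\<lambda>i. snd (tchart F \<phi> (?c t))) [()]) (fst (tchart F \<phi> (?c t))) - D ([] @ map (\<lambda>i. g) [()]) f) /\<^sub>R t)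
     (D (h # [] @ map (\<lambda>i. g) [()]) f + (\<Sum>L\<leftarrow>repl (\<lambda>i. g) (\<lambda>i. k) [()]. D ([] @ L) f)) (at 0)"
    by (rule jet_curve_deriv[OF F F D(1) S t1 t2])
  have "velocity FF (tchart F \<psi> \<circ> ?c) = (D [h] f, D [h, g] f + D [k] f)"
  proof (rule tb.velocityI)
    have "tends FF (\<lambda>t. ((D [] (fst (tchart F \<phi> (?c t))), D [snd (tchart F \<phi> (?c t))] (fst (tchart F \<phi> (?c t)))) - (D [] f, D [g] f)) /\<^sub>R t)
       (D [h] f, D [h, g] f + D [k] f) (at 0)"
      using 1 2 by (simp add: tends_max_metric[OF F F])
    moreover have "\<forall>\<^sub>F t in at 0. ?c t \<in> {\<xi>\<in>tangent_set M. tproj \<xi> \<in> U} \<inter> {\<xi>\<in>tangent_set M. tproj \<xi> \<in> V}"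
      using tb.curve_eventually[OF tb.rep_smooth[OF \<Upsilon>] openin_Int[OF tb.chart_open[OF chart_TM[OF U(1)]] tb.chart_open[OF chart_TM[OF V(1)]]], of 0]
        U(2) V(2) tproj_TT by (simp add: pi2_eq tb.tproj_eq_rep)
    ultimately have "tends FF (\<lambda>t. (tchart F \<psi> (?c t) - tchart F \<psi> (?c 0)) /\<^sub>R t) (D [h] f, D [h, g] f + D [k] f) (at 0)"
      by (rule tends_cong[OF tb.G, OF _ eventually_mono]) (use tp' in \<open>auto simp: ch tb.tproj_eq_rep\<close>)
    then show "has_dir_deriv FF (tchart F \<psi> \<circ> ?c) 0 1 (D [h] f, D [h, g] f + D [k] f)"
      by (simp add: has_dir_deriv_iff_tends[OF tb.G] o_def)
  qed
  then show ?thesis by (simp add: ttchart_eq_rep tp')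
qed

end

section \<open>The second order tangent bundle in charts\<close>

lemma T2_set_TT: "\<Upsilon> \<in> T2_set M \<Longrightarrow> \<Upsilon> \<in> tangent_set TM"
  by (simp add: T2_set_def pts_TTM)

text \<open>On T2M the vector \<open>tproj \<Upsilon>\<close> is the jet of the projected curve: its
  fiber coordinate g is the velocity of that curve, and so is h by
  \<open>ttchart_velocity\<close>.\<close>

lemma T2_set_ttchart:
  assumes \<Upsilon>: "\<Upsilon> \<in> T2_set M" and U: "(U, \<phi>) \<in> atlas M" "pi2 M \<Upsilon> \<in> U"
  shows "\<exists>g k. ttchart F \<phi> \<Upsilon> = ((\<phi> (pi2 M \<Upsilon>), g), (g, k))"
proof -
  note TT = T2_set_TT[OF \<Upsilon>]
  have "tproj \<Upsilon> = jet1 M (tproj \<circ> tb.rep \<Upsilon>)" using \<Upsilon> by (simp add: T2_set_def tangent_map_tproj)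
  moreover have "tproj (tb.rep \<Upsilon> 0) \<in> U" using U(2) by (simp add: pi2_eq[OF TT] tb.tproj_eq_rep)
  ultimately have "snd (fst (ttchart F \<phi> \<Upsilon>)) = velocity F (\<phi> \<circ> (tproj \<circ> tb.rep \<Upsilon>))"
    using tchart_jet1[OF smooth_tproj[OF tb.rep_smooth[OF TT]] U(1)] by (simp add: ttchart_eq_rep)
  with ttchart_velocity[OF TT U] fst_ttchart[OF TT, of \<phi>] show ?thesis
    by (cases "ttchart F \<phi> \<Upsilon>") auto
qed

definition T2_chart :: "('m \<Rightarrow> 'f) \<Rightarrow> 'm tan tan \<Rightarrow> 'f \<times> 'f \<times> 'f" where
  "T2_chart \<phi> \<Upsilon> = (case ttchart F \<phi> \<Upsilon> of ((f, g), (h, k)) \<Rightarrow> (f, g, k))"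

definition T2_over :: "'m set \<Rightarrow> 'm tan tan set" where
  "T2_over U = {\<Upsilon>\<in>T2_set M. pi2 M \<Upsilon> \<in> U}"

text \<open>The witness is the constant curve in TM at the zero vector over p. It makes the points
  at which \<tau> is evaluated available in each chart.\<close>

lemma zero_in_T2_chart:
  assumes U: "(U, \<phi>) \<in> atlas M" "p \<in> U"
  shows "(\<phi> p, 0, 0) \<in> T2_chart \<phi> ` T2_over U"
proof -
  have p: "p \<in> pts M" using openin_subset[OF chart_open[OF U(1)]] U(2) by blast
  define \<xi> where "\<xi> = jet1 M (\<lambda>t. p)"
  define \<Upsilon> where "\<Upsilon> = jet1 TM (\<lambda>t. \<xi>)"
  note cp = smooth_curve_const[OF p]
  have \<xi>: "\<xi> \<in> tangent_set M" "tproj \<xi> = p" "tchart F \<phi> \<xi> = (\<phi> p, 0)"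
    using tchart_jet1[OF cp U(1)] U(2)
    by (simp_all add: \<xi>_def jet1_in_tangent_set[OF cp] tproj_jet1[OF cp] velocity_const o_def)
  have c\<xi>: "smooth_curve TM (\<lambda>t. \<xi>)" by (rule tb.smooth_curve_const) (simp add: pts_TM \<xi>)
  have \<Upsilon>: "\<Upsilon> \<in> tangent_set TM" "tproj \<Upsilon> = \<xi>"
    by (simp_all add: \<Upsilon>_def tb.jet1_in_tangent_set[OF c\<xi>] tb.tproj_jet1[OF c\<xi>])
  have pi: "pi2 M \<Upsilon> = p" by (simp add: pi2_eq[OF \<Upsilon>(1)] \<Upsilon> \<xi>)
  have tt: "ttchart F \<phi> \<Upsilon> = ((\<phi> p, 0), 0)"
    using tb.tchart_jet1[OF c\<xi> chart_TM[OF U(1)]] U(2) \<xi>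
    by (simp add: ttchart_def \<Upsilon>_def tb.velocity_const o_def)
  have "\<Upsilon> \<in> T2_set M"
  proof -
    note sm = smooth_tproj[OF tb.rep_smooth[OF \<Upsilon>(1)]]
    have "jet1 M (tproj \<circ> tb.rep \<Upsilon>) = jet1 M (\<lambda>t. p)"
    proof (rule jet1_eqI[OF sm cp _ U(1)])
      have 0: "tproj (tb.rep \<Upsilon> 0) = p" using \<Upsilon>(2) \<xi>(2) by (simp add: tb.tproj_eq_rep)
      then show "(tproj \<circ> tb.rep \<Upsilon>) 0 = p" "(tproj \<circ> tb.rep \<Upsilon>) 0 \<in> U" using U(2) by simp_all
      show "velocity F (\<phi> \<circ> (tproj \<circ> tb.rep \<Upsilon>)) = velocity F (\<phi> \<circ> (\<lambda>t. p))"
        using ttchart_velocity[OF \<Upsilon>(1) U(1)] U(2) by (simp add: pi tt velocity_const o_def)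
    qed
    then show ?thesis using \<Upsilon> by (simp add: T2_set_def pts_TTM tangent_map_tproj \<xi>_def)
  qed
  then show ?thesis
    using pi U(2) by (intro image_eqI[of _ _ \<Upsilon>]) (simp_all add: T2_chart_def tt T2_over_def zero_prod_def)
qed

section \<open>The Whitney sum\<close>

definition whitney_chart :: "('m \<Rightarrow> 'f) \<Rightarrow> 'm tan \<times> 'm tan \<Rightarrow> 'f \<times> 'f \<times> 'f" where
  "whitney_chart \<phi> = (\<lambda>(\<xi>, \<eta>). (\<phi> (tproj \<xi>), tvec M \<phi> \<xi>, tvec M \<phi> \<eta>))"

definition whitney_over :: "'m set \<Rightarrow> ('m tan \<times> 'm tan) set" where
  "whitney_over U = {\<omega>\<in>whitney_set M. whitney_proj \<omega> \<in> U}"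

lemma tvec_eq: "tvec M \<phi> \<xi> = snd (tchart F \<phi> \<xi>)"
  by (simp add: tvec_def model_M)

lemma inj_whitney_chart:
  assumes U: "(U, \<phi>) \<in> atlas M"
  shows "inj_on (whitney_chart \<phi>) (whitney_over U)"
proof (rule inj_onI)
  fix \<omega> \<omega>' assume *: "\<omega> \<in> whitney_over U" "\<omega>' \<in> whitney_over U" "whitney_chart \<phi> \<omega> = whitney_chart \<phi> \<omega>'"
  obtain \<xi> \<eta> \<xi>' \<eta>' where w: "\<omega> = (\<xi>, \<eta>)" "\<omega>' = (\<xi>', \<eta>')" by (cases \<omega>, cases \<omega>')
  have m: "\<xi> \<in> tangent_set M" "\<eta> \<in> tangent_set M" "\<xi>' \<in> tangent_set M" "\<eta>' \<in> tangent_set M"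
    "tproj \<eta> = tproj \<xi>" "tproj \<eta>' = tproj \<xi>'" "tproj \<xi> \<in> U" "tproj \<xi>' \<in> U"
    using * by (auto simp: w whitney_over_def whitney_set_def whitney_proj_def)
  have eq: "\<phi> (tproj \<xi>) = \<phi> (tproj \<xi>')" "snd (tchart F \<phi> \<xi>) = snd (tchart F \<phi> \<xi>')" "snd (tchart F \<phi> \<eta>) = snd (tchart F \<phi> \<eta>')"
    using *(3) by (auto simp: w whitney_chart_def tvec_eq)
  have p: "tproj \<xi> = tproj \<xi>'" using inj_onD[OF chart_props(3)[OF U] eq(1)] m by blast
  have "\<xi> = \<xi>'" by (rule tangent_eqI[OF m(1,3) p U m(7) eq(2)])
  moreover have "\<eta> = \<eta>'" by (rule tangent_eqI[OF m(2,4) _ U _ eq(3)]) (use m p in auto)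
  ultimately show "\<omega> = \<omega>'" by (simp add: w)
qed

lemma whitney_chart_change:
  assumes \<omega>: "\<omega> \<in> whitney_set M" and U: "(U, \<phi>) \<in> atlas M" "whitney_proj \<omega> \<in> U"
    and V: "(V, \<psi>) \<in> atlas M" "whitney_proj \<omega> \<in> V"
    and D: "jet F F S D" "\<And>p. p \<in> U \<inter> V \<Longrightarrow> \<phi> p \<in> S \<and> D [] (\<phi> p) = \<psi> p"
    and eq: "whitney_chart \<phi> \<omega> = (f, a, b)"
  shows "whitney_chart \<psi> \<omega> = (D [] f, D [a] f, D [b] f)"
proof -
  obtain \<xi> \<eta> where w: "\<omega> = (\<xi>, \<eta>)" by force
  have m: "\<xi> \<in> tangent_set M" "\<eta> \<in> tangent_set M" "tproj \<eta> = tproj \<xi>" "tproj \<xi> \<in> U" "tproj \<xi> \<in> V"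
    using \<omega> U V by (auto simp: w whitney_set_def whitney_proj_def)
  have "snd (tchart F \<psi> \<eta>) = D [snd (tchart F \<phi> \<eta>)] (\<phi> (tproj \<xi>))"
    using tchart_change[OF m(2) U(1) _ V(1) _ D] m by simp
  moreover have "tchart F \<psi> \<xi> = (D [] (\<phi> (tproj \<xi>)), D [snd (tchart F \<phi> \<xi>)] (\<phi> (tproj \<xi>)))"
    by (rule tchart_change[OF m(1) U(1) m(4) V(1) m(5) D])
  ultimately show ?thesis
    using eq D(2)[of "tproj \<xi>"] m by (auto simp: w whitney_chart_def tvec_eq)
qed

lemma pts_whitney_sum: "pts (whitney_sum M) = whitney_set M"
  by (auto simp: whitney_sum_def pts_TM whitney_set_def)

lemma pts_T2: "pts (T2_bundle M) = T2_set M"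
  by (auto simp: T2_bundle_def T2_set_def)

lemma atlas_whitney_sum: "atlas (whitney_sum M) = (\<lambda>(U, \<phi>). (whitney_over U, whitney_chart \<phi>)) ` atlas M"
  by (simp add: whitney_sum_def whitney_over_def whitney_chart_def)

lemma atlas_T2: "atlas (T2_bundle M) = (\<lambda>(U, \<phi>). (T2_over U, T2_chart \<phi>)) ` atlas M"
  by (simp add: T2_bundle_def T2_over_def T2_chart_def[abs_def] model_M)

end

section \<open>The connection of a splitting\<close>

text \<open>Injectivity of the T2M charts is assumed here; it is finally supplied by the manifold
  structure that \<open>MC_vector_bundle\<close> demands of \<open>T2_bundle M\<close>, just as
  \<Gamma> comes from \<open>MC_diffeo\<close>.\<close>

locale splitting = frechet_manifold F M
  for F :: "'f::real_vector metric" and M :: "('m, 'f) mfd" +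
  fixes \<Phi> :: "'m tan tan \<Rightarrow> 'm tan \<times> 'm tan" and \<Gamma> :: "'m tan \<times> 'm tan \<Rightarrow> 'm tan tan"
  assumes \<Phi>: "MC_map (T2_bundle M) (whitney_sum M) \<Phi>" and \<Gamma>: "MC_map (whitney_sum M) (T2_bundle M) \<Gamma>"
    and \<Gamma>\<Phi>: "\<Upsilon> \<in> T2_set M \<Longrightarrow> \<Gamma> (\<Phi> \<Upsilon>) = \<Upsilon>" and \<Phi>\<Gamma>: "\<omega> \<in> whitney_set M \<Longrightarrow> \<Phi> (\<Gamma> \<omega>) = \<omega>"
    and proj: "\<Upsilon> \<in> T2_set M \<Longrightarrow> whitney_proj (\<Phi> \<Upsilon>) = pi2 M \<Upsilon>"
    and inj_T2_chart: "(U, \<phi>) \<in> atlas M \<Longrightarrow> inj_on (T2_chart \<phi>) (T2_over U)"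
begin

abbreviation "F3 \<equiv> max_metric F FF"

lemma F3: "standard_metric F3"
  by (rule standard_metric_max_metric[OF F tb.G])

lemma \<Phi>_set: "\<Upsilon> \<in> T2_set M \<Longrightarrow> \<Phi> \<Upsilon> \<in> whitney_set M"
  using \<Phi> by (auto simp: MC_map_def continuous_map_def pts_T2 pts_whitney_sum)

lemma \<Gamma>_set: "\<omega> \<in> whitney_set M \<Longrightarrow> \<Gamma> \<omega> \<in> T2_set M"
  using \<Gamma> by (auto simp: MC_map_def continuous_map_def pts_T2 pts_whitney_sum)

lemma \<Phi>_over: "\<Upsilon> \<in> T2_over U \<Longrightarrow> \<Phi> \<Upsilon> \<in> whitney_over U"
  by (simp add: T2_over_def whitney_over_def \<Phi>_set proj)

lemma \<Gamma>_over: "\<omega> \<in> whitney_over U \<Longrightarrow> \<Gamma> \<omega> \<in> T2_over U"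
  using proj[OF \<Gamma>_set, of \<omega>] by (simp add: T2_over_def whitney_over_def \<Gamma>_set \<Phi>\<Gamma>)

definition local_\<Phi> :: "'m set \<Rightarrow> ('m \<Rightarrow> 'f) \<Rightarrow> 'f \<times> 'f \<times> 'f \<Rightarrow> 'f \<times> 'f \<times> 'f" where
  "local_\<Phi> U \<phi> = whitney_chart \<phi> \<circ> \<Phi> \<circ> inv_into (T2_over U) (T2_chart \<phi>)"

definition local_\<Gamma> :: "'m set \<Rightarrow> ('m \<Rightarrow> 'f) \<Rightarrow> 'f \<times> 'f \<times> 'f \<Rightarrow> 'f \<times> 'f \<times> 'f" where
  "local_\<Gamma> U \<phi> = T2_chart \<phi> \<circ> \<Gamma> \<circ> inv_into (whitney_over U) (whitney_chart \<phi>)"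

lemma local_\<Phi>: "(U, \<phi>) \<in> atlas M \<Longrightarrow> \<Upsilon> \<in> T2_over U \<Longrightarrow> local_\<Phi> U \<phi> (T2_chart \<phi> \<Upsilon>) = whitney_chart \<phi> (\<Phi> \<Upsilon>)"
  by (simp add: local_\<Phi>_def inv_into_f_f[OF inj_T2_chart])

lemma local_\<Gamma>: "(U, \<phi>) \<in> atlas M \<Longrightarrow> \<omega> \<in> whitney_over U \<Longrightarrow> local_\<Gamma> U \<phi> (whitney_chart \<phi> \<omega>) = T2_chart \<phi> (\<Gamma> \<omega>)"
  by (simp add: local_\<Gamma>_def inv_into_f_f[OF inj_whitney_chart])

lemma model_T2: "model (T2_bundle M) = F3" "model (whitney_sum M) = F3"
  by (simp_all add: T2_bundle_def whitney_sum_def model_M)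

lemma local_\<Phi>_MC_inf:
  assumes U: "(U, \<phi>) \<in> atlas M"
  shows "MC_inf F3 F3 (T2_chart \<phi> ` T2_over U) (local_\<Phi> U \<phi>)"
proof -
  have a: "(T2_over U, T2_chart \<phi>) \<in> atlas (T2_bundle M)" "(whitney_over U, whitney_chart \<phi>) \<in> atlas (whitney_sum M)"
    unfolding atlas_T2 atlas_whitney_sum using U by (auto intro: rev_image_eqI)
  have "\<forall>(U, \<phi>)\<in>atlas (T2_bundle M). \<forall>(V, \<psi>)\<in>atlas (whitney_sum M).
        MC_inf (model (T2_bundle M)) (model (whitney_sum M)) (\<phi> ` (U \<inter> \<Phi> -` V)) (\<psi> \<circ> \<Phi> \<circ> inv_into U \<phi>)"
    using \<Phi> by (simp add: MC_map_def)
  from bspec[OF bspec[OF this a(1), simplified] a(2)]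
  have "MC_inf F3 F3 (T2_chart \<phi> ` (T2_over U \<inter> \<Phi> -` whitney_over U)) (local_\<Phi> U \<phi>)"
    by (simp add: model_T2 local_\<Phi>_def)
  \<comment> \<open>\<Phi> covers the identity of M, so its local form is defined on the whole
    chart.\<close>
  moreover have "T2_over U \<inter> \<Phi> -` whitney_over U = T2_over U" using \<Phi>_over by auto
  ultimately show ?thesis by simp
qed

lemma local_\<Gamma>_MC_inf:
  assumes U: "(U, \<phi>) \<in> atlas M"
  shows "MC_inf F3 F3 (whitney_chart \<phi> ` whitney_over U) (local_\<Gamma> U \<phi>)"
proof -
  have a: "(T2_over U, T2_chart \<phi>) \<in> atlas (T2_bundle M)" "(whitney_over U, whitney_chart \<phi>) \<in> atlas (whitney_sum M)"
    unfolding atlas_T2 atlas_whitney_sum using U by (auto intro: rev_image_eqI)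
  have "\<forall>(U, \<phi>)\<in>atlas (whitney_sum M). \<forall>(V, \<psi>)\<in>atlas (T2_bundle M).
        MC_inf (model (whitney_sum M)) (model (T2_bundle M)) (\<phi> ` (U \<inter> \<Gamma> -` V)) (\<psi> \<circ> \<Gamma> \<circ> inv_into U \<phi>)"
    using \<Gamma> by (simp add: MC_map_def)
  from bspec[OF bspec[OF this a(2), simplified] a(1)]
  have "MC_inf F3 F3 (whitney_chart \<phi> ` (whitney_over U \<inter> \<Gamma> -` T2_over U)) (local_\<Gamma> U \<phi>)"
    by (simp add: model_T2 local_\<Gamma>_def)
  moreover have "whitney_over U \<inter> \<Gamma> -` T2_over U = whitney_over U" using \<Gamma>_over by auto
  ultimately show ?thesis by simp
qed

abbreviation "jet_\<Phi> U \<phi> \<equiv> iter_dd F3 (local_\<Phi> U \<phi>)"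
abbreviation "jet_\<Gamma> U \<phi> \<equiv> iter_dd F3 (local_\<Gamma> U \<phi>)"

lemma fst_T2_chart: "\<Upsilon> \<in> T2_set M \<Longrightarrow> fst (T2_chart \<phi> \<Upsilon>) = \<phi> (pi2 M \<Upsilon>)"
  using fst_ttchart[OF T2_set_TT, of \<Upsilon> \<phi>] by (auto simp: T2_chart_def split: prod.split)

lemma fst_whitney_chart: "fst (whitney_chart \<phi> \<omega>) = \<phi> (whitney_proj \<omega>)"
  by (simp add: whitney_chart_def whitney_proj_def split: prod.split)

lemma fiber_diffeo_charts:
  assumes U: "(U, \<phi>) \<in> atlas M"
  shows "fiber_diffeo F (T2_chart \<phi> ` T2_over U) (whitney_chart \<phi> ` whitney_over U) (jet_\<Phi> U \<phi>) (jet_\<Gamma> U \<phi>)"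
proof
  show "standard_metric F" by (rule F)
  show "jet F3 F3 (T2_chart \<phi> ` T2_over U) (jet_\<Phi> U \<phi>)" by (rule MC_inf_imp_jet[OF F3 F3 local_\<Phi>_MC_inf[OF U]])
  show "jet F3 F3 (whitney_chart \<phi> ` whitney_over U) (jet_\<Gamma> U \<phi>)" by (rule MC_inf_imp_jet[OF F3 F3 local_\<Gamma>_MC_inf[OF U]])
  have T2: "\<Upsilon> \<in> T2_set M" if "\<Upsilon> \<in> T2_over U" for \<Upsilon> using that by (simp add: T2_over_def)
  have W: "\<omega> \<in> whitney_set M" if "\<omega> \<in> whitney_over U" for \<omega> using that by (simp add: whitney_over_def)
  fix w
  {
    assume "w \<in> T2_chart \<phi> ` T2_over U"
    then obtain \<Upsilon> where \<Upsilon>: "\<Upsilon> \<in> T2_over U" "w = T2_chart \<phi> \<Upsilon>" by blast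
    show "jet_\<Phi> U \<phi> [] w \<in> whitney_chart \<phi> ` whitney_over U"
      using \<Phi>_over[OF \<Upsilon>(1)] by (simp add: \<Upsilon>(2) local_\<Phi>[OF U \<Upsilon>(1)])
    show "jet_\<Gamma> U \<phi> [] (jet_\<Phi> U \<phi> [] w) = w"
      by (simp add: \<Upsilon>(2) local_\<Phi>[OF U \<Upsilon>(1)] local_\<Gamma>[OF U \<Phi>_over[OF \<Upsilon>(1)]] \<Gamma>\<Phi>[OF T2[OF \<Upsilon>(1)]])
    show "fst (jet_\<Phi> U \<phi> [] w) = fst w"
      by (simp add: \<Upsilon>(2) local_\<Phi>[OF U \<Upsilon>(1)] fst_whitney_chart fst_T2_chart[OF T2[OF \<Upsilon>(1)]] proj[OF T2[OF \<Upsilon>(1)]])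
  }
  {
    assume "w \<in> whitney_chart \<phi> ` whitney_over U"
    then obtain \<omega> where \<omega>: "\<omega> \<in> whitney_over U" "w = whitney_chart \<phi> \<omega>" by blast
    show "jet_\<Gamma> U \<phi> [] w \<in> T2_chart \<phi> ` T2_over U"
      using \<Gamma>_over[OF \<omega>(1)] by (simp add: \<omega>(2) local_\<Gamma>[OF U \<omega>(1)])
    show "jet_\<Phi> U \<phi> [] (jet_\<Gamma> U \<phi> [] w) = w"
      by (simp add: \<omega>(2) local_\<Gamma>[OF U \<omega>(1)] local_\<Phi>[OF U \<Gamma>_over[OF \<omega>(1)]] \<Phi>\<Gamma>[OF W[OF \<omega>(1)]])
  }
qed

definition \<tau> :: "'m set \<times> ('m \<Rightarrow> 'f) \<Rightarrow> 'f \<Rightarrow> 'f \<Rightarrow> 'f \<Rightarrow> 'f" where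
  "\<tau> = (\<lambda>(U, \<phi>). fiber_diffeo.\<tau> (jet_\<Phi> U \<phi>) (jet_\<Gamma> U \<phi>))"

text \<open>The compatibility demanded by \<open>fiber_diffeo_transformation\<close> holds because
  the same point \<Upsilon> and the same image \<Phi> \<Upsilon> are read in two charts: T2M
  contributes the quadratic term, while \<open>TM \<oplus> TM\<close> changes linearly on
  fibers.\<close>

lemma \<tau>_change:
  assumes U: "(U, \<phi>) \<in> atlas M" "p \<in> U" and V: "(V, \<psi>) \<in> atlas M" "p \<in> V"
    and D: "jet F F S D" "\<And>p. p \<in> U \<inter> V \<Longrightarrow> \<phi> p \<in> S \<and> D [] (\<phi> p) = \<psi> p"
  shows "\<tau> (V, \<psi>) (D [] (\<phi> p)) (D [g] (\<phi> p)) (D [h] (\<phi> p)) + D [h, g] (\<phi> p) = D [\<tau> (U, \<phi>) (\<phi> p) g h] (\<phi> p)"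
  unfolding \<tau>_def case_prod_conv
proof (rule fiber_diffeo_transformation[OF fiber_diffeo_charts[OF U(1)] fiber_diffeo_charts[OF V(1)] D(1)])
  show "\<phi> p \<in> S" using D(2) U V by blast
  show "(\<phi> p, 0, 0) \<in> T2_chart \<phi> ` T2_over U" by (rule zero_in_T2_chart[OF U])
  fix g k assume "(\<phi> p, g, k) \<in> T2_chart \<phi> ` T2_over U"
  then obtain \<Upsilon> where \<Upsilon>: "\<Upsilon> \<in> T2_over U" "T2_chart \<phi> \<Upsilon> = (\<phi> p, g, k)" by force
  then have T2: "\<Upsilon> \<in> T2_set M" "pi2 M \<Upsilon> \<in> U" by (auto simp: T2_over_def)
  have "\<phi> (pi2 M \<Upsilon>) = \<phi> p" using fst_T2_chart[OF T2(1), of \<phi>] \<Upsilon>(2) by simp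
  then have pi: "pi2 M \<Upsilon> = p" using inj_onD[OF chart_props(3)[OF U(1)]] T2(2) U(2) by blast
  have \<Upsilon>V: "\<Upsilon> \<in> T2_over V" using T2 V pi by (simp add: T2_over_def)
  \<comment> \<open>On T2M the entries g and h coincide, which turns the term
    \<open>D [h, g]\<close> of \<open>ttchart_change\<close> into the quadratic
    \<open>D [g, g]\<close>.\<close>
  obtain g' k' where "ttchart F \<phi> \<Upsilon> = ((\<phi> p, g'), (g', k'))" using T2_set_ttchart[OF T2(1) U(1)] U(2) pi by auto
  with \<Upsilon>(2) have tt: "ttchart F \<phi> \<Upsilon> = ((\<phi> p, g), (g, k))" by (simp add: T2_chart_def)
  have "ttchart F \<psi> \<Upsilon> = ((D [] (\<phi> p), D [g] (\<phi> p)), (D [g] (\<phi> p), D [g, g] (\<phi> p) + D [k] (\<phi> p)))"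
    by (rule ttchart_change[OF T2_set_TT[OF T2(1)] U(1) _ V(1) _ D tt]) (use pi U V in auto)
  then have ch: "T2_chart \<psi> \<Upsilon> = (D [] (\<phi> p), D [g] (\<phi> p), D [g, g] (\<phi> p) + D [k] (\<phi> p))" by (simp add: T2_chart_def)
  obtain f a b where w: "whitney_chart \<phi> (\<Phi> \<Upsilon>) = (f, a, b)" by (cases "whitney_chart \<phi> (\<Phi> \<Upsilon>)") auto
  have f: "f = \<phi> p" using fst_whitney_chart[of \<phi> "\<Phi> \<Upsilon>"] w proj[OF T2(1)] pi by simp
  have "whitney_chart \<psi> (\<Phi> \<Upsilon>) = (D [] f, D [a] f, D [b] f)"
    by (rule whitney_chart_change[OF \<Phi>_set[OF T2(1)] U(1) _ V(1) _ D w]) (use pi U V proj[OF T2(1)] in auto)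
  moreover have "local_\<Phi> U \<phi> (\<phi> p, g, k) = (f, a, b)" using local_\<Phi>[OF U(1) \<Upsilon>(1)] \<Upsilon>(2) w by simp
  moreover have "local_\<Phi> V \<psi> (T2_chart \<psi> \<Upsilon>) = whitney_chart \<psi> (\<Phi> \<Upsilon>)" by (rule local_\<Phi>[OF V(1) \<Upsilon>V])
  moreover have "T2_chart \<psi> \<Upsilon> \<in> T2_chart \<psi> ` T2_over V" using \<Upsilon>V by (rule imageI)
  ultimately show "(D [] (\<phi> p), D [g] (\<phi> p), D [g, g] (\<phi> p) + D [k] (\<phi> p)) \<in> T2_chart \<psi> ` T2_over V \<and>
      jet_\<Phi> V \<psi> [] (D [] (\<phi> p), D [g] (\<phi> p), D [g, g] (\<phi> p) + D [k] (\<phi> p)) =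
      (D [] (\<phi> p), D [fst (snd (jet_\<Phi> U \<phi> [] (\<phi> p, g, k)))] (\<phi> p), D [snd (snd (jet_\<Phi> U \<phi> [] (\<phi> p, g, k)))] (\<phi> p))"
    by (simp add: ch f)
qed

text \<open>The image of the chart of \<open>TM \<oplus> TM\<close> is open because the inverse of the splitting is of class MC
  there, so velocities near 0 occur; reparametrization gives all others.\<close>

lemma ex_tangent_vector:
  assumes U: "(U, \<phi>) \<in> atlas M" "p \<in> U"
  shows "\<exists>\<xi>\<in>tangent_set M. tproj \<xi> = p \<and> tchart F \<phi> \<xi> = (\<phi> p, v)"
proof -
  let ?W = "whitney_chart \<phi> ` whitney_over U"
  interpret fd: fiber_diffeo F "T2_chart \<phi> ` T2_over U" ?W "jet_\<Phi> U \<phi>" "jet_\<Gamma> U \<phi>"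
    by (rule fiber_diffeo_charts[OF U(1)])
  have p: "p \<in> pts M" using openin_subset[OF chart_open[OF U(1)]] U(2) by blast
  note cp = smooth_curve_const[OF p]
  \<comment> \<open>The zero vector over p: the pair of two copies lies over the point
    \<open>(\<phi> p, 0, 0)\<close>, around which the open image contains short vectors in the
    direction v.\<close>
  define \<zeta> where "\<zeta> = jet1 M (\<lambda>t. p)"
  have \<zeta>: "\<zeta> \<in> tangent_set M" "tproj \<zeta> = p" "tchart F \<phi> \<zeta> = (\<phi> p, 0)"
    using tchart_jet1[OF cp U(1)] U(2)
    by (simp_all add: \<zeta>_def jet1_in_tangent_set[OF cp] tproj_jet1[OF cp] velocity_const o_def)
  have "(\<zeta>, \<zeta>) \<in> whitney_over U" using \<zeta> U by (simp add: whitney_over_def whitney_set_def whitney_proj_def)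
  moreover have "whitney_chart \<phi> (\<zeta>, \<zeta>) = (\<phi> p, 0, 0)" using \<zeta> by (simp add: whitney_chart_def tvec_eq)
  ultimately have 0: "(\<phi> p, 0, 0) \<in> ?W" by (metis imageI)
  have "\<forall>\<^sub>F t in at 0. (\<phi> p, 0, 0) + t *\<^sub>R (0, v, 0) \<in> ?W"
    by (rule eventually_line_in_open[OF F3 MC_inf_open[OF local_\<Gamma>_MC_inf[OF U(1)]] 0])
  moreover have "\<forall>\<^sub>F t in at (0::real). t \<noteq> 0" by (simp add: eventually_at_filter)
  ultimately have "\<forall>\<^sub>F t in at 0. t \<noteq> 0 \<and> (\<phi> p, t *\<^sub>R v, 0) \<in> ?W" by eventually_elim simp
  then have "\<exists>t::real. t \<noteq> 0 \<and> (\<phi> p, t *\<^sub>R v, 0) \<in> ?W"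
    by (rule eventually_happens'[rotated]) simp
  then obtain t where t: "t \<noteq> 0" "(\<phi> p, t *\<^sub>R v, 0) \<in> ?W" by blast
  then obtain \<omega> where \<omega>: "\<omega> \<in> whitney_over U" "whitney_chart \<phi> \<omega> = (\<phi> p, t *\<^sub>R v, 0)" by force
  obtain \<xi> \<eta> where "\<omega> = (\<xi>, \<eta>)" by force
  then have \<xi>: "\<xi> \<in> tangent_set M" "tproj \<xi> \<in> U" "\<phi> (tproj \<xi>) = \<phi> p" "snd (tchart F \<phi> \<xi>) = t *\<^sub>R v"
    using \<omega> by (auto simp: whitney_over_def whitney_set_def whitney_proj_def whitney_chart_def tvec_eq)
  have \<xi>p: "tproj \<xi> = p" using inj_onD[OF chart_props(3)[OF U(1)] \<xi>(3,2) U(2)] .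
  have it: "inverse t \<noteq> 0" using t by simp
  note c = rep_smooth[OF \<xi>(1)]
  note c' = smooth_curve_rescale[OF c it]
  have c0: "rep \<xi> 0 = p" using \<xi>p by (simp add: tproj_eq_rep)
  have "velocity F (\<phi> \<circ> (\<lambda>s. rep \<xi> (inverse t * s))) = inverse t *\<^sub>R velocity F (\<phi> \<circ> rep \<xi>)"
    by (rule velocity_rescale[OF c U(1) _ it]) (simp add: c0 U)
  also have "\<dots> = v" using \<xi>(4) t by (simp add: tchart_eq_rep)
  finally have "tchart F \<phi> (jet1 M (\<lambda>s. rep \<xi> (inverse t * s))) = (\<phi> p, v)"
    using tchart_jet1[OF c' U(1)] U(2) by (simp add: c0)
  then show ?thesis
    using jet1_in_tangent_set[OF c'] tproj_jet1[OF c'] by (intro bexI[of _ "jet1 M (\<lambda>s. rep \<xi> (inverse t * s))"]) (simp_all add: c0)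
qed

section \<open>The connection map\<close>

definition K_chart :: "'m set \<times> ('m \<Rightarrow> 'f) \<Rightarrow> 'm tan tan \<Rightarrow> 'f \<times> 'f" where
  "K_chart a \<Upsilon> = (case ttchart F (snd a) \<Upsilon> of ((f, g), (h, k)) \<Rightarrow> (f, k + \<tau> a f g h))"

text \<open>The choice asks for the right coordinates in all charts at once, so no chart has to be
  singled out for each point.\<close>

definition K :: "'m tan tan \<Rightarrow> 'm tan" where
  "K \<Upsilon> = (SOME \<xi>. \<xi> \<in> tangent_set M \<and> tproj \<xi> = pi2 M \<Upsilon> \<and>
     (\<forall>(U, \<phi>)\<in>atlas M. pi2 M \<Upsilon> \<in> U \<longrightarrow> tchart F \<phi> \<xi> = K_chart (U, \<phi>) \<Upsilon>))"

text \<open>A tangent vector with the prescribed coordinates in one chart exists by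
  \<open>ex_tangent_vector\<close>. It has the prescribed coordinates in every other chart because
  the inhomogeneous terms of \<tau> and of the fourth coordinate k match.\<close>

lemma K:
  assumes \<Upsilon>: "\<Upsilon> \<in> tangent_set TM"
  shows "K \<Upsilon> \<in> tangent_set M" "tproj (K \<Upsilon>) = pi2 M \<Upsilon>"
    "(V, \<psi>) \<in> atlas M \<Longrightarrow> pi2 M \<Upsilon> \<in> V \<Longrightarrow> tchart F \<psi> (K \<Upsilon>) = K_chart (V, \<psi>) \<Upsilon>"
proof -
  obtain U \<phi> where U: "(U, \<phi>) \<in> atlas M" "pi2 M \<Upsilon> \<in> U" by (rule obtain_chart[OF pi2_pts[OF \<Upsilon>]])
  obtain f g h k where tt: "ttchart F \<phi> \<Upsilon> = ((f, g), (h, k))" by (metis surj_pair)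
  have f: "f = \<phi> (pi2 M \<Upsilon>)" using fst_ttchart[OF \<Upsilon>, of \<phi>] tt by simp
  obtain \<xi> where \<xi>: "\<xi> \<in> tangent_set M" "tproj \<xi> = pi2 M \<Upsilon>" "tchart F \<phi> \<xi> = (f, k + \<tau> (U, \<phi>) f g h)"
    using ex_tangent_vector[OF U] unfolding f by blast
  have "tchart F \<psi> \<xi> = K_chart (V, \<psi>) \<Upsilon>" if V: "(V, \<psi>) \<in> atlas M" "pi2 M \<Upsilon> \<in> V" for V \<psi>
  proof -
    obtain S D where D: "jet F F S D" "\<And>p. p \<in> U \<inter> V \<Longrightarrow> \<phi> p \<in> S \<and> D [] (\<phi> p) = \<psi> p"
      using transition_jet[OF U(1) V(1)] by blast
    have S: "f \<in> S" using D(2) U V f by simp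
    have "tchart F \<psi> \<xi> = (D [] f, D [k + \<tau> (U, \<phi>) f g h] f)"
      using tchart_change[OF \<xi>(1) U(1) _ V(1) _ D] U V \<xi> by (simp add: f)
    also have "D [k + \<tau> (U, \<phi>) f g h] f = D [k] f + D [\<tau> (U, \<phi>) f g h] f"
      by (rule linear_add[OF jet_linear_hd[OF F F D(1) S]])
    \<comment> \<open>The term \<open>D [h, g] f\<close> that appears here is the one that
      \<open>ttchart_change\<close> adds to \<open>D [k] f\<close>.\<close>
    also have "D [\<tau> (U, \<phi>) f g h] f = \<tau> (V, \<psi>) (D [] f) (D [g] f) (D [h] f) + D [h, g] f"
      unfolding f by (rule \<tau>_change[OF U V D, symmetric])
    also have "(D [] f, D [k] f + (\<tau> (V, \<psi>) (D [] f) (D [g] f) (D [h] f) + D [h, g] f)) = K_chart (V, \<psi>) \<Upsilon>"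
      using ttchart_change[OF \<Upsilon> U V D tt] by (simp add: K_chart_def add_ac)
    finally show ?thesis .
  qed
  then have "\<exists>\<xi>. \<xi> \<in> tangent_set M \<and> tproj \<xi> = pi2 M \<Upsilon> \<and>
     (\<forall>(U, \<phi>)\<in>atlas M. pi2 M \<Upsilon> \<in> U \<longrightarrow> tchart F \<phi> \<xi> = K_chart (U, \<phi>) \<Upsilon>)"
    using \<xi> by (intro exI[of _ \<xi>]) auto
  from someI_ex[OF this, folded K_def]
  have *: "K \<Upsilon> \<in> tangent_set M" "tproj (K \<Upsilon>) = pi2 M \<Upsilon>"
    "\<forall>(U, \<phi>)\<in>atlas M. pi2 M \<Upsilon> \<in> U \<longrightarrow> tchart F \<phi> (K \<Upsilon>) = K_chart (U, \<phi>) \<Upsilon>" by simp_all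
  then show "K \<Upsilon> \<in> tangent_set M" "tproj (K \<Upsilon>) = pi2 M \<Upsilon>" by simp_all
  show "tchart F \<psi> (K \<Upsilon>) = K_chart (V, \<psi>) \<Upsilon>" if "(V, \<psi>) \<in> atlas M" "pi2 M \<Upsilon> \<in> V"
    using bspec[OF *(3) that(1)] that(2) by simp
qed

lemma linear_connection_K: "linear_connection M K"
  unfolding linear_connection_def
proof (intro exI conjI)
  have zero: "(x, 0, 0) \<in> T2_chart \<phi> ` T2_over U" if "(U, \<phi>) \<in> atlas M" "x \<in> \<phi> ` U" for U \<phi> x
    using zero_in_T2_chart[OF that(1)] that(2) by auto
  show "connection_with M \<tau> K"
    unfolding connection_with_def model_M pts_TTM
  proof (intro ballI, clarify, intro conjI ballI allI impI)
    fix U \<phi> assume U: "(U, \<phi>) \<in> atlas M"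
    interpret fd: fiber_diffeo F "T2_chart \<phi> ` T2_over U" "whitney_chart \<phi> ` whitney_over U" "jet_\<Phi> U \<phi>" "jet_\<Gamma> U \<phi>"
      by (rule fiber_diffeo_charts[OF U])
    show "\<tau> (U, \<phi>) x y \<in> Lip_maps F F" if "x \<in> \<phi> ` U" for x y
      using fd.\<tau>_Lip[OF zero[OF U that]] by (simp add: \<tau>_def)
    show "MC_inf (max_metric FF F) F ((\<phi> ` U \<times> UNIV) \<times> UNIV) (\<lambda>((x, y), h). \<tau> (U, \<phi>) x y h)"
      using fd.\<tau>_MC_inf[OF chart_props(2)[OF U] zero[OF U]] by (simp add: \<tau>_def)
    fix \<Upsilon> assume \<Upsilon>: "\<Upsilon> \<in> tangent_set TM" "pi2 M \<Upsilon> \<in> U"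
    show "K \<Upsilon> \<in> tangent_set M" "tproj (K \<Upsilon>) \<in> U" using K[OF \<Upsilon>(1)] \<Upsilon>(2) by simp_all
    show "tchart F \<phi> (K \<Upsilon>) = (case ttchart F \<phi> \<Upsilon> of ((f, g), (h, k)) \<Rightarrow> (f, k + \<tau> (U, \<phi>) f g h))"
      using K(3)[OF \<Upsilon>(1) U \<Upsilon>(2)] by (simp add: K_chart_def)
  qed
  have "linear (\<lambda>(g, k). k + \<tau> (U, \<phi>) x g h)" if U: "(U, \<phi>) \<in> atlas M" and x: "x \<in> \<phi> ` U" for U \<phi> x h
  proof -
    interpret fd: fiber_diffeo F "T2_chart \<phi> ` T2_over U" "whitney_chart \<phi> ` whitney_over U" "jet_\<Phi> U \<phi>" "jet_\<Gamma> U \<phi>"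
      by (rule fiber_diffeo_charts[OF U])
    have "linear (\<lambda>g. \<tau> (U, \<phi>) x g h)"
      using fd.\<tau>_bilinear(2)[OF zero[OF U x]] by (simp add: \<tau>_def)
    from linear_compose_add[OF linear_snd linear_compose[OF linear_fst this]]
    show ?thesis by (simp add: o_def case_prod_beta')
  qed
  then show "\<forall>(U, \<phi>)\<in>atlas M. \<forall>x\<in>\<phi> ` U. \<forall>h. linear (\<lambda>(g, k). k + \<tau> (U, \<phi>) x g h)" by auto
qed

end

theorem theorem4p2:
  fixes F :: "'f::real_vector metric" and M :: "('m, 'f) mfd"
  assumes "frechet_space F" and "mspace F = UNIV"
    and "bounded_frechet_manifold F M"
    and "\<exists>add scl \<Phi>.
      MC_vector_bundle (max_metric F F) M (T2_bundle M) (pi2 M) add scl \<and>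
      vector_bundle_iso M (T2_bundle M) (pi2 M) add scl
        (whitney_sum M) whitney_proj (whitney_add M) (whitney_scale M) \<Phi>"
  shows "\<exists>K. linear_connection M K"
proof -
  interpret frechet_manifold F M
    by unfold_locales (rule frechet_space_imp_standard_metric[OF assms(1,2)], rule assms(3))
  obtain add scl \<Phi> where vb: "MC_vector_bundle (max_metric F F) M (T2_bundle M) (pi2 M) add scl"
    and iso: "vector_bundle_iso M (T2_bundle M) (pi2 M) add scl
        (whitney_sum M) whitney_proj (whitney_add M) (whitney_scale M) \<Phi>" using assms(4) by blast
  have "MC_diffeo (T2_bundle M) (whitney_sum M) \<Phi>" using iso by (simp add: vector_bundle_iso_def)
  then obtain \<Gamma> where \<Gamma>: "MC_map (T2_bundle M) (whitney_sum M) \<Phi>" "MC_map (whitney_sum M) (T2_bundle M) \<Gamma>"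
    "\<forall>x\<in>pts (T2_bundle M). \<Gamma> (\<Phi> x) = x" "\<forall>y\<in>pts (whitney_sum M). \<Phi> (\<Gamma> y) = y"
    unfolding MC_diffeo_def by blast
  \<comment> \<open>The bundle structure makes \<open>T2_bundle M\<close> a bounded Frechet
    manifold, so its charts are homeomorphic maps and in particular injective: an element of T2M
    over U is determined by \<open>(f, g, k)\<close>.\<close>
  have inj: "inj_on (T2_chart \<phi>) (T2_over U)" if U: "(U, \<phi>) \<in> atlas M" for U \<phi>
  proof -
    have "bounded_frechet_manifold (model (T2_bundle M)) (T2_bundle M)" using vb by (simp add: MC_vector_bundle_def)
    then have "frechet_space (model (T2_bundle M))" "mspace (model (T2_bundle M)) = UNIV" and
      bm: "bounded_frechet_manifold (model (T2_bundle M)) (T2_bundle M)"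
      by (simp_all add: bounded_frechet_manifold_def)
    then interpret T2: frechet_manifold "model (T2_bundle M)" "T2_bundle M"
      by unfold_locales (rule frechet_space_imp_standard_metric)
    show ?thesis
      by (rule T2.chart_props(3)) (use U in \<open>auto simp: atlas_T2 intro: rev_image_eqI\<close>)
  qed
  interpret splitting F M \<Phi> \<Gamma>
    by unfold_locales (use \<Gamma> iso inj in \<open>auto simp: pts_T2 pts_whitney_sum vector_bundle_iso_def\<close>)
  show ?thesis using linear_connection_K by blast
qed

end
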